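(* Let $T'$ be a complete countable NIP theory in a language $\mathcal L'$ with monster model $\mathcal U$, let $F\subseteq\mathcal U$ be a small subset, and let $T=\mathrm{Th}(\mathcal U_F)$ in the language $\mathcal L=\mathcal L'(F)$ (with monster model again denoted $\mathcal U$). Suppose $X$ is a $\emptyset$-definable (in $\mathcal L$) subset of a sort of $\mathcal U$, and let $T_X:=\mathrm{Th}(X(\mathcal U)_{\mathrm{ind}})$. Suppose $T_X$ is stable. Let $N\vDash T_X$. Then there exists $M\vDash T$ such that $N=X(M)_{\mathrm{ind}}$. Moreover, if $N_1\prec N_2\vDash T_X$, and $M_1\vDash T$ is such that $X(M_1)=N_1$, then there is $M_2\succ M_1$ such that $X(M_2)=N_2$ (where $X(M_i)=N_i$ is read as the equality of structures $X(M_i)_{\mathrm{ind}}=N_i$).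
   Context: $\mathcal U$ is a large saturated model; small means of cardinality $<|\mathcal U|$. As usual with a monster model, all models, tuples and sets of parameters are assumed to be small and contained in (perhaps a collection of sorts from) $\mathcal U$ unless stated otherwise. $\mathcal U_F$ is the expansion of $\mathcal U$ by constants for the elements of $F$, and $\mathcal L'(F)$ is $\mathcal L'$ together with these constants. A theory is NIP if for every formula $\phi(x,y)$ the family $\{\phi(\mathcal U^x,b):b\in\mathcal U^y\}$ has finite VC-dimension; it is stable if no formula $\phi(x,y)$ has the order property (i.e. there are no $(a_i,b_i)_{i<\omega}$ such that $\phi(a_i,b_j)$ holds iff $i<j$). For a model $M\vDash T$, $X(M)$ is the set of realisations in $M$ of the formula defining $X$. The induced structure $A_{\mathrm{ind}}$ on a subset $A$ of $\mathcal U$ is the structure with universe $A$ in the language with a relation $R_{\phi(x)}$ for each $\mathcal L$-formula $\phi(x)$ (without parameters), interpreted as $\{a\in A^x:\mathcal U\vDash\phi(a)\}$. The symbol $\prec$ denotes elementary substructure. *)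

theory Defs
  imports Main "HOL-Library.Countable_Set"
begin

unbundle cardinal_syntax

section \<open>Many-sorted first-order logic\<close>

record ('s, 'f, 'r) lang =
  sorts :: "'s set"
  funs :: "'f set"
  rels :: "'r set"
  fun_args :: "'f \<Rightarrow> 's list"
  fun_res :: "'f \<Rightarrow> 's"
  rel_args :: "'r \<Rightarrow> 's list"

definition wf_lang :: "('s, 'f, 'r) lang \<Rightarrow> bool" where
  "wf_lang L \<longleftrightarrow>
     (\<forall>f\<in>funs L. set (fun_args L f) \<subseteq> sorts L \<and> fun_res L f \<in> sorts L) \<and>
     (\<forall>r\<in>rels L. set (rel_args L r) \<subseteq> sorts L)"

definition countable_lang :: "('s, 'f, 'r) lang \<Rightarrow> bool" where
  "countable_lang L \<longleftrightarrow> countable (sorts L) \<and> countable (funs L) \<and> countable (rels L)"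

text \<open>The variable \<open>(s, n)\<close> is the \<open>n\<close>-th variable of sort \<open>s\<close>.\<close>

type_synonym 's var = "'s \<times> nat"

datatype ('s, 'f) tm = Var "'s var" | Fn 'f "('s, 'f) tm list"

datatype ('s, 'f, 'r) fm =
    Bot
  | Eq "('s, 'f) tm" "('s, 'f) tm"
  | Rel 'r "('s, 'f) tm list"
  | Neg "('s, 'f, 'r) fm"
  | Conj "('s, 'f, 'r) fm" "('s, 'f, 'r) fm"
  | Ex "'s var" "('s, 'f, 'r) fm"

inductive has_sort :: "('s, 'f, 'r) lang \<Rightarrow> ('s, 'f) tm \<Rightarrow> 's \<Rightarrow> bool" for L where
  "fst x \<in> sorts L \<Longrightarrow> has_sort L (Var x) (fst x)"
| "f \<in> funs L \<Longrightarrow> list_all2 (has_sort L) ts (fun_args L f) \<Longrightarrow> has_sort L (Fn f ts) (fun_res L f)"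

primrec wf_fm :: "('s, 'f, 'r) lang \<Rightarrow> ('s, 'f, 'r) fm \<Rightarrow> bool" where
  "wf_fm L Bot \<longleftrightarrow> True"
| "wf_fm L (Eq t u) \<longleftrightarrow> (\<exists>s. has_sort L t s \<and> has_sort L u s)"
| "wf_fm L (Rel r ts) \<longleftrightarrow> r \<in> rels L \<and> list_all2 (has_sort L) ts (rel_args L r)"
| "wf_fm L (Neg \<phi>) \<longleftrightarrow> wf_fm L \<phi>"
| "wf_fm L (Conj \<phi> \<psi>) \<longleftrightarrow> wf_fm L \<phi> \<and> wf_fm L \<psi>"
| "wf_fm L (Ex x \<phi>) \<longleftrightarrow> fst x \<in> sorts L \<and> wf_fm L \<phi>"

primrec tm_vars :: "('s, 'f) tm \<Rightarrow> 's var set" where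
  "tm_vars (Var x) = {x}"
| "tm_vars (Fn f ts) = \<Union> (set (map tm_vars ts))"

primrec fv :: "('s, 'f, 'r) fm \<Rightarrow> 's var set" where
  "fv Bot = {}"
| "fv (Eq t u) = tm_vars t \<union> tm_vars u"
| "fv (Rel r ts) = \<Union> (set (map tm_vars ts))"
| "fv (Neg \<phi>) = fv \<phi>"
| "fv (Conj \<phi> \<psi>) = fv \<phi> \<union> fv \<psi>"
| "fv (Ex x \<phi>) = fv \<phi> - {x}"

definition var_tuple :: "('s, 'f, 'r) lang \<Rightarrow> 's var list \<Rightarrow> bool" where
  "var_tuple L xs \<longleftrightarrow> distinct xs \<and> fst ` set xs \<subseteq> sorts L"

definition formulas :: "('s, 'f, 'r) lang \<Rightarrow> 's var list \<Rightarrow> ('s, 'f, 'r) fm set" where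
  "formulas L xs = {\<phi>. wf_fm L \<phi> \<and> fv \<phi> \<subseteq> set xs}"

record ('s, 'f, 'r, 'a) fo_struct =
  carr :: "'s \<Rightarrow> 'a set"
  fun_int :: "'f \<Rightarrow> 'a list \<Rightarrow> 'a"
  rel_int :: "'r \<Rightarrow> 'a list set"

definition tuples :: "('s \<Rightarrow> 'a set) \<Rightarrow> 's list \<Rightarrow> 'a list set" where
  "tuples C ss = {as. list_all2 (\<lambda>a s. a \<in> C s) as ss}"

text \<open>
  Interpretations are normalised outside the language and the carriers, so that equality of
  \<open>L\<close>-structures is equality of records. Sorts may be empty: a definable set, and hence
  the structure induced on it, may be.
\<close>

definition is_struct :: "('s, 'f, 'r) lang \<Rightarrow> ('s, 'f, 'r, 'a) fo_struct \<Rightarrow> bool" where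
  "is_struct L M \<longleftrightarrow>
     (\<forall>s. s \<notin> sorts L \<longrightarrow> carr M s = {}) \<and>
     (\<forall>f as. if f \<in> funs L \<and> as \<in> tuples (carr M) (fun_args L f)
             then fun_int M f as \<in> carr M (fun_res L f)
             else fun_int M f as = undefined) \<and>
     (\<forall>r. if r \<in> rels L
          then rel_int M r \<subseteq> tuples (carr M) (rel_args L r)
          else rel_int M r = {})"

text \<open>
  Carriers of different sorts may overlap in the ambient type, so the elements of a structure are
  pairs of a sort and an element of that sort.
\<close>

definition elements :: "('s, 'f, 'r, 'a) fo_struct \<Rightarrow> ('s \<times> 'a) set" where
  "elements M = Sigma UNIV (carr M)"

primrec eval :: "('s, 'f, 'r, 'a) fo_struct \<Rightarrow> ('s var \<Rightarrow> 'a) \<Rightarrow> ('s, 'f) tm \<Rightarrow> 'a" where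
  "eval M v (Var x) = v x"
| "eval M v (Fn f ts) = fun_int M f (map (eval M v) ts)"

primrec sat :: "('s, 'f, 'r, 'a) fo_struct \<Rightarrow> ('s var \<Rightarrow> 'a) \<Rightarrow> ('s, 'f, 'r) fm \<Rightarrow> bool" where
  "sat M v Bot \<longleftrightarrow> False"
| "sat M v (Eq t u) \<longleftrightarrow> eval M v t = eval M v u"
| "sat M v (Rel r ts) \<longleftrightarrow> map (eval M v) ts \<in> rel_int M r"
| "sat M v (Neg \<phi>) \<longleftrightarrow> \<not> sat M v \<phi>"
| "sat M v (Conj \<phi> \<psi>) \<longleftrightarrow> sat M v \<phi> \<and> sat M v \<psi>"
| "sat M v (Ex x \<phi>) \<longleftrightarrow> (\<exists>a\<in>carr M (fst x). sat M (v(x := a)) \<phi>)"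

text \<open>\<open>holds M xs \<phi> as\<close> is \<open>M \<Turnstile> \<phi>(as)\<close>, for \<open>\<phi>\<close> in the variables \<open>xs\<close>.\<close>

definition holds ::
  "('s, 'f, 'r, 'a) fo_struct \<Rightarrow> 's var list \<Rightarrow> ('s, 'f, 'r) fm \<Rightarrow> 'a list \<Rightarrow> bool" where
  "holds M xs \<phi> as \<longleftrightarrow> sat M (\<lambda>x. the (map_of (zip xs as) x)) \<phi>"

text \<open>For \<open>xs\<close> a tuple of variables, \<open>pow C xs\<close> is the set written \<open>C\<^sup>x\<close>.\<close>

definition pow :: "('s \<Rightarrow> 'a set) \<Rightarrow> 's var list \<Rightarrow> 'a list set" where
  "pow C xs = tuples C (map fst xs)"

definition Th :: "('s, 'f, 'r) lang \<Rightarrow> ('s, 'f, 'r, 'a) fo_struct \<Rightarrow> ('s, 'f, 'r) fm set" where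
  "Th L M = {\<sigma> \<in> formulas L []. holds M [] \<sigma> []}"

definition models ::
  "('s, 'f, 'r) lang \<Rightarrow> ('s, 'f, 'r, 'a) fo_struct \<Rightarrow> ('s, 'f, 'r) fm set \<Rightarrow> bool" where
  "models L M T \<longleftrightarrow> is_struct L M \<and> (\<forall>\<sigma>\<in>T. holds M [] \<sigma> [])"

text \<open>Theories are identified with their sets of consequences; consistency is not part of this
  definition, and is provided by a model wherever it is used.\<close>

definition complete_theory :: "('s, 'f, 'r) lang \<Rightarrow> ('s, 'f, 'r) fm set \<Rightarrow> bool" where
  "complete_theory L T \<longleftrightarrow>
     T \<subseteq> formulas L [] \<and> (\<forall>\<sigma>\<in>formulas L []. \<sigma> \<in> T \<or> Neg \<sigma> \<in> T)"

text \<open>That the functions and relations of \<open>M\<close> are the restrictions of those of \<open>N\<close> is the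
  case of atomic \<open>\<phi>\<close>.\<close>

definition elem_sub ::
  "('s, 'f, 'r) lang \<Rightarrow> ('s, 'f, 'r, 'a) fo_struct \<Rightarrow> ('s, 'f, 'r, 'a) fo_struct \<Rightarrow> bool" where
  "elem_sub L M N \<longleftrightarrow>
     is_struct L M \<and> is_struct L N \<and> (\<forall>s. carr M s \<subseteq> carr N s) \<and>
     (\<forall>xs. var_tuple L xs \<longrightarrow>
        (\<forall>\<phi>\<in>formulas L xs. \<forall>as\<in>pow (carr M) xs. holds M xs \<phi> as \<longleftrightarrow> holds N xs \<phi> as))"

section \<open>Naming parameters, saturation, monster models\<close>

text \<open>\<open>L(A)\<close> and \<open>U\<^sub>A\<close>: the element \<open>(s, a)\<close> of \<open>A\<close> is named by the
  0-ary function symbol \<open>Inr (s, a)\<close>.\<close>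

definition const_lang ::
  "('s, 'f, 'r) lang \<Rightarrow> ('s \<times> 'a) set \<Rightarrow> ('s, 'f + 's \<times> 'a, 'r) lang" where
  "const_lang L A =
     \<lparr> sorts = sorts L, funs = Inl ` funs L \<union> Inr ` A, rels = rels L,
       fun_args = case_sum (fun_args L) (\<lambda>c. []),
       fun_res = case_sum (fun_res L) fst,
       rel_args = rel_args L \<rparr>"

definition const_struct ::
  "('s, 'f, 'r, 'a) fo_struct \<Rightarrow> ('s \<times> 'a) set \<Rightarrow> ('s, 'f + 's \<times> 'a, 'r, 'a) fo_struct" where
  "const_struct U A =
     \<lparr> carr = carr U,
       fun_int = case_sum (fun_int U)
                          (\<lambda>c as. if c \<in> A \<and> as = [] then snd c else undefined),
       rel_int = rel_int U \<rparr>"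

definition small :: "('s, 'f, 'r, 'a) fo_struct \<Rightarrow> 'b set \<Rightarrow> bool" where
  "small U A \<longleftrightarrow> |A| <o |elements U|"

definition saturated :: "('s, 'f, 'r) lang \<Rightarrow> ('s, 'f, 'r, 'a) fo_struct \<Rightarrow> bool" where
  "saturated L U \<longleftrightarrow>
     (\<forall>A s p. A \<subseteq> elements U \<and> small U A \<and> s \<in> sorts L \<and>
        p \<subseteq> formulas (const_lang L A) [(s, 0)] \<and>
        (\<forall>q. finite q \<and> q \<subseteq> p \<longrightarrow>
           (\<exists>a\<in>carr U s. \<forall>\<phi>\<in>q. holds (const_struct U A) [(s, 0)] \<phi> [a])) \<longrightarrow>
        (\<exists>a\<in>carr U s. \<forall>\<phi>\<in>p. holds (const_struct U A) [(s, 0)] \<phi> [a]))"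

text \<open>For countable languages; ``large'' amounts to uncountable, so that there are small models.\<close>

definition monster ::
  "('s, 'f, 'r) lang \<Rightarrow> ('s, 'f, 'r) fm set \<Rightarrow> ('s, 'f, 'r, 'a) fo_struct \<Rightarrow> bool" where
  "monster L T U \<longleftrightarrow> models L U T \<and> saturated L U \<and> uncountable (elements U)"

text \<open>
  The convention that models are small and contained in the monster model \<open>U\<close>: \<open>V\<close> is \<open>U\<close>,
  an expansion of \<open>U\<close> by constants, or the structure induced on a definable set of \<open>U\<close>, and
  \<open>T\<close> is its theory. Smallness always refers to \<open>U\<close>, since \<open>V\<close> may be finite.
\<close>

definition small_model_in ::
  "('s, 'f, 'r, 'a) fo_struct \<Rightarrow> ('t, 'g, 'q) lang \<Rightarrow> ('t, 'g, 'q, 'a) fo_struct \<Rightarrow>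
   ('t, 'g, 'q) fm set \<Rightarrow> ('t, 'g, 'q, 'a) fo_struct \<Rightarrow> bool" where
  "small_model_in U L V T M \<longleftrightarrow> models L M T \<and> elem_sub L M V \<and> small U (elements M)"

section \<open>NIP and stability\<close>

definition shatters :: "'x set set \<Rightarrow> 'x set \<Rightarrow> bool" where
  "shatters S A \<longleftrightarrow> (\<forall>B\<subseteq>A. \<exists>C\<in>S. C \<inter> A = B)"

definition finite_VC_dim :: "'x set set \<Rightarrow> bool" where
  "finite_VC_dim S \<longleftrightarrow> (\<exists>d. \<forall>A. finite A \<and> shatters S A \<longrightarrow> card A \<le> d)"

text \<open>
  NIP and stability of the complete theory of which \<open>U\<close> is a monster model. If \<open>U\<close> is
  saturated, then so is the structure induced on a definable set of \<open>U\<close>; so stability of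
  \<open>Th(X(U)\<^sub>i\<^sub>n\<^sub>d)\<close> is \<open>stable_in\<close> for \<open>X(U)\<^sub>i\<^sub>n\<^sub>d\<close>.
\<close>

definition NIP_in :: "('s, 'f, 'r) lang \<Rightarrow> ('s, 'f, 'r, 'a) fo_struct \<Rightarrow> bool" where
  "NIP_in L U \<longleftrightarrow>
     (\<forall>xs ys. var_tuple L (xs @ ys) \<longrightarrow>
        (\<forall>\<phi>\<in>formulas L (xs @ ys).
           finite_VC_dim {{as \<in> pow (carr U) xs. holds U (xs @ ys) \<phi> (as @ bs)} | bs.
                            bs \<in> pow (carr U) ys}))"

definition order_property ::
  "('s, 'f, 'r, 'a) fo_struct \<Rightarrow> 's var list \<Rightarrow> 's var list \<Rightarrow> ('s, 'f, 'r) fm \<Rightarrow> bool" where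
  "order_property U xs ys \<phi> \<longleftrightarrow>
     (\<exists>(a :: nat \<Rightarrow> 'a list) b.
        (\<forall>i. a i \<in> pow (carr U) xs \<and> b i \<in> pow (carr U) ys) \<and>
        (\<forall>i j. holds U (xs @ ys) \<phi> (a i @ b j) \<longleftrightarrow> i < j))"

definition stable_in :: "('s, 'f, 'r) lang \<Rightarrow> ('s, 'f, 'r, 'a) fo_struct \<Rightarrow> bool" where
  "stable_in L U \<longleftrightarrow>
     (\<forall>xs ys. var_tuple L (xs @ ys) \<longrightarrow>
        (\<forall>\<phi>\<in>formulas L (xs @ ys). \<not> order_property U xs ys \<phi>))"

section \<open>Definable sets and induced structure\<close>

definition realisations ::
  "('s, 'f, 'r, 'a) fo_struct \<Rightarrow> 's var \<Rightarrow> ('s, 'f, 'r) fm \<Rightarrow> 'a set" where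
  "realisations M x \<chi> = {a \<in> carr M (fst x). holds M [x] \<chi> [a]}"

text \<open>
  The structure \<open>A\<^sub>i\<^sub>n\<^sub>d\<close> on a subset \<open>A\<close> of the sort \<open>s\<close> of \<open>U\<close>. It has a single sort;
  the relation symbol \<open>R\<^bsub>\<phi>(x)\<^esub>\<close> is the pair of the tuple \<open>x\<close> of variables of sort \<open>s\<close> and
  the formula \<open>\<phi>\<close>.
\<close>

definition ind_lang ::
  "('s, 'f, 'r) lang \<Rightarrow> 's \<Rightarrow> (unit, unit, 's var list \<times> ('s, 'f, 'r) fm) lang" where
  "ind_lang L s =
     \<lparr> sorts = UNIV, funs = {},
       rels = {(xs, \<phi>). var_tuple L xs \<and> fst ` set xs \<subseteq> {s} \<and> \<phi> \<in> formulas L xs},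
       fun_args = undefined, fun_res = undefined,
       rel_args = (\<lambda>(xs, \<phi>). replicate (length xs) ()) \<rparr>"

definition induced ::
  "('s, 'f, 'r) lang \<Rightarrow> ('s, 'f, 'r, 'a) fo_struct \<Rightarrow> 's \<Rightarrow> 'a set \<Rightarrow>
   (unit, unit, 's var list \<times> ('s, 'f, 'r) fm, 'a) fo_struct" where
  "induced L U s A =
     \<lparr> carr = (\<lambda>_. A), fun_int = (\<lambda>_ _. undefined),
       rel_int = (\<lambda>(xs, \<phi>). if (xs, \<phi>) \<in> rels (ind_lang L s)
                            then {as \<in> pow (\<lambda>_. A) xs. holds U xs \<phi> as} else {}) \<rparr>"

end

theory Submission
  imports Defs "HOL-Library.Ramsey" "HOL-Library.Multiset"
begin

text \<open>
  Call \<open>N \<subseteq> X\<close> \<^emph>\<open>met\<close> by a parameter set \<open>B\<close> if every \<open>B\<close>-definable set that intersects \<open>X\<close>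
  intersects \<open>N\<close>. An elementary substructure \<open>N\<close> of \<open>X(U)\<^sub>i\<^sub>n\<^sub>d\<close> is met by \<open>F \<union> N\<close>, and a set \<open>B \<supseteq> F \<union> N\<close>
  that meets \<open>N\<close> and intersects every non-empty \<open>B\<close>-definable set is the universe of an \<open>M \<prec> U\<^sub>F\<close>
  with \<open>X(M) = N\<close>. So it suffices to show that, given \<open>B\<close> meeting \<open>N\<close> and a non-empty
  \<open>B\<close>-definable set, an element \<open>c\<close> of that set can be added to \<open>B\<close>. By NIP and
  saturation there is a \<open>c\<close> whose type over \<open>B\<close> is compressible with respect to every formula:
  each finite part of the \<open>\<phi>\<close>-type follows from a bounded number of conditions in the type. Compressibility
  and the absence of the order property then yield the claim. For the second part, the traces on
  \<open>X\<close> of definable sets are definable with parameters in \<open>F \<union> X\<close> (by NIP and the stability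
  of \<open>X\<close>); therefore, with \<open>B\<^sub>1\<close> the universe of \<open>M\<^sub>1\<close>, the set \<open>B\<^sub>1 \<union> N\<^sub>2\<close> meets \<open>N\<^sub>2\<close>.
\<close>

section \<open>Compressible filters\<close>

text \<open>The language is countable only before the elements of \<open>F\<close> are named. So
  definability is over \<open>L'\<close>, with \<open>F\<close> among the parameters, and the
  formulas can be treated one after another along the natural numbers, each with its own bound on
  the number of conditions. This bound matters: boundedly many conditions on formulas of bounded
  index have finitely many shapes (indices and signs), so an order between elements of
  \<open>N\<close> and lists of conditions becomes, on an infinite subsequence, an order for one
  formula. The obstacle is that such an order has only one side in \<open>X\<close>, while stability
  of the induced structure excludes orders with both sides in \<open>X\<close>; NIP closes this gap
  in \<open>no_order\<close>. The same fact makes the local rank with splitting instances in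
  \<open>X\<close> finite, whence the definability of traces. Types are represented by filters, so
  that the bound survives limits of chains. Saturation concerns one variable, so tuples are found
  coordinate by coordinate. Whether \<open>B\<close> meets \<open>N\<close> depends on finitely many
  parameters at a time, so it passes to unions of chains, and Zorn's lemma can replace a transfinite
  construction.\<close>

definition agree :: "('c \<Rightarrow> 'p \<Rightarrow> bool) \<Rightarrow> ('p \<times> bool) set \<Rightarrow> 'c \<Rightarrow> bool" where
  "agree S C c \<longleftrightarrow> (\<forall>(y, t)\<in>C. S c y = t)"

text \<open>A filter stands for a partial type: an eventual property is implied by the type, a
  frequent one is consistent with it. Shattering therefore asks for consistency of every sign
  pattern on \<open>Z\<close> with the type, not for realisations chosen beforehand.\<close>

definition fshatters :: "('c \<Rightarrow> 'p \<Rightarrow> bool) \<Rightarrow> 'c filter \<Rightarrow> 'p set \<Rightarrow> bool" where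
  "fshatters S D Z \<longleftrightarrow> (\<forall>b. \<exists>\<^sub>F c in D. \<forall>y\<in>Z. S c y = b y)"

definition decides :: "('c \<Rightarrow> 'p \<Rightarrow> bool) \<Rightarrow> 'p set \<Rightarrow> 'c filter \<Rightarrow> bool" where
  "decides S A D \<longleftrightarrow> (\<forall>a\<in>A. (\<forall>\<^sub>F c in D. S c a) \<or> (\<forall>\<^sub>F c in D. \<not> S c a))"

text \<open>Relative compressibility: modulo the base \<open>F\<close>, each consequence of
  \<open>D\<close> follows from at most \<open>k\<close> conditions belonging to \<open>D\<close>,
  with \<open>k\<close> independent of the consequence. Keeping a base allows one relation after the
  other to be handled.\<close>

definition compressible ::
  "('c \<Rightarrow> 'p \<Rightarrow> bool) \<Rightarrow> 'p set \<Rightarrow> nat \<Rightarrow> 'c filter \<Rightarrow> 'c filter \<Rightarrow> bool" where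
  "compressible S A k F D \<longleftrightarrow>
     (\<forall>P. eventually P D \<longrightarrow>
        (\<exists>C. fst ` C \<subseteq> A \<and> finite C \<and> card C \<le> k \<and>
             (\<forall>\<^sub>F c in D. agree S C c) \<and> (\<forall>\<^sub>F c in F. agree S C c \<longrightarrow> P c)))"

lemma compressibleD:
  assumes "compressible S A k F D" "eventually P D"
  obtains C where "fst ` C \<subseteq> A" "finite C" "card C \<le> k" "eventually (agree S C) D"
    "\<forall>\<^sub>F c in F. agree S C c \<longrightarrow> P c"
proof -
  have "eventually P D \<longrightarrow> (\<exists>C. fst ` C \<subseteq> A \<and> finite C \<and> card C \<le> k \<and>
      (\<forall>\<^sub>F c in D. agree S C c) \<and> (\<forall>\<^sub>F c in F. agree S C c \<longrightarrow> P c))"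
    using assms(1) unfolding compressible_def by (rule spec)
  with assms(2) that show ?thesis by auto
qed

lemma compressible_refl: "compressible S A 0 F F"
  unfolding compressible_def
  by (intro allI impI exI[of _ "{}"]) (auto simp: agree_def[abs_def])

text \<open>The implication from the \<open>l\<close> conditions to \<open>P\<close> is itself a
  consequence of \<open>D\<close>, so it can be compressed over \<open>F\<close> at the price of
  \<open>k\<close> further conditions.\<close>

lemma compressible_trans:
  assumes "compressible S A k F D" "compressible S A l D E" "E \<le> D"
  shows "compressible S A (k + l) F E"
  unfolding compressible_def
proof (intro allI impI)
  fix P assume "eventually P E"
  with assms(2) obtain C where C: "fst ` C \<subseteq> A" "finite C" "card C \<le> l" "eventually (agree S C) E"
    "\<forall>\<^sub>F c in D. agree S C c \<longrightarrow> P c"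
    by (rule compressibleD)
  from assms(1) C(5)
  obtain C' where C': "fst ` C' \<subseteq> A" "finite C'" "card C' \<le> k" "eventually (agree S C') D"
    "\<forall>\<^sub>F c in F. agree S C' c \<longrightarrow> agree S C c \<longrightarrow> P c"
    by (rule compressibleD)
  have "eventually (agree S C') E"
    using C'(4) \<open>E \<le> D\<close> by (simp add: le_filter_def)
  with C(4) have "\<forall>\<^sub>F c in E. agree S (C' \<union> C) c"
    by eventually_elim (auto simp: agree_def)
  moreover have "\<forall>\<^sub>F c in F. agree S (C' \<union> C) c \<longrightarrow> P c"
    using C'(5) by eventually_elim (auto simp: agree_def)
  moreover have "card (C' \<union> C) \<le> k + l"
    using card_Un_le[of C' C] C(3) C'(3) by linarith
  ultimately show "\<exists>C. fst ` C \<subseteq> A \<and> finite C \<and> card C \<le> k + l \<and>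
      eventually (agree S C) E \<and> (\<forall>\<^sub>F c in F. agree S C c \<longrightarrow> P c)"
    using C(1,2) C'(1,2) by (intro exI[of _ "C' \<union> C"]) auto
qed

text \<open>Zorn's lemma for decreasing filters. What is eventual in the infimum of a chain is
  eventual in a member, so the conditions of that member serve the infimum as well; for this the
  bound \<open>m\<close> has to be common to the whole chain.\<close>

lemma minimal_compressible:
  assumes "F \<noteq> bot"
  obtains D where "D \<noteq> bot" "D \<le> F" "compressible S A m F D"
    "\<And>E. E \<noteq> bot \<Longrightarrow> E \<le> D \<Longrightarrow> compressible S A m F E \<Longrightarrow> E = D"
proof -
  define DD where "DD = {D. D \<noteq> bot \<and> D \<le> F \<and> compressible S A m F D}"
  have "compressible S A m F F"
    using compressible_refl[of S A F] unfolding compressible_def by (meson le_trans zero_le)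
  then have F: "F \<in> DD" using assms by (simp add: DD_def)
  have "\<exists>D\<in>DD. \<forall>E\<in>DD. D \<ge> E \<longrightarrow> E = D"
  proof (rule predicate_Zorn)
    show "partial_order_on DD (relation_of (\<ge>) DD)"
      by (rule partial_order_on_relation_ofI) auto
  next
    fix C assume C: "C \<in> Chains (relation_of (\<ge>) DD)"
    then have sub: "C \<subseteq> DD" and lin: "\<And>D E. D \<in> C \<Longrightarrow> E \<in> C \<Longrightarrow> D \<le> E \<or> E \<le> D"
      by (auto simp: Chains_def relation_of_def)
    show "\<exists>u\<in>DD. \<forall>a\<in>C. a \<ge> u"
    proof (cases "C = {}")
      case True then show ?thesis using F by auto
    next
      case False
      have ev: "eventually P (Inf C) \<longleftrightarrow> (\<exists>D\<in>C. eventually P D)" for P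
        using False lin by (intro eventually_Inf_base) (auto intro: inf_greatest)
      have "Inf C \<noteq> bot"
        using sub ev[of "\<lambda>_. False"] by (auto simp: DD_def trivial_limit_def)
      moreover have "Inf C \<le> F"
        using sub False by (auto simp: DD_def intro: Inf_lower2)
      moreover have "compressible S A m F (Inf C)"
        unfolding compressible_def
      proof (intro allI impI)
        fix P assume "eventually P (Inf C)"
        then obtain D where "D \<in> C" "eventually P D" unfolding ev by (rule bexE)
        then show "\<exists>C'. fst ` C' \<subseteq> A \<and> finite C' \<and> card C' \<le> m \<and>
            eventually (agree S C') (Inf C) \<and> (\<forall>\<^sub>F c in F. agree S C' c \<longrightarrow> P c)"
          proof -
            have "compressible S A m F D" using \<open>D \<in> C\<close> sub by (auto simp: DD_def)
            then obtain C' where "fst ` C' \<subseteq> A" "finite C'" "card C' \<le> m" "eventually (agree S C') D"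
              "\<forall>\<^sub>F c in F. agree S C' c \<longrightarrow> P c"
              using \<open>eventually P D\<close> by (rule compressibleD)
            then show ?thesis using \<open>D \<in> C\<close> unfolding ev by (intro exI[of _ C'] conjI bexI[of _ D])
          qed
      qed
      ultimately show ?thesis by (intro bexI[of _ "Inf C"]) (auto simp: DD_def intro: Inf_lower)
    qed
  qed
  then show ?thesis using that by (force simp: DD_def)
qed

text \<open>Exchange step of Chen, Cheng and Tang: if \<open>D\<close> still shatters a set \<open>Z\<close> of the maximal size,
  then many conditions defining \<open>D\<close> can be traded for a single sign pattern on \<open>Z\<close>.\<close>

lemma exchange_conditions:
  assumes vc: "\<And>Z'. Z' \<subseteq> A \<Longrightarrow> finite Z' \<Longrightarrow> card Z' = Suc (card Z) \<Longrightarrow> \<not> fshatters S F Z'"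
    and Z: "Z \<subseteq> A" "finite Z" "Z \<noteq> {}" and sh: "fshatters S D Z" and DF: "D \<le> F"
    and m: "m = 2 ^ card Z * card Z + card Z"
    and C: "fst ` C \<subseteq> A" "finite C" "card C \<le> m" "eventually (agree S C) D"
  obtains B C' where "B \<subseteq> Z" "fst ` C' \<subseteq> A" "finite C'" "card C' \<le> m"
    "\<forall>c. agree S C c \<longrightarrow> (\<forall>y\<in>Z. S c y \<longleftrightarrow> y \<in> B) \<longrightarrow> agree S C' c"
    "\<forall>\<^sub>F c in F. agree S C' c \<longrightarrow> agree S C c \<and> (\<forall>y\<in>Z. S c y \<longleftrightarrow> y \<in> B)"
proof -
  \<comment> \<open>Each condition \<open>(x, t)\<close> of \<open>C\<close> is forced, modulo
    \<open>F\<close>, by some pattern on \<open>Z\<close>: the set \<open>insert x Z\<close> is too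
    large to be shattered by \<open>F\<close>, so a pattern on it is excluded, and that pattern has
    the wrong sign at \<open>x\<close> because \<open>D\<close> shatters \<open>Z\<close> while
    satisfying the condition.\<close>
  have D: "\<exists>B. B \<subseteq> Z \<and> (\<forall>\<^sub>F c in F. (\<forall>y\<in>Z. S c y \<longleftrightarrow> y \<in> B) \<longrightarrow> S c (fst e) = snd e)"
    if e: "e \<in> C" for e
  proof -
    obtain x t where xt: "e = (x, t)" by force
    have evx: "\<forall>\<^sub>F c in D. S c x = t"
      using C(4) by eventually_elim (use e xt in \<open>auto simp: agree_def\<close>)
    have "x \<notin> Z"
    proof
      assume "x \<in> Z"
      have "\<exists>\<^sub>F c in D. \<forall>y\<in>Z. S c y = (\<not> t)" using sh unfolding fshatters_def by (rule allE)
      then have "\<exists>\<^sub>F c in D. S c x = (\<not> t)"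
        by (rule frequently_elim1) (use \<open>x \<in> Z\<close> in auto)
      with evx show False by (auto simp: frequently_def elim: eventually_mono)
    qed
    then have "\<not> fshatters S F (insert x Z)"
      using e xt C(1) Z by (intro vc) auto
    then obtain b where "\<not> (\<exists>\<^sub>F c in F. \<forall>y\<in>insert x Z. S c y = b y)"
      unfolding fshatters_def by blast
    then have b: "\<forall>\<^sub>F c in F. \<not> (\<forall>y\<in>insert x Z. S c y = b y)"
      by (simp add: not_frequently)
    have "b x \<noteq> t"
    proof
      assume "b x = t"
      have "\<forall>\<^sub>F c in D. \<not> (\<forall>y\<in>insert x Z. S c y = b y)"
        using b DF by (simp add: le_filter_def)
      with evx have "\<forall>\<^sub>F c in D. \<not> (\<forall>y\<in>Z. S c y = b y)"
        by eventually_elim (use \<open>b x = t\<close> in auto)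
      moreover have "\<exists>\<^sub>F c in D. \<forall>y\<in>Z. S c y = b y"
        using sh unfolding fshatters_def by (rule allE)
      ultimately show False by (simp add: frequently_def)
    qed
    then have "\<forall>\<^sub>F c in F. (\<forall>y\<in>Z. S c y \<longleftrightarrow> y \<in> {y\<in>Z. b y}) \<longrightarrow> S c (fst e) = snd e"
      using b by (auto simp: xt elim!: eventually_mono)
    then show ?thesis by (intro exI[of _ "{y\<in>Z. b y}"]) auto
  qed
  then have "\<forall>e\<in>C. \<exists>B. B \<subseteq> Z \<and> (\<forall>\<^sub>F c in F. (\<forall>y\<in>Z. S c y \<longleftrightarrow> y \<in> B) \<longrightarrow> S c (fst e) = snd e)"
    by (intro ballI)
  from bchoice[OF this] obtain f where f0: "\<forall>e\<in>C. f e \<subseteq> Z \<and>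
      (\<forall>\<^sub>F c in F. (\<forall>y\<in>Z. S c y \<longleftrightarrow> y \<in> f e) \<longrightarrow> S c (fst e) = snd e)"
    by (elim exE)
  then have f: "\<And>e. e \<in> C \<Longrightarrow> f e \<subseteq> Z"
    "\<And>e. e \<in> C \<Longrightarrow> \<forall>\<^sub>F c in F. (\<forall>y\<in>Z. S c y \<longleftrightarrow> y \<in> f e) \<longrightarrow> S c (fst e) = snd e"
    by simp_all
  \<comment> \<open>Pigeonhole over the \<open>2 ^ card Z\<close> patterns: among more than
    \<open>2 ^ card Z * card Z\<close> conditions, at least \<open>card Z\<close> are forced by the
    same pattern. The second summand of \<open>m\<close> leaves room for the conditions that
    describe the pattern.\<close>
  have "\<exists>B\<subseteq>Z. card C \<le> m - card Z \<or> card Z \<le> card {e\<in>C. f e = B}"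
  proof (rule ccontr)
    assume neg: "\<not> ?thesis"
    then have "card C > m - card Z" by auto
    have "C = (\<Union>B\<in>Pow Z. {e\<in>C. f e = B})" using f(1) by auto
    then have "card C = card (\<Union>B\<in>Pow Z. {e\<in>C. f e = B})" by (rule arg_cong)
    also have "\<dots> \<le> (\<Sum>B\<in>Pow Z. card {e\<in>C. f e = B})"
      by (rule card_UN_le) (use Z(2) in simp)
    also have "\<dots> \<le> (\<Sum>B\<in>Pow Z. card Z)"
      using neg by (intro sum_mono) (auto simp: not_le less_imp_le)
    also have "\<dots> = m - card Z" using Z(2) by (simp add: m card_Pow)
    finally show False using \<open>card C > m - card Z\<close> by simp
  qed
  then obtain B where B: "B \<subseteq> Z" "card C \<le> m - card Z \<or> card Z \<le> card {e\<in>C. f e = B}" by blast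
  \<comment> \<open>The conditions forced by \<open>B\<close> are dropped and replaced by the
    description of \<open>B\<close> on \<open>Z\<close>.\<close>
  define W where "W = {e\<in>C. f e = B}"
  define C' where "C' = (C - W) \<union> (\<lambda>y. (y, y \<in> B)) ` Z"
  have agB: "agree S ((\<lambda>y. (y, y \<in> B)) ` Z) c \<longleftrightarrow> (\<forall>y\<in>Z. S c y \<longleftrightarrow> y \<in> B)" for c
    by (auto simp: agree_def)
  have "card C' \<le> card (C - W) + card Z"
    unfolding C'_def using card_Un_le card_image_le[OF Z(2)] by (meson add_left_mono order_trans)
  also have "card (C - W) = card C - card W" using C(2) by (intro card_Diff_subset) (auto simp: W_def)
  also have "card C - card W + card Z \<le> m"
    using B(2) C(3) m card_mono[of C W] C(2) by (auto simp: W_def)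
  finally have card: "card C' \<le> m" .
  have "\<forall>\<^sub>F c in F. \<forall>e\<in>W. (\<forall>y\<in>Z. S c y \<longleftrightarrow> y \<in> B) \<longrightarrow> S c (fst e) = snd e"
    using C(2) f(2) by (intro eventually_ball_finite) (auto simp: W_def)
  then have "\<forall>\<^sub>F c in F. agree S C' c \<longrightarrow> agree S C c \<and> (\<forall>y\<in>Z. S c y \<longleftrightarrow> y \<in> B)"
  proof (rule eventually_mono, intro impI)
    fix c assume W: "\<forall>e\<in>W. (\<forall>y\<in>Z. S c y \<longleftrightarrow> y \<in> B) \<longrightarrow> S c (fst e) = snd e" and "agree S C' c"
    then have "agree S (C - W) c" and Zc: "\<forall>y\<in>Z. S c y \<longleftrightarrow> y \<in> B"
      unfolding agB[symmetric] by (simp_all add: C'_def agree_def ball_Un)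
    have "S c (fst e) = snd e" if "e \<in> C" for e
    proof (cases "e \<in> W")
      case True
      then show ?thesis using W Zc by blast
    next
      case False
      then show ?thesis using \<open>agree S (C - W) c\<close> that by (simp add: agree_def split_beta)
    qed
    then show "agree S C c \<and> (\<forall>y\<in>Z. S c y \<longleftrightarrow> y \<in> B)"
      using Zc by (simp add: agree_def split_beta)
  qed
  then show ?thesis
    using B(1) C(1,2) Z card by (intro that[of B C']) (auto simp: C'_def agree_def)
qed

text \<open>Induction on the bound for shattered sets. A minimal refinement \<open>D\<close> of
  \<open>F\<close> with compression bound \<open>m\<close> cannot shatter a set of size
  \<open>Suc d\<close>, because the exchange would give a strictly smaller refinement with the same
  \<open>m\<close>. The induction hypothesis then applies to \<open>D\<close>, and the two bounds
  are added.\<close>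

theorem compressible_decides:
  assumes "F \<noteq> bot"
    and "\<And>Z. Z \<subseteq> A \<Longrightarrow> finite Z \<Longrightarrow> card Z = Suc d \<Longrightarrow> \<not> fshatters S F Z"
  shows "\<exists>k D. D \<noteq> bot \<and> D \<le> F \<and> compressible S A k F D \<and> decides S A D"
  using assms
proof (induction d arbitrary: F)
  case 0
  have "decides S A F"
    unfolding decides_def
  proof
    fix a assume "a \<in> A"
    then have "\<not> fshatters S F {a}" using 0(2)[of "{a}"] by simp
    then obtain b where "\<forall>\<^sub>F c in F. S c a \<noteq> b a"
      by (auto simp: fshatters_def not_frequently)
    then show "(\<forall>\<^sub>F c in F. S c a) \<or> (\<forall>\<^sub>F c in F. \<not> S c a)"
      by (cases "b a") auto
  qed
  then show ?case using 0(1) compressible_refl by blast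
next
  case (Suc d)
  define m :: nat where "m = 2 ^ Suc d * Suc d + Suc d"
  obtain D where D: "D \<noteq> bot" "D \<le> F" "compressible S A m F D"
    "\<And>E. E \<noteq> bot \<Longrightarrow> E \<le> D \<Longrightarrow> compressible S A m F E \<Longrightarrow> E = D"
    using minimal_compressible[OF Suc.prems(1), of S A m] by (metis (no_types, lifting))
  have "\<not> fshatters S D Z" if Z: "Z \<subseteq> A" "finite Z" "card Z = Suc d" for Z
  proof
    assume sh: "fshatters S D Z"
    have "Z \<noteq> {}" using Z by auto
    \<comment> \<open>What compressibility over \<open>F\<close> demands of \<open>P\<close>,
      written out for the restriction of \<open>D\<close> to the pattern \<open>B\<close> on
      \<open>Z\<close>.\<close>
    define good where "good P B \<longleftrightarrow> (\<exists>C'. fst ` C' \<subseteq> A \<and> finite C' \<and> card C' \<le> m \<and>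
       (\<forall>\<^sub>F c in D. (\<forall>y\<in>Z. S c y \<longleftrightarrow> y \<in> B) \<longrightarrow> agree S C' c) \<and>
       (\<forall>\<^sub>F c in F. agree S C' c \<longrightarrow> P c \<and> (\<forall>y\<in>Z. S c y \<longleftrightarrow> y \<in> B)))" for P B
    have ex: "\<exists>B\<subseteq>Z. good P B" if P: "eventually P D" for P
    proof -
      obtain C where C: "fst ` C \<subseteq> A" "finite C" "card C \<le> m" "eventually (agree S C) D"
        "\<forall>\<^sub>F c in F. agree S C c \<longrightarrow> P c"
        using D(3) P by (rule compressibleD)
      obtain B C' where B: "B \<subseteq> Z" "fst ` C' \<subseteq> A" "finite C'" "card C' \<le> m"
        "\<forall>c. agree S C c \<longrightarrow> (\<forall>y\<in>Z. S c y \<longleftrightarrow> y \<in> B) \<longrightarrow> agree S C' c"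
        "\<forall>\<^sub>F c in F. agree S C' c \<longrightarrow> agree S C c \<and> (\<forall>y\<in>Z. S c y \<longleftrightarrow> y \<in> B)"
        by (rule exchange_conditions[OF Suc.prems(2)[folded Z(3)] Z(1,2) \<open>Z \<noteq> {}\<close> sh D(2)
            m_def[folded Z(3)] C(1-4)])
      have "\<forall>\<^sub>F c in F. agree S C' c \<longrightarrow> P c \<and> (\<forall>y\<in>Z. S c y \<longleftrightarrow> y \<in> B)"
        using B(6) C(5) by eventually_elim auto
      moreover have "\<forall>\<^sub>F c in D. (\<forall>y\<in>Z. S c y \<longleftrightarrow> y \<in> B) \<longrightarrow> agree S C' c"
        using C(4) by eventually_elim (use B(5) in auto)
      ultimately show ?thesis
        using B(1-4) unfolding good_def by (intro exI[of _ B] conjI exI[of _ C'])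
    qed
    have good_mono: "good P' B" if g: "good P B" and imp: "\<And>c. P c \<Longrightarrow> P' c" for P P' B
    proof -
      obtain C' where C': "fst ` C' \<subseteq> A" "finite C'" "card C' \<le> m"
        "\<forall>\<^sub>F c in D. (\<forall>y\<in>Z. S c y \<longleftrightarrow> y \<in> B) \<longrightarrow> agree S C' c"
        "\<forall>\<^sub>F c in F. agree S C' c \<longrightarrow> P c \<and> (\<forall>y\<in>Z. S c y \<longleftrightarrow> y \<in> B)"
        using g unfolding good_def by (elim exE conjE)
      have "\<forall>\<^sub>F c in F. agree S C' c \<longrightarrow> P' c \<and> (\<forall>y\<in>Z. S c y \<longleftrightarrow> y \<in> B)"
        using C'(5) by eventually_elim (use imp in simp)
      then show ?thesis using C'(1-4) unfolding good_def by (intro exI[of _ C'] conjI)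
    qed
    \<comment> \<open>The pattern supplied by the exchange depends on \<open>P\<close>. As there are
      only finitely many patterns, the conjunction of one counterexample for each of them would have
      no good pattern at all; so a single pattern serves every \<open>P\<close>.\<close>
    have "\<exists>B\<subseteq>Z. \<forall>P. eventually P D \<longrightarrow> good P B"
    proof (rule ccontr)
      assume "\<not> ?thesis"
      then have "\<forall>B. \<exists>P. B \<subseteq> Z \<longrightarrow> eventually P D \<and> \<not> good P B" by simp
      from choice[OF this]
      obtain P where "\<forall>B. B \<subseteq> Z \<longrightarrow> eventually (P B) D \<and> \<not> good (P B) B" by (elim exE)
      then have P: "\<And>B. B \<subseteq> Z \<Longrightarrow> eventually (P B) D" "\<And>B. B \<subseteq> Z \<Longrightarrow> \<not> good (P B) B"
        by simp_all
      have "\<forall>\<^sub>F c in D. \<forall>B\<in>Pow Z. P B c"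
        using P(1) Z(2) by (intro eventually_ball_finite) auto
      from ex[OF this] obtain B where "B \<subseteq> Z" and B: "good (\<lambda>c. \<forall>B\<in>Pow Z. P B c) B"
        by (elim exE conjE)
      have "good (P B) B" by (rule good_mono[OF B]) (use \<open>B \<subseteq> Z\<close> in simp)
      with P(2)[OF \<open>B \<subseteq> Z\<close>] show False ..
    qed
    then obtain B where B: "B \<subseteq> Z" "\<forall>P. eventually P D \<longrightarrow> good P B" by (elim exE conjE)
    define E where "E = inf D (principal {c. \<forall>y\<in>Z. S c y \<longleftrightarrow> y \<in> B})"
    have evE: "eventually P E \<longleftrightarrow> (\<forall>\<^sub>F c in D. (\<forall>y\<in>Z. S c y \<longleftrightarrow> y \<in> B) \<longrightarrow> P c)" for P
      by (simp add: E_def eventually_inf_principal)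
    have shZ: "\<exists>\<^sub>F c in D. \<forall>y\<in>Z. S c y = b y" for b
      using sh unfolding fshatters_def by (rule allE)
    have "E \<noteq> bot"
      using shZ[of "\<lambda>y. y \<in> B"] unfolding trivial_limit_def evE by (simp add: frequently_def)
    moreover have "E \<le> D" by (simp add: E_def)
    moreover have "compressible S A m F E"
      unfolding compressible_def
    proof (intro allI impI)
      fix P assume "eventually P E"
      then have "good (\<lambda>c. (\<forall>y\<in>Z. S c y \<longleftrightarrow> y \<in> B) \<longrightarrow> P c) B"
        unfolding evE by (rule B(2)[THEN spec, THEN mp])
      then obtain C' where C': "fst ` C' \<subseteq> A" "finite C'" "card C' \<le> m"
        "\<forall>\<^sub>F c in D. (\<forall>y\<in>Z. S c y \<longleftrightarrow> y \<in> B) \<longrightarrow> agree S C' c"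
        "\<forall>\<^sub>F c in F. agree S C' c \<longrightarrow>
           ((\<forall>y\<in>Z. S c y \<longleftrightarrow> y \<in> B) \<longrightarrow> P c) \<and> (\<forall>y\<in>Z. S c y \<longleftrightarrow> y \<in> B)"
        unfolding good_def by (elim exE conjE)
      have "\<forall>\<^sub>F c in F. agree S C' c \<longrightarrow> P c"
        using C'(5) by eventually_elim auto
      with C'(1-4) show "\<exists>C. fst ` C \<subseteq> A \<and> finite C \<and> card C \<le> m \<and>
           eventually (agree S C) E \<and> (\<forall>\<^sub>F c in F. agree S C c \<longrightarrow> P c)"
        unfolding evE by (intro exI[of _ C'] conjI)
    qed
    \<comment> \<open>By minimality \<open>D\<close> already implies the pattern \<open>B\<close>,
      whereas shattering makes it consistent with the complementary pattern, which differs from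
      \<open>B\<close> as \<open>Z\<close> is non-empty.\<close>
    ultimately have "E = D" using D(4) by blast
    obtain x where "x \<in> Z" using \<open>Z \<noteq> {}\<close> by blast
    have "\<forall>\<^sub>F c in D. \<forall>y\<in>Z. S c y \<longleftrightarrow> y \<in> B"
      using evE[of "\<lambda>c. \<forall>y\<in>Z. S c y \<longleftrightarrow> y \<in> B"] \<open>E = D\<close> by simp
    then have "\<forall>\<^sub>F c in D. \<not> (\<forall>y\<in>Z. S c y = (y \<notin> B))"
      by (rule eventually_mono) (use \<open>x \<in> Z\<close> in auto)
    then show False using shZ[of "\<lambda>y. y \<notin> B"] by (simp add: frequently_def)
  qed
  then obtain k D' where D': "D' \<noteq> bot" "D' \<le> D" "compressible S A k D D'" "decides S A D'"
    using Suc.IH[OF D(1)] by blast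
  then show ?case using compressible_trans[OF D(3) D'(3,2)] D(2)
    by (intro exI[of _ "m + k"] exI[of _ D'] conjI) (auto intro: order_trans)
qed

text \<open>The conditions are listed as triples consisting of the index of a relation, a parameter and
  a sign.\<close>

definition obeys :: "(nat \<Rightarrow> 'c \<Rightarrow> 'p \<Rightarrow> bool) \<Rightarrow> (nat \<times> 'p \<times> bool) list \<Rightarrow> 'c \<Rightarrow> bool" where
  "obeys S l c \<longleftrightarrow> (\<forall>(j, y, t)\<in>set l. S j c y = t)"

lemma obeys_append: "obeys S (l @ map (Pair i) e) c \<longleftrightarrow> obeys S l c \<and> agree (S i) (set e) c"
  unfolding obeys_def agree_def by (simp add: ball_Un)

text \<open>The filters are refined one relation at a time: stage \<open>Suc i\<close> decides
  relation \<open>i\<close> and is compressible over stage \<open>i\<close>. Unwinding the stages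
  down to the principal filter turns conditions modulo stage \<open>i\<close> into conditions on
  \<open>\<Theta>\<close>, at the cost of admitting relations of smaller index; the resulting bound
  depends on \<open>i\<close> alone.\<close>

theorem compressible_sequence:
  fixes S :: "nat \<Rightarrow> 'c \<Rightarrow> 'p \<Rightarrow> bool"
  assumes "\<Theta> \<noteq> {}"
    and vc: "\<And>i. \<exists>d. \<forall>Z\<subseteq>A i. finite Z \<and> card Z = Suc d \<longrightarrow> (\<exists>b. \<forall>c\<in>\<Theta>. \<exists>y\<in>Z. S i c y \<noteq> b y)"
  shows "\<exists>D. D \<noteq> bot \<and> D \<le> principal \<Theta> \<and>
     (\<forall>i. \<exists>K. \<forall>Z\<subseteq>A i \<times> UNIV. finite Z \<longrightarrow> (\<forall>(y, t)\<in>Z. \<forall>\<^sub>F c in D. S i c y = t) \<longrightarrow>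
        (\<exists>l. length l \<le> K \<and> (\<forall>(j, y, t)\<in>set l. j \<le> i \<and> y \<in> A j \<and> (\<forall>\<^sub>F c in D. S j c y = t)) \<and>
             (\<forall>c\<in>\<Theta>. obeys S l c \<longrightarrow> agree (S i) Z c))) \<and>
     (\<forall>i. decides (S i) (A i) D)"
proof -
  have "\<exists>D. \<forall>i. (D i \<noteq> bot \<and> D i \<le> principal \<Theta> \<and> (i = 0 \<longrightarrow> D i = principal \<Theta>)) \<and>
     (D (Suc i) \<le> D i \<and> decides (S i) (A i) (D (Suc i)) \<and>
      (\<exists>k. compressible (S i) (A i) k (D i) (D (Suc i))))"
  proof (rule dependent_nat_choice, goal_cases)
    case 1 then show ?case using assms(1) by (auto simp: trivial_limit_def eventually_principal)
  next
    case (2 D i)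
    obtain d where d: "\<And>Z. Z \<subseteq> A i \<Longrightarrow> finite Z \<Longrightarrow> card Z = Suc d \<Longrightarrow>
        \<exists>b. \<forall>c\<in>\<Theta>. \<exists>y\<in>Z. S i c y \<noteq> b y"
      using vc by metis
    have "\<not> fshatters (S i) D Z" if Z: "Z \<subseteq> A i" "finite Z" "card Z = Suc d" for Z
    proof -
      obtain b where "\<forall>c\<in>\<Theta>. \<exists>y\<in>Z. S i c y \<noteq> b y" using d[OF Z] by blast
      then have "\<forall>\<^sub>F c in principal \<Theta>. \<not> (\<forall>y\<in>Z. S i c y = b y)" by (auto simp: eventually_principal)
      then have "\<forall>\<^sub>F c in D. \<not> (\<forall>y\<in>Z. S i c y = b y)" using 2 by (simp add: le_filter_def)
      then show ?thesis unfolding fshatters_def by (auto simp: frequently_def)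
    qed
    then show ?case
      using compressible_decides[of D "A i" d "S i"] 2 by (metis Suc_neq_Zero order_trans)
  qed
  then obtain D where D: "\<And>i. D i \<noteq> bot" "\<And>i. D i \<le> principal \<Theta>" "D 0 = principal \<Theta>"
     "\<And>i. D (Suc i) \<le> D i" "\<And>i. decides (S i) (A i) (D (Suc i))"
     "\<And>i. \<exists>k. compressible (S i) (A i) k (D i) (D (Suc i))" by metis
  define E where "E = (INF i. D i)"
  have anti: "antimono D" using D(4) by (simp add: antimono_iff_le_Suc)
  have ev: "eventually P E \<longleftrightarrow> (\<exists>i. eventually P (D i))" for P
    unfolding E_def
  proof (subst eventually_INF_base)
    show "\<exists>x\<in>UNIV. D x \<le> inf (D a) (D b)" for a b
      using anti by (intro bexI[of _ "max a b"]) (auto simp: antimono_def intro!: le_infI)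
  qed auto
  have ED: "E \<le> D i" for i by (simp add: E_def INF_lower)
  have lists: "\<exists>K. \<forall>P. eventually P (D i) \<longrightarrow>
     (\<exists>l. length l \<le> K \<and> (\<forall>(j, y, t)\<in>set l. j < i \<and> y \<in> A j \<and> (\<forall>\<^sub>F c in D i. S j c y = t)) \<and>
          (\<forall>c\<in>\<Theta>. obeys S l c \<longrightarrow> P c))" for i
  proof (induction i)
    case 0 show ?case
      by (intro exI[of _ 0] allI impI exI[of _ "[]"]) (auto simp: D(3) eventually_principal)
  next
    case (Suc i)
    then obtain K where K: "\<forall>P. eventually P (D i) \<longrightarrow>
     (\<exists>l. length l \<le> K \<and> (\<forall>(j, y, t)\<in>set l. j < i \<and> y \<in> A j \<and> (\<forall>\<^sub>F c in D i. S j c y = t)) \<and>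
          (\<forall>c\<in>\<Theta>. obeys S l c \<longrightarrow> P c))" by (rule exE)
    obtain k where k: "compressible (S i) (A i) k (D i) (D (Suc i))" using D(6) by blast
    show ?case
    proof (intro exI[of _ "K + k"] allI impI)
      fix P assume "eventually P (D (Suc i))"
      with k obtain C where C: "fst ` C \<subseteq> A i" "finite C" "card C \<le> k"
        "eventually (agree (S i) C) (D (Suc i))" "\<forall>\<^sub>F c in D i. agree (S i) C c \<longrightarrow> P c"
        by (rule compressibleD)
      obtain l where l: "length l \<le> K"
        "\<forall>(j, y, t)\<in>set l. j < i \<and> y \<in> A j \<and> (\<forall>\<^sub>F c in D i. S j c y = t)"
        "\<forall>c\<in>\<Theta>. obeys S l c \<longrightarrow> agree (S i) C c \<longrightarrow> P c"
        using K[THEN spec, THEN mp, OF C(5)] by blast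
      obtain e where e: "set e = C" "length e = card C"
        using finite_distinct_list[OF C(2)] distinct_card by metis
      have e1: "\<forall>\<^sub>F c in D (Suc i). S i c y = t" if "(y, t) \<in> C" for y t
        using C(4) by eventually_elim (use that in \<open>auto simp: agree_def\<close>)
      have e2: "\<forall>\<^sub>F c in D (Suc i). S j c y = t" if "\<forall>\<^sub>F c in D i. S j c y = t" for j y t
        using that D(4) by (simp add: le_filter_def)
      have "j < Suc i \<and> y \<in> A j \<and> (\<forall>\<^sub>F c in D (Suc i). S j c y = t)"
        if jyt: "(j, y, t) \<in> set (l @ map (Pair i) e)" for j y t
      proof (cases "(j, y, t) \<in> set l")
        case True
        then have "j < i \<and> y \<in> A j \<and> (\<forall>\<^sub>F c in D i. S j c y = t)" using l(2) by auto
        then show ?thesis using e2[of j y t] by simp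
      next
        case False
        then have "j = i" "(y, t) \<in> C" using jyt e(1) by auto
        then show ?thesis using e1[of y t] C(1) by force
      qed
      then have "\<forall>(j, y, t)\<in>set (l @ map (Pair i) e).
          j < Suc i \<and> y \<in> A j \<and> (\<forall>\<^sub>F c in D (Suc i). S j c y = t)"
        by (intro ballI) (simp only: split_paired_all prod.case)
      moreover have "P c" if "c \<in> \<Theta>" "obeys S (l @ map (Pair i) e) c" for c
        using that l(3) e(1) by (simp add: obeys_append)
      ultimately show "\<exists>l. length l \<le> K + k \<and>
          (\<forall>(j, y, t)\<in>set l. j < Suc i \<and> y \<in> A j \<and> (\<forall>\<^sub>F c in D (Suc i). S j c y = t)) \<and>
          (\<forall>c\<in>\<Theta>. obeys S l c \<longrightarrow> P c)"
        using l(1) e(2) C(3) by (intro exI[of _ "l @ map (Pair i) e"] conjI) simp_all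
    qed
  qed
  have dec: "decides (S i) (A i) E" for i
    using D(5)[of i] filter_leD[OF ED[of "Suc i"]] unfolding decides_def by meson
  \<comment> \<open>Later refinements cannot overturn what stage \<open>Suc i\<close> has decided,
    so that stage and the limit agree on relation \<open>i\<close>. Finite parts of the limit type
    can therefore be compressed there, with a finite bound.\<close>
  have up: "\<forall>\<^sub>F c in D (Suc i). S i c y = t" if "y \<in> A i" "\<forall>\<^sub>F c in E. S i c y = t" for i y t
  proof (rule ccontr)
    assume "\<not> ?thesis"
    then have "\<forall>\<^sub>F c in D (Suc i). S i c y = (\<not> t)"
      using D(5)[of i] \<open>y \<in> A i\<close> unfolding decides_def by (cases t) auto
    then have "\<forall>\<^sub>F c in E. S i c y = (\<not> t)" using ED by (simp add: le_filter_def)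
    with that(2) have "\<forall>\<^sub>F c in E. False" by eventually_elim auto
    then show False using ev D(1) by (simp add: trivial_limit_def)
  qed
  show ?thesis
  proof (intro exI[of _ E] conjI allI)
    show "E \<noteq> bot" using ev D(1) by (simp add: trivial_limit_def)
    show "E \<le> principal \<Theta>" using ED[of 0] D(3) by simp
    show "decides (S i) (A i) E" for i by (rule dec)
    show "\<exists>K. \<forall>Z\<subseteq>A i \<times> UNIV. finite Z \<longrightarrow> (\<forall>(y, t)\<in>Z. \<forall>\<^sub>F c in E. S i c y = t) \<longrightarrow>
        (\<exists>l. length l \<le> K \<and> (\<forall>(j, y, t)\<in>set l. j \<le> i \<and> y \<in> A j \<and> (\<forall>\<^sub>F c in E. S j c y = t)) \<and>
             (\<forall>c\<in>\<Theta>. obeys S l c \<longrightarrow> agree (S i) Z c))" for i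
    proof -
      obtain K where K: "\<forall>P. eventually P (D (Suc i)) \<longrightarrow>
        (\<exists>l. length l \<le> K \<and>
          (\<forall>(j, y, t)\<in>set l. j < Suc i \<and> y \<in> A j \<and> (\<forall>\<^sub>F c in D (Suc i). S j c y = t)) \<and>
          (\<forall>c\<in>\<Theta>. obeys S l c \<longrightarrow> P c))" using lists[of "Suc i"] by (rule exE)
      show ?thesis
      proof (intro exI[of _ K] allI impI)
        fix Z assume Z: "Z \<subseteq> A i \<times> UNIV" "finite Z" "\<forall>(y, t)\<in>Z. \<forall>\<^sub>F c in E. S i c y = t"
        have "\<forall>\<^sub>F c in D (Suc i). \<forall>e\<in>Z. S i c (fst e) = snd e"
          using Z up by (intro eventually_ball_finite ballI)
            (auto simp: mem_Times_iff split_beta dest!: bspec subsetD)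
        then have "\<forall>\<^sub>F c in D (Suc i). agree (S i) Z c"
          by eventually_elim (auto simp: agree_def)
        from K[THEN spec, THEN mp, OF this] obtain l where l: "length l \<le> K"
          "\<forall>(j, y, t)\<in>set l. j < Suc i \<and> y \<in> A j \<and> (\<forall>\<^sub>F c in D (Suc i). S j c y = t)"
          "\<forall>c\<in>\<Theta>. obeys S l c \<longrightarrow> agree (S i) Z c" by blast
        have e2: "\<forall>\<^sub>F c in E. S j c y = t" if "\<forall>\<^sub>F c in D (Suc i). S j c y = t" for j y t
          using that ED by (simp add: le_filter_def)
        have "j \<le> i \<and> y \<in> A j \<and> (\<forall>\<^sub>F c in E. S j c y = t)" if "(j, y, t) \<in> set l" for j y t
        proof -
          have "j < Suc i \<and> y \<in> A j \<and> (\<forall>\<^sub>F c in D (Suc i). S j c y = t)"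
            using that l(2) by auto
          then show ?thesis using e2[of j y t] by simp
        qed
        then have "\<forall>(j, y, t)\<in>set l. j \<le> i \<and> y \<in> A j \<and> (\<forall>\<^sub>F c in E. S j c y = t)"
          by (intro ballI) (simp only: split_paired_all prod.case)
        with l(1,3) show "\<exists>l. length l \<le> K \<and>
            (\<forall>(j, y, t)\<in>set l. j \<le> i \<and> y \<in> A j \<and> (\<forall>\<^sub>F c in E. S j c y = t)) \<and>
            (\<forall>c\<in>\<Theta>. obeys S l c \<longrightarrow> agree (S i) Z c)"
          by (intro exI[of _ l] conjI)
      qed
    qed
  qed
qed

section \<open>Coverings, trees and orders\<close>

text \<open>If no finite part of \<open>E\<close> covers \<open>N\<close>, choose alternately an
  element \<open>d\<close> related to all earlier \<open>a\<close>, and an \<open>a\<close>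
  unrelated to all \<open>d\<close> so far, the newest included. This produces exactly the forbidden
  order.\<close>

lemma cover_or_order:
  assumes fin: "\<And>N0. finite N0 \<Longrightarrow> N0 \<subseteq> N \<Longrightarrow> \<exists>d\<in>E. \<forall>a\<in>N0. R a d"
    and no: "\<And>(a :: nat \<Rightarrow> 'a) d. (\<And>i. a i \<in> N) \<Longrightarrow> (\<And>i. d i \<in> E) \<Longrightarrow>
               (\<And>i j. R (a i) (d j) \<longleftrightarrow> i < j) \<Longrightarrow> False"
  shows "\<exists>E0\<subseteq>E. finite E0 \<and> (\<forall>a\<in>N. \<exists>d\<in>E0. R a d)"
proof (rule ccontr)
  assume neg: "\<not> ?thesis"
  have avoid: "\<exists>a\<in>N. \<forall>d\<in>E0. \<not> R a d" if "finite E0" "E0 \<subseteq> E" for E0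
  proof (rule ccontr)
    assume "\<not> ?thesis"
    then have "\<forall>a\<in>N. \<exists>d\<in>E0. R a d" by simp
    with that have "\<exists>E0\<subseteq>E. finite E0 \<and> (\<forall>a\<in>N. \<exists>d\<in>E0. R a d)" by (intro exI[of _ E0] conjI)
    with neg show False by (rule notE)
  qed
  define P where "P = (\<lambda>(A, B, a, d). finite A \<and> A \<subseteq> N \<and> finite B \<and> B \<subseteq> E \<and> a \<in> A \<and> d \<in> B \<and>
     (\<forall>d\<in>B. \<not> R a d))"
  define Q where "Q = (\<lambda>(A, B :: 'b set, a :: 'a, d :: 'b) (A', B', a' :: 'a, d').
     A \<subseteq> A' \<and> B \<subseteq> B' \<and> (\<forall>a\<in>A. R a d'))"
  have "\<exists>f. \<forall>n :: nat. P (f n) \<and> Q (f n) (f (Suc n))"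
  proof (rule dependent_nat_choice)
    obtain d where d: "d \<in> E" using fin[of "{}"] by auto
    then obtain a where "a \<in> N" "\<not> R a d" using avoid[of "{d}"] by auto
    with d have "P ({a}, {d}, a, d)" by (simp add: P_def)
    then show "\<exists>x. P x" by blast
  next
    fix x and n :: nat assume "P x"
    obtain A B a d where x: "x = (A, B, a, d)" by (rule prod_cases4)
    have P: "finite A" "A \<subseteq> N" "finite B" "B \<subseteq> E" using \<open>P x\<close> by (auto simp: P_def x)
    obtain d' where d': "d' \<in> E" "\<forall>a\<in>A. R a d'" using fin[OF P(1,2)] by blast
    obtain a' where a': "a' \<in> N" "\<forall>d\<in>insert d' B. \<not> R a' d"
      using avoid[of "insert d' B"] P d' by auto
    have "P (insert a' A, insert d' B, a', d')" "Q x (insert a' A, insert d' B, a', d')"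
      using P d' a' by (auto simp: P_def Q_def x)
    then show "\<exists>y. P y \<and> Q x y" by blast
  qed
  then obtain f where f: "\<And>n :: nat. P (f n)" "\<And>n. Q (f n) (f (Suc n))" by blast
  define A B a d where "A n = fst (f n)" and "B n = fst (snd (f n))" and
    "a n = fst (snd (snd (f n)))" and "d n = snd (snd (snd (f n)))" for n
  have PP: "A n \<subseteq> N" "B n \<subseteq> E" "a n \<in> A n" "d n \<in> B n" "\<And>d. d \<in> B n \<Longrightarrow> \<not> R (a n) d" for n
    using f(1)[of n] by (auto simp: P_def A_def B_def a_def d_def split_beta)
  have QQ: "A n \<subseteq> A (Suc n)" "B n \<subseteq> B (Suc n)" "\<And>a. a \<in> A n \<Longrightarrow> R a (d (Suc n))" for n
    using f(2)[of n] by (auto simp: Q_def A_def B_def a_def d_def split_beta)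
  have mono: "A i \<subseteq> A j" "B i \<subseteq> B j" if "i \<le> j" for i j
    using lift_Suc_mono_le[of A, OF QQ(1) that] lift_Suc_mono_le[of B, OF QQ(2) that] by auto
  have "R (a i) (d j) \<longleftrightarrow> i < j" for i j
  proof (cases "i < j")
    case True
    then obtain k where k: "j = Suc k" "i \<le> k" by (cases j) auto
    then show ?thesis using QQ(3)[of "a i" k] mono(1)[of i k] PP(3)[of i] by auto
  next
    case False
    then show ?thesis using PP(5)[of "d j" i] PP(4)[of j] mono(2)[of j i] by auto
  qed
  moreover have "a i \<in> N" "d i \<in> E" for i using PP(1-4)[of i] by auto
  ultimately show False by (intro no[of a d])
qed

section \<open>Binary trees: Shelah's local 2-rank of a relation\<close>

primrec tree :: "('u \<Rightarrow> 'w \<Rightarrow> bool) \<Rightarrow> 'u set \<Rightarrow> nat \<Rightarrow> 'w set \<Rightarrow> bool" where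
  "tree R D 0 S \<longleftrightarrow> S \<noteq> {}"
| "tree R D (Suc r) S \<longleftrightarrow> (\<exists>u\<in>D. tree R D r {w\<in>S. R u w} \<and> tree R D r {w\<in>S. \<not> R u w})"

lemma tree_mono: "tree R D r S \<Longrightarrow> D \<subseteq> D' \<Longrightarrow> S \<subseteq> S' \<Longrightarrow> tree R D' r S'"
proof (induction r arbitrary: S S')
  case 0 then show ?case by auto
next
  case (Suc r)
  then obtain u where u: "u \<in> D" "tree R D r {w\<in>S. R u w}" "tree R D r {w\<in>S. \<not> R u w}" by auto
  have "tree R D' r {w\<in>S'. R u w}" "tree R D' r {w\<in>S'. \<not> R u w}"
    using Suc.IH[OF u(2) Suc.prems(2)] Suc.IH[OF u(3) Suc.prems(2)] Suc.prems(3)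
    by (simp_all add: Collect_mono_iff subset_iff)
  then show ?case using u(1) Suc.prems(2) by auto
qed

lemma tree_SucD: "tree R D (Suc r) S \<Longrightarrow> tree R D r S"
proof -
  assume "tree R D (Suc r) S"
  then obtain u where "tree R D r {w\<in>S. R u w}" by auto
  then show "tree R D r S" by (rule tree_mono) auto
qed

lemma tree_nonempty: "tree R D r S \<Longrightarrow> S \<noteq> {}"
proof (induction r)
  case (Suc r)
  show ?case using Suc.IH[OF tree_SucD[OF Suc.prems]] .
qed simp

text \<open>The colour of the root decides which of \<open>p\<close> and \<open>q\<close> is lowered
  by one for both subtrees. Either one of them contains a tree of the other colour, or both contain
  a tree of the root's colour, and these are joined at the root.\<close>

lemma tree_partition:
  "tree R D (p + q) S \<Longrightarrow> tree R {u\<in>D. Q u} p S \<or> tree R {u\<in>D. \<not> Q u} q S"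
proof (induction "p + q" arbitrary: p q S)
  case 0 then show ?case by auto
next
  case (Suc n)
  show ?case
  proof (cases "p = 0 \<or> q = 0")
    case True
    then show ?thesis using tree_nonempty[OF Suc.prems] by auto
  next
    case False
    then obtain p' q' where pq: "p = Suc p'" "q = Suc q'" by (meson not0_implies_Suc)
    have "tree R D (Suc n) S" using Suc by simp
    then obtain u where u: "u \<in> D" "tree R D n {w\<in>S. R u w}" "tree R D n {w\<in>S. \<not> R u w}" by auto
    have sub: "tree R D' r S" if "tree R D' r {w\<in>S. R u w} \<or> tree R D' r {w\<in>S. \<not> R u w}" for D' r
      using that tree_mono[of R D' r _ D' S] by blast
    show ?thesis
    proof (cases "Q u")
      case True
      have n: "n = p' + q" using Suc.hyps(2) pq by simp
      have "tree R {u\<in>D. Q u} p' {w\<in>S. R u w} \<or> tree R {u\<in>D. \<not> Q u} q {w\<in>S. R u w}"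
        "tree R {u\<in>D. Q u} p' {w\<in>S. \<not> R u w} \<or> tree R {u\<in>D. \<not> Q u} q {w\<in>S. \<not> R u w}"
        using Suc.hyps(1)[OF n] u n by auto
      then show ?thesis using sub u(1) True pq(1) by auto
    next
      case False
      have n: "n = p + q'" using Suc.hyps(2) pq by simp
      have "tree R {u\<in>D. Q u} p {w\<in>S. R u w} \<or> tree R {u\<in>D. \<not> Q u} q' {w\<in>S. R u w}"
        "tree R {u\<in>D. Q u} p {w\<in>S. \<not> R u w} \<or> tree R {u\<in>D. \<not> Q u} q' {w\<in>S. \<not> R u w}"
        using Suc.hyps(1)[OF n] u n by auto
      then show ?thesis using sub u(1) False pq(2) by auto
    qed
  qed
qed

text \<open>Infinite rank: \<open>tree R D r S\<close> expresses that the 2-rank of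
  \<open>S\<close>, with splitting instances taken from \<open>D\<close>, is at least
  \<open>r\<close>.\<close>

definition tall :: "('u \<Rightarrow> 'w \<Rightarrow> bool) \<Rightarrow> 'u set \<Rightarrow> 'w set \<Rightarrow> bool" where
  "tall R D S \<longleftrightarrow> (\<forall>r. tree R D r S)"

lemma tall_partition:
  fixes Q :: "'u \<Rightarrow> bool"
  assumes "tall R D S"
  shows "\<exists>b. tall R {u\<in>D. Q u = b} S"
proof (rule ccontr)
  assume neg: "\<not> ?thesis"
  from neg have "\<not> tall R {u\<in>D. Q u = True} S" by blast
  then obtain p where p: "\<not> tree R {u\<in>D. Q u} p S" by (auto simp: tall_def)
  from neg have "\<not> tall R {u\<in>D. Q u = False} S" by blast
  then obtain q where q: "\<not> tree R {u\<in>D. \<not> Q u} q S" by (auto simp: tall_def)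
  show False using tree_partition[of R D p q S Q] p q assms by (simp add: tall_def)
qed

text \<open>The signs are chosen so that every new pair behaves in opposite ways towards the past and the
  future.\<close>

lemma tall_order:
  fixes R :: "'u \<Rightarrow> 'w \<Rightarrow> bool" and D S
  defines "Dr \<equiv> \<lambda>ws. {u\<in>D. \<forall>(w, e)\<in>set ws. R u w = e}"
    and "Sr \<equiv> \<lambda>us. {w\<in>S. \<forall>(u, e)\<in>set us. R u w = e}"
  assumes sat: "\<And>ws us. fst ` set ws \<subseteq> S \<Longrightarrow> fst ` set us \<subseteq> D \<Longrightarrow> tall R (Dr ws) (Sr us) \<Longrightarrow>
      \<exists>u\<in>Dr ws. tall R (Dr ws) (Sr ((u, True) # us)) \<and> tall R (Dr ws) (Sr ((u, False) # us))"
    and "tall R D S"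
  obtains u :: "nat \<Rightarrow> 'u" and w where "\<And>i. u i \<in> D" "\<And>i. w i \<in> S"
    "(\<forall>i j. R (u i) (w j) \<longleftrightarrow> i < j) \<or> (\<forall>i j. \<not> R (u i) (w j) \<longleftrightarrow> i < j)"
proof -
  \<comment> \<open>The lists \<open>ws\<close> and \<open>us\<close> are the commitments made so
    far; \<open>Dr ws\<close> and \<open>Sr us\<close> are the nodes and branches that respect them.
    The invariant is that trees with these nodes and branches remain tall.\<close>
  define P where "P = (\<lambda>(ws, us, w :: 'w, e :: bool, u :: 'u).
     fst ` set ws \<subseteq> S \<and> fst ` set us \<subseteq> D \<and> tall R (Dr ws) (Sr us))"
  define Q where "Q = (\<lambda>(ws, us, w :: 'w, e :: bool, u :: 'u) (ws', us', w', e', u').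
     ws' = (w', e') # ws \<and> us' = (u', \<not> e') # us \<and> w' \<in> Sr us \<and> u' \<in> Dr ws')"
  have "\<exists>f. \<forall>n :: nat. P (f n) \<and> Q (f n) (f (Suc n))"
  proof (rule dependent_nat_choice)
    have "P ([], [], undefined, undefined, undefined)" using \<open>tall R D S\<close> by (simp add: P_def Dr_def Sr_def)
    then show "\<exists>x. P x" by blast
  next
    fix x and n :: nat assume "P x"
    obtain ws us w0 e0 u0 where x: "x = (ws, us, w0, e0, u0)" by (rule prod_cases5)
    have P: "fst ` set ws \<subseteq> S" "fst ` set us \<subseteq> D" "tall R (Dr ws) (Sr us)"
      using \<open>P x\<close> by (auto simp: P_def x)
    obtain w where w: "w \<in> Sr us" using P(3)[unfolded tall_def, THEN spec, of 0] by auto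
    \<comment> \<open>The partition property fixes the sign \<open>e\<close> that the new node and
      all later nodes take at \<open>w\<close>; later branches will take the opposite sign at the
      new node.\<close>
    obtain e where "tall R {u\<in>Dr ws. R u w = e} (Sr us)" using tall_partition[OF P(3), of "\<lambda>u. R u w"] by blast
    moreover have "{u\<in>Dr ws. R u w = e} = Dr ((w, e) # ws)" by (auto simp: Dr_def)
    ultimately have "tall R (Dr ((w, e) # ws)) (Sr us)" by simp
    then obtain u where u: "u \<in> Dr ((w, e) # ws)" "tall R (Dr ((w, e) # ws)) (Sr ((u, True) # us))"
      "tall R (Dr ((w, e) # ws)) (Sr ((u, False) # us))"
      using sat[of "(w, e) # ws" us] P w by (auto simp: Sr_def)
    have "tall R (Dr ((w, e) # ws)) (Sr ((u, \<not> e) # us))" using u by (cases e) auto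
    moreover have "w \<in> S" "u \<in> D" using w u(1) by (auto simp: Sr_def Dr_def)
    ultimately have "P ((w, e) # ws, (u, \<not> e) # us, w, e, u)" "Q x ((w, e) # ws, (u, \<not> e) # us, w, e, u)"
      using P w u by (auto simp: P_def Q_def x)
    then show "\<exists>y. P y \<and> Q x y" by blast
  qed
  then obtain f where f: "\<And>n :: nat. P (f n)" "\<And>n. Q (f n) (f (Suc n))" by blast
  define ws us w e u where "ws n = fst (f n)" and "us n = fst (snd (f n))" and
    "w n = fst (snd (snd (f (Suc n))))" and "e n = fst (snd (snd (snd (f (Suc n)))))" and
    "u n = snd (snd (snd (snd (f (Suc n)))))" for n
  have Q: "ws (Suc n) = (w n, e n) # ws n" "us (Suc n) = (u n, \<not> e n) # us n"
    "w n \<in> Sr (us n)" "u n \<in> Dr (ws (Suc n))" for n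
    using f(2)[of n] by (auto simp: Q_def ws_def us_def w_def e_def u_def split_beta)
  have mono: "set (ws i) \<subseteq> set (ws j)" "set (us i) \<subseteq> set (us j)" if "i \<le> j" for i j
  proof -
    have "set (ws n) \<subseteq> set (ws (Suc n))" "set (us n) \<subseteq> set (us (Suc n))" for n using Q by auto
    then show "set (ws i) \<subseteq> set (ws j)" "set (us i) \<subseteq> set (us j)"
      using lift_Suc_mono_le[of "\<lambda>i. set (ws i)" i j] lift_Suc_mono_le[of "\<lambda>i. set (us i)" i j] that
      by auto
  qed
  have 1: "R (u j) (w i) = e i" if "i \<le> j" for i j
  proof -
    have "(w i, e i) \<in> set (ws (Suc j))" using mono(1)[of "Suc i" "Suc j"] that Q(1)[of i] by auto
    then show ?thesis using Q(4)[of j] unfolding Dr_def by blast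
  qed
  have 2: "R (u i) (w j) = (\<not> e i)" if "i < j" for i j
  proof -
    have "(u i, \<not> e i) \<in> set (us j)" using mono(2)[of "Suc i" j] that Q(2)[of i] by auto
    moreover have "\<forall>(u, e)\<in>set (us j). R u (w j) = e" using Q(3)[of j] by (simp add: Sr_def)
    ultimately show ?thesis by (auto dest: bspec)
  qed
  \<comment> \<open>Where the sign is constant, the relation depends only on the order of the
    indices; the constant decides whether \<open>R\<close> or its negation is the order.\<close>
  have "\<exists>b. infinite {n. e n = b}"
  proof (rule ccontr)
    assume "\<not> ?thesis"
    then have "finite {n. e n = True}" "finite {n. e n = False}" by blast+
    then have "finite ({n. e n = True} \<union> {n. e n = False})" by (rule finite_UnI)
    also have "{n. e n = True} \<union> {n. e n = False} = UNIV" by auto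
    finally show False using infinite_UNIV_nat by (rule notE[rotated])
  qed
  then obtain b where b: "infinite {n. e n = b}" by blast
  define g where "g = enumerate {n. e n = b}"
  have g: "strict_mono g" "\<And>n. e (g n) = b"
    using b enumerate_in_set[OF b] by (auto simp: g_def strict_mono_enumerate)
  have "R (u (g i)) (w (g j)) = (if i < j then \<not> b else b)" for i j
    using 1[of "g j" "g i"] 2[of "g i" "g j"] g strict_mono_less[OF g(1), of i j]
    by (auto simp: not_less[symmetric])
  moreover have "u n \<in> D" "w n \<in> S" for n using Q(3,4)[of n] by (auto simp: Dr_def Sr_def)
  ultimately show ?thesis by (intro that[of "u \<circ> g" "w \<circ> g"]) (cases b; auto)+
qed

section \<open>Homogeneous sequences and words in two letters\<close>

lemma ramsey_simultaneous:
  fixes P :: "'c \<Rightarrow> nat set \<Rightarrow> bool"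
  assumes "finite C"
  obtains Y where "infinite Y"
    "\<And>c X X'. c \<in> C \<Longrightarrow> X \<subseteq> Y \<Longrightarrow> X' \<subseteq> Y \<Longrightarrow> finite X \<Longrightarrow> finite X' \<Longrightarrow> card X = n \<Longrightarrow>
       card X' = n \<Longrightarrow> P c X \<longleftrightarrow> P c X'"
proof -
  have "\<exists>Y. infinite Y \<and> (\<forall>c\<in>C. \<exists>t. \<forall>X\<subseteq>Y. finite X \<and> card X = n \<longrightarrow> P c X = t)"
    using assms
  proof (induction C rule: finite_induct)
    case empty then show ?case using infinite_UNIV_nat by blast
  next
    case (insert c C)
    then obtain Y where Y: "infinite Y" "\<forall>c\<in>C. \<exists>t. \<forall>X\<subseteq>Y. finite X \<and> card X = n \<longrightarrow> P c X = t" by blast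
    have "\<exists>Y' t. Y' \<subseteq> Y \<and> infinite Y' \<and> t < (2::nat) \<and>
        (\<forall>X. X \<subseteq> Y' \<and> finite X \<and> card X = n \<longrightarrow> (if P c X then 1 else 0) = t)"
      by (rule Ramsey[OF Y(1)]) auto
    then obtain Y' t where Y': "Y' \<subseteq> Y" "infinite Y'"
      "\<forall>X. X \<subseteq> Y' \<and> finite X \<and> card X = n \<longrightarrow> (if P c X then 1 else 0) = (t::nat)"
      by (elim exE conjE)
    have "P c X = (t = 1)" if "X \<subseteq> Y'" "finite X" "card X = n" for X
      using Y'(3)[THEN spec, of X] that by (auto split: if_splits)
    then have "\<exists>t. \<forall>X\<subseteq>Y'. finite X \<and> card X = n \<longrightarrow> P c X = t"
      by (intro exI[of _ "t = 1"]) simp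
    moreover have "\<forall>c\<in>C. \<exists>t. \<forall>X\<subseteq>Y'. finite X \<and> card X = n \<longrightarrow> P c X = t"
      using Y(2) Y'(1) by (meson order_trans)
    ultimately show ?case using Y'(2) by blast
  qed
  then obtain Y where Y: "infinite Y" "\<forall>c\<in>C. \<exists>t. \<forall>X\<subseteq>Y. finite X \<and> card X = n \<longrightarrow> P c X = t"
    by (elim exE conjE)
  show ?thesis
  proof (rule that[OF Y(1)])
    fix c X X' assume "c \<in> C" and X: "X \<subseteq> Y" "X' \<subseteq> Y" "finite X" "finite X'" "card X = n" "card X' = n"
    from bspec[OF Y(2) \<open>c \<in> C\<close>]
    obtain t where "\<forall>X\<subseteq>Y. finite X \<and> card X = n \<longrightarrow> P c X = t" by (rule exE)
    with X show "P c X \<longleftrightarrow> P c X'" by simp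
  qed
qed

lemma mset_bool_word:
  "mset \<eta> = mset (replicate (length (filter id \<eta>)) True @ replicate (length (filter Not \<eta>)) False)"
  by (induction \<eta>) auto

text \<open>Begin with the sorted word that has the letters of \<open>\<eta>\<close>. For each
  letter of \<open>\<eta>\<close> in turn, move a remaining copy of it to the end; after
  \<open>m\<close> moves the word ends in \<open>take m \<eta>\<close>, and the part in front still
  has the letters that are missing.\<close>

lemma words_closed_under_moves:
  assumes base: "\<And>k. k \<le> n \<Longrightarrow> replicate k True @ replicate (n - k) False \<in> W"
    and move: "\<And>\<eta> j. \<eta> \<in> W \<Longrightarrow> length \<eta> = n \<Longrightarrow> j < n \<Longrightarrow> take j \<eta> @ drop (Suc j) \<eta> @ [\<eta> ! j] \<in> W"
    and "length \<eta> = n"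
  shows "\<eta> \<in> W"
proof -
  have "\<exists>\<rho>. \<rho> @ take m \<eta> \<in> W \<and> mset \<rho> = mset (drop m \<eta>)" if "m \<le> n" for m
    using that
  proof (induction m)
    case 0
    have "length (filter Not \<eta>) = n - length (filter id \<eta>)" "length (filter id \<eta>) \<le> n"
      using sum_length_filter_compl[of id \<eta>] assms(3) by (auto simp: id_def)
    then show ?case using base mset_bool_word[of \<eta>]
      by (intro exI[of _ "replicate (length (filter id \<eta>)) True @ replicate (length (filter Not \<eta>)) False"])
        auto
  next
    case (Suc m)
    then obtain \<rho> where \<rho>: "\<rho> @ take m \<eta> \<in> W" "mset \<rho> = mset (drop m \<eta>)" by auto
    have m: "m < length \<eta>" using Suc assms(3) by simp
    then have "\<eta> ! m \<in> set \<rho>"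
      using mset_eq_setD[OF \<rho>(2)] by (simp add: Cons_nth_drop_Suc[symmetric])
    then obtain j where j: "j < length \<rho>" "\<rho> ! j = \<eta> ! m" unfolding in_set_conv_nth by blast
    have len: "length \<rho> = length \<eta> - m" using mset_eq_length[OF \<rho>(2)] by simp
    define \<rho>' where "\<rho>' = take j \<rho> @ drop (Suc j) \<rho>"
    have "take j (\<rho> @ take m \<eta>) @ drop (Suc j) (\<rho> @ take m \<eta>) @ [(\<rho> @ take m \<eta>) ! j] \<in> W"
      using j len m assms(3) by (intro move \<rho>(1)) auto
    moreover have "take j (\<rho> @ take m \<eta>) @ drop (Suc j) (\<rho> @ take m \<eta>) @ [(\<rho> @ take m \<eta>) ! j] =
        \<rho>' @ take (Suc m) \<eta>"
      using j m by (simp add: \<rho>'_def nth_append take_Suc_conv_app_nth)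
    moreover have "mset \<rho>' = mset (drop (Suc m) \<eta>)"
    proof -
      have "mset \<rho> = add_mset (\<rho> ! j) (mset \<rho>')"
        using arg_cong[OF id_take_nth_drop[OF j(1)], of mset] by (simp add: \<rho>'_def)
      moreover have "mset (drop m \<eta>) = add_mset (\<eta> ! m) (mset (drop (Suc m) \<eta>))"
        using m by (simp add: Cons_nth_drop_Suc[symmetric])
      ultimately show ?thesis using \<rho>(2) j(2) by simp
    qed
    ultimately show ?case by auto
  qed
  from this[of n] show ?thesis using assms(3) by auto
qed

section \<open>Formulas and definable sets\<close>

instance tm :: (countable, countable) countable
  by countable_datatype

instance fm :: (countable, countable, countable) countable
  by countable_datatype

lemma has_sort_symbols: "has_sort L t \<sigma> \<Longrightarrow> set1_tm t \<subseteq> sorts L \<and> set2_tm t \<subseteq> funs L"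
proof (induction rule: has_sort.induct)
  case (1 x)
  then show ?case by (cases x) auto
next
  case (2 f ts)
  then have "set1_tm t \<subseteq> sorts L \<and> set2_tm t \<subseteq> funs L" if "t \<in> set ts" for t
    using that by (auto simp: list_all2_conv_all_nth in_set_conv_nth)
  then show ?case using 2(1) by fastforce
qed

lemma wf_fm_symbols: "wf_fm L \<phi> \<Longrightarrow> set1_fm \<phi> \<subseteq> sorts L \<and> set2_fm \<phi> \<subseteq> funs L \<and> set3_fm \<phi> \<subseteq> rels L"
proof (induction \<phi>)
  case (Eq t u)
  then show ?case using has_sort_symbols by fastforce
next
  case (Rel r ts)
  then have "\<exists>\<sigma>. has_sort L t \<sigma>" if "t \<in> set ts" for t
    using that by (auto simp: list_all2_conv_all_nth in_set_conv_nth)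
  then have "set1_tm t \<subseteq> sorts L \<and> set2_tm t \<subseteq> funs L" if "t \<in> set ts" for t
    using that has_sort_symbols by metis
  then show ?case using Rel by fastforce
next
  case (Ex x \<phi>)
  then show ?case by (cases x) auto
qed auto

text \<open>The types of symbols may be uncountable, but a well-formed formula contains only symbols
  of \<open>L\<close>. Numbering these maps the well-formed formulas injectively into a countable
  type.\<close>

lemma countable_wf_fm:
  assumes "countable_lang L"
  shows "countable {\<phi>. wf_fm L \<phi>}"
proof (rule countable_image_inj_on)
  let ?m = "map_fm (to_nat_on (sorts L)) (to_nat_on (funs L)) (to_nat_on (rels L))"
  show "countable (?m ` {\<phi>. wf_fm L \<phi>})" by simp
  have inj: "inj_on (to_nat_on (sorts L)) (sorts L)" "inj_on (to_nat_on (funs L)) (funs L)"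
    "inj_on (to_nat_on (rels L)) (rels L)"
    using assms by (auto simp: countable_lang_def)
  show "inj_on ?m {\<phi>. wf_fm L \<phi>}"
  proof (rule inj_onI)
    fix \<phi> \<psi> assume "\<phi> \<in> {\<phi>. wf_fm L \<phi>}" "\<psi> \<in> {\<phi>. wf_fm L \<phi>}" "?m \<phi> = ?m \<psi>"
    moreover from this have "set1_fm \<phi> \<subseteq> sorts L" "set2_fm \<phi> \<subseteq> funs L" "set3_fm \<phi> \<subseteq> rels L"
      "set1_fm \<psi> \<subseteq> sorts L" "set2_fm \<psi> \<subseteq> funs L" "set3_fm \<psi> \<subseteq> rels L"
      using wf_fm_symbols by blast+
    ultimately show "\<phi> = \<psi>"
      using inj by (intro fm.inj_map_strong[of \<phi> \<psi>]) (auto simp: inj_on_def subset_iff)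
  qed
qed

lemma finite_tm_vars: "finite (tm_vars t)"
  by (induction t) auto

lemma finite_fv: "finite (fv \<phi>)"
  by (induction \<phi>) (auto simp: finite_tm_vars)

lemma eval_cong: "(\<And>x. x \<in> tm_vars t \<Longrightarrow> v x = v' x) \<Longrightarrow> eval M v t = eval M v' t"
proof (induction t)
  case (Fn f ts)
  then have "map (eval M v) ts = map (eval M v') ts" by auto
  then show ?case by (simp only: eval.simps)
qed auto

lemma sat_cong: "(\<And>x. x \<in> fv \<phi> \<Longrightarrow> v x = v' x) \<Longrightarrow> sat M v \<phi> \<longleftrightarrow> sat M v' \<phi>"
proof (induction \<phi> arbitrary: v v')
  case (Eq t u)
  then show ?case using eval_cong[of t v v' M] eval_cong[of u v v' M] by auto
next
  case (Rel r ts)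
  then have "map (eval M v) ts = map (eval M v') ts" by (auto intro!: eval_cong)
  then show ?case by (simp only: sat.simps)
next
  case (Conj \<phi> \<psi>)
  have "sat M v \<phi> \<longleftrightarrow> sat M v' \<phi>" by (rule Conj.IH(1)) (use Conj.prems in auto)
  moreover have "sat M v \<psi> \<longleftrightarrow> sat M v' \<psi>" by (rule Conj.IH(2)) (use Conj.prems in auto)
  ultimately show ?case by simp
next
  case (Ex x \<phi>)
  have "sat M (v(x := a)) \<phi> \<longleftrightarrow> sat M (v'(x := a)) \<phi>" for a
    by (rule Ex.IH) (use Ex.prems in auto)
  then show ?case by simp
next
  case (Neg \<phi>)
  have "sat M v \<phi> \<longleftrightarrow> sat M v' \<phi>" by (rule Neg.IH) (use Neg.prems in auto)
  then show ?case by simp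
qed simp

lemma has_sort_vars: "has_sort L t \<sigma> \<Longrightarrow> fst ` tm_vars t \<subseteq> sorts L"
proof (induction rule: has_sort.induct)
  case (2 f ts)
  have "fst ` tm_vars t \<subseteq> sorts L" if t: "t \<in> set ts" for t
  proof -
    obtain i where "i < length ts" "t = ts ! i" using t unfolding in_set_conv_nth by blast
    then show ?thesis using 2(2) by (simp add: list_all2_conv_all_nth)
  qed
  then show ?case by auto
qed auto

lemma wf_fm_vars: "wf_fm L \<phi> \<Longrightarrow> fst ` fv \<phi> \<subseteq> sorts L"
proof (induction \<phi>)
  case (Eq t u)
  then show ?case using has_sort_vars by fastforce
next
  case (Rel r ts)
  then show ?case using has_sort_vars by (fastforce simp: list_all2_conv_all_nth in_set_conv_nth)
qed auto

primrec tsub :: "('f \<Rightarrow> 'g) \<Rightarrow> ('s var \<Rightarrow> ('s, 'g) tm) \<Rightarrow> ('s, 'f) tm \<Rightarrow> ('s, 'g) tm" where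
  "tsub j \<tau> (Var x) = \<tau> x"
| "tsub j \<tau> (Fn f ts) = Fn (j f) (map (tsub j \<tau>) ts)"

lemma tm_vars_tsub: "tm_vars (tsub j \<tau> t) = (\<Union>x\<in>tm_vars t. tm_vars (\<tau> x))"
  by (induction t) auto

text \<open>Two instances matter: renaming variables within one structure, and passing to the
  expansion by constants, where \<open>Inl\<close> embeds the function symbols.\<close>

locale embedding =
  fixes L1 :: "('s, 'f, 'r) lang" and L2 :: "('s, 'g, 'r) lang" and j :: "'f \<Rightarrow> 'g"
    and M1 :: "('s, 'f, 'r, 'a) fo_struct" and M2 :: "('s, 'g, 'r, 'a) fo_struct"
  assumes sorts: "sorts L2 = sorts L1" and rels: "rels L2 = rels L1" "rel_args L2 = rel_args L1"
    and funs: "\<And>f. f \<in> funs L1 \<Longrightarrow> j f \<in> funs L2"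
      "\<And>f. fun_args L2 (j f) = fun_args L1 f" "\<And>f. fun_res L2 (j f) = fun_res L1 f"
    and int: "carr M2 = carr M1" "rel_int M2 = rel_int M1" "\<And>f. fun_int M2 (j f) = fun_int M1 f"
begin

lemma eval_tsub: "eval M2 v (tsub j \<tau> t) = eval M1 (\<lambda>x. eval M2 v (\<tau> x)) t"
proof (induction t)
  case (Fn f ts)
  then have "map (\<lambda>t. eval M2 v (tsub j \<tau> t)) ts = map (eval M1 (\<lambda>x. eval M2 v (\<tau> x))) ts" by auto
  then show ?case by (simp only: tsub.simps eval.simps int map_map o_def)
qed auto

lemma has_sort_tsub:
  "has_sort L1 t \<sigma> \<Longrightarrow> (\<And>x. x \<in> tm_vars t \<Longrightarrow> has_sort L2 (\<tau> x) (fst x)) \<Longrightarrow> has_sort L2 (tsub j \<tau> t) \<sigma>"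
proof (induction rule: has_sort.induct)
  case (1 x)
  then show ?case by simp
next
  case (2 f ts)
  have "has_sort L2 (\<tau> x) (fst x)" if "i < length ts" "x \<in> tm_vars (ts ! i)" for i x
    using 2(3)[of x] nth_mem[OF that(1)] that(2) by auto
  then have "list_all2 (has_sort L2) (map (tsub j \<tau>) ts) (fun_args L1 f)"
    using 2(2) by (auto simp: list_all2_conv_all_nth)
  then show ?case
    using has_sort.intros(2)[of "j f" L2 "map (tsub j \<tau>) ts"] 2(1) funs by simp
qed

text \<open>Substitution is stated as the existence of a formula with the right semantics. A
  quantifier could capture a variable of a substituted term, so its variable is replaced by a fresh
  one of the same sort, and no particular choice has to be tracked.\<close>

lemma translate:
  "wf_fm L1 \<phi> \<Longrightarrow> (\<And>x. x \<in> fv \<phi> \<Longrightarrow> has_sort L2 (\<tau> x) (fst x)) \<Longrightarrow>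
   \<exists>\<psi>. wf_fm L2 \<psi> \<and> fv \<psi> = (\<Union>x\<in>fv \<phi>. tm_vars (\<tau> x)) \<and>
      (\<forall>v. sat M2 v \<psi> \<longleftrightarrow> sat M1 (\<lambda>x. eval M2 v (\<tau> x)) \<phi>)"
proof (induction \<phi> arbitrary: \<tau>)
  case Bot
  show ?case by (rule exI[of _ Bot]) simp
next
  case (Eq t u)
  then obtain \<sigma> where "has_sort L1 t \<sigma>" "has_sort L1 u \<sigma>" by auto
  then have "wf_fm L2 (Eq (tsub j \<tau> t) (tsub j \<tau> u))"
    using has_sort_tsub[of t \<sigma> \<tau>] has_sort_tsub[of u \<sigma> \<tau>] Eq.prems(2) by auto
  then show ?case
    by (intro exI[of _ "Eq (tsub j \<tau> t) (tsub j \<tau> u)"]) (auto simp: eval_tsub tm_vars_tsub)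
next
  case (Rel r ts)
  have "list_all2 (has_sort L2) (map (tsub j \<tau>) ts) (rel_args L1 r)"
  proof -
    have "has_sort L2 (\<tau> x) (fst x)" if "i < length ts" "x \<in> tm_vars (ts ! i)" for i x
      using Rel.prems(2)[of x] nth_mem[OF that(1)] that(2) by auto
    then show ?thesis using Rel.prems(1) has_sort_tsub by (simp add: list_all2_conv_all_nth)
  qed
  moreover have "map (eval M2 v) (map (tsub j \<tau>) ts) = map (eval M1 (\<lambda>x. eval M2 v (\<tau> x))) ts" for v
    by (simp add: eval_tsub)
  ultimately show ?case
    using Rel.prems(1)
    by (intro exI[of _ "Rel r (map (tsub j \<tau>) ts)"]) (auto simp: rels int tm_vars_tsub simp del: map_map)
next
  case (Neg \<phi>)
  obtain \<psi> where "wf_fm L2 \<psi>" "fv \<psi> = (\<Union>x\<in>fv \<phi>. tm_vars (\<tau> x))"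
    "\<forall>v. sat M2 v \<psi> \<longleftrightarrow> sat M1 (\<lambda>x. eval M2 v (\<tau> x)) \<phi>"
    using Neg.IH[of \<tau>] Neg.prems by auto
  then show ?case by (intro exI[of _ "Neg \<psi>"]) auto
next
  case (Conj \<phi>1 \<phi>2)
  obtain \<psi>1 where 1: "wf_fm L2 \<psi>1" "fv \<psi>1 = (\<Union>x\<in>fv \<phi>1. tm_vars (\<tau> x))"
    "\<forall>v. sat M2 v \<psi>1 \<longleftrightarrow> sat M1 (\<lambda>x. eval M2 v (\<tau> x)) \<phi>1"
    using Conj.IH(1)[of \<tau>] Conj.prems by auto
  obtain \<psi>2 where 2: "wf_fm L2 \<psi>2" "fv \<psi>2 = (\<Union>x\<in>fv \<phi>2. tm_vars (\<tau> x))"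
    "\<forall>v. sat M2 v \<psi>2 \<longleftrightarrow> sat M1 (\<lambda>x. eval M2 v (\<tau> x)) \<phi>2"
    using Conj.IH(2)[of \<tau>] Conj.prems by auto
  show ?case using 1 2 by (intro exI[of _ "Conj \<psi>1 \<psi>2"]) auto
next
  case (Ex x \<phi>)
  define W where "W = (\<Union>z\<in>fv \<phi> - {x}. tm_vars (\<tau> z))"
  have "finite W" by (auto simp: W_def finite_fv finite_tm_vars)
  then have "finite (snd ` W)" by simp
  then obtain m where m: "m \<notin> snd ` W" using ex_new_if_finite infinite_UNIV_nat by blast
  define y where "y = (fst x, m)"
  have y: "y \<notin> W" using m by (force simp: y_def)
  have xs: "fst x \<in> sorts L1" "wf_fm L1 \<phi>" using Ex.prems(1) by auto
  have "has_sort L2 (Var y) (fst y)" using has_sort.intros(1)[of y L2] xs sorts by (simp add: y_def)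
  then have hs: "has_sort L2 ((\<tau>(x := Var y)) z) (fst z)" if "z \<in> fv \<phi>" for z
    using Ex.prems(2)[of z] that by (auto simp: y_def)
  obtain \<psi> where \<psi>: "wf_fm L2 \<psi>" "fv \<psi> = (\<Union>z\<in>fv \<phi>. tm_vars ((\<tau>(x := Var y)) z))"
    "\<And>v. sat M2 v \<psi> \<longleftrightarrow> sat M1 (\<lambda>z. eval M2 v ((\<tau>(x := Var y)) z)) \<phi>"
    using Ex.IH[OF xs(2) hs] by auto
  have "fv (Ex y \<psi>) = (\<Union>z\<in>fv (Ex x \<phi>). tm_vars (\<tau> z))"
    using y by (auto simp: \<psi>(2) W_def split: if_splits)
  moreover have "wf_fm L2 (Ex y \<psi>)" using \<psi>(1) xs sorts by (simp add: y_def)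
  moreover have "sat M2 v (Ex y \<psi>) \<longleftrightarrow> sat M1 (\<lambda>z. eval M2 v (\<tau> z)) (Ex x \<phi>)" for v
  proof -
    have "sat M2 (v(y := a)) \<psi> \<longleftrightarrow> sat M1 ((\<lambda>z. eval M2 v (\<tau> z))(x := a)) \<phi>" for a
      unfolding \<psi>(3)
    proof (rule sat_cong)
      fix z assume z: "z \<in> fv \<phi>"
      show "eval M2 (v(y := a)) ((\<tau>(x := Var y)) z) = ((\<lambda>z. eval M2 v (\<tau> z))(x := a)) z"
      proof (cases "z = x")
        case False
        then have "y \<notin> tm_vars (\<tau> z)" using y z by (auto simp: W_def)
        then show ?thesis using False by (auto intro!: eval_cong)
      qed simp
    qed
    then show ?thesis by (simp add: int y_def)
  qed
  ultimately show ?case by (intro exI[of _ "Ex y \<psi>"] conjI allI)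
qed

end

lemma embedding_id: "embedding L L id U U"
  by (simp add: embedding_def)

lemma embedding_const: "embedding L (const_lang L B) Inl U (const_struct U B)"
  by (simp add: embedding_def const_lang_def const_struct_def)

text \<open>\<open>enc (t, z)\<close> is the copy number \<open>t\<close> of the variable \<open>z\<close>.\<close>

definition enc :: "nat \<times> 's var \<Rightarrow> 's var" where
  "enc i = (fst (snd i), prod_encode (fst i, snd (snd i)))"

definition dec :: "'s var \<Rightarrow> nat \<times> 's var" where
  "dec x = (fst (prod_decode (snd x)), (fst x, snd (prod_decode (snd x))))"

lemma dec_enc [simp]: "dec (enc i) = i" and enc_dec [simp]: "enc (dec x) = x"
  and fst_enc: "fst (enc i) = fst (snd i)" and fst_dec: "fst (snd (dec x)) = fst x"
  by (auto simp: enc_def dec_def)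

definition untag :: "(nat \<Rightarrow> 's var \<Rightarrow> 'a) \<Rightarrow> 's var \<Rightarrow> 'a" where
  "untag V x = V (fst (dec x)) (snd (dec x))"

lemma untag_enc [simp]: "untag V (enc i) = V (fst i) (snd i)"
  by (simp add: untag_def)

lemma untag_upd:
  fixes V :: "nat \<Rightarrow> 's var \<Rightarrow> 'a"
  shows "untag (V(t := (V t)(z := a))) = (untag V)(enc (t, z) := a)"
proof
  fix x :: "'s var"
  obtain i where x: "x = enc i" using enc_dec[of x] by metis
  have "enc i = enc (t, z) \<longleftrightarrow> i = (t, z)" by (metis dec_enc)
  then show "untag (V(t := (V t)(z := a))) x = ((untag V)(enc (t, z) := a)) x"
    by (cases i) (auto simp: x)
qed

section \<open>Predicates definable without parameters\<close>

locale fo_structure =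
  fixes L :: "('s, 'f, 'r) lang" and U :: "('s, 'f, 'r, 'a) fo_struct"
  assumes wf_lang: "wf_lang L" and is_struct: "is_struct L U"
begin

definition Vals :: "'s var set \<Rightarrow> ('s var \<Rightarrow> 'a) set" where
  "Vals I = {u. \<forall>z\<in>I. u z \<in> carr U (fst z)}"

text \<open>Predicates definable by an \<open>L\<close>-formula without parameters. The free variables are organised
  in countably many copies of the variables of \<open>L\<close>, so that several tuples can be handled without
  renaming; \<open>T\<close> contains the pairs (copy, variable) that may occur.\<close>

definition df :: "(nat \<times> 's var) set \<Rightarrow> ((nat \<Rightarrow> 's var \<Rightarrow> 'a) \<Rightarrow> bool) \<Rightarrow> bool" where
  "df T Q \<longleftrightarrow> (\<exists>\<phi>. wf_fm L \<phi> \<and> fv \<phi> \<subseteq> enc ` T \<and> (\<forall>V. Q V \<longleftrightarrow> sat U (untag V) \<phi>))"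

lemma dfI: "wf_fm L \<phi> \<Longrightarrow> fv \<phi> \<subseteq> enc ` T \<Longrightarrow> (\<And>V. Q V \<longleftrightarrow> sat U (untag V) \<phi>) \<Longrightarrow> df T Q"
  unfolding df_def by (intro exI[of _ \<phi>] conjI allI)

lemma dfE:
  assumes "df T Q"
  obtains \<phi> where "wf_fm L \<phi>" "fv \<phi> \<subseteq> enc ` T" "Q = (\<lambda>V. sat U (untag V) \<phi>)"
proof -
  obtain \<phi> where \<phi>: "wf_fm L \<phi> \<and> fv \<phi> \<subseteq> enc ` T \<and> (\<forall>V. Q V \<longleftrightarrow> sat U (untag V) \<phi>)"
    using assms unfolding df_def by (rule exE)
  then have "Q = (\<lambda>V. sat U (untag V) \<phi>)" by (intro ext) simp
  with \<phi> show ?thesis by (intro that[of \<phi>]) simp_all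
qed

lemma df_mono:
  assumes "df T Q" "T \<subseteq> T'"
  shows "df T' Q"
proof -
  obtain \<phi> where "wf_fm L \<phi>" "fv \<phi> \<subseteq> enc ` T" "Q = (\<lambda>V. sat U (untag V) \<phi>)"
    using assms(1) by (rule dfE)
  then show ?thesis using assms(2) by (intro dfI[of \<phi>]) auto
qed

lemma df_atom:
  assumes "wf_fm L \<phi>" "\<And>z. z \<in> fv \<phi> \<Longrightarrow> (g z, h z) \<in> T" "\<And>z. z \<in> fv \<phi> \<Longrightarrow> fst (h z) = fst z"
  shows "df T (\<lambda>V. sat U (\<lambda>z. V (g z) (h z)) \<phi>)"
proof -
  have "has_sort L (Var (enc (g x, h x))) (fst x)" if "x \<in> fv \<phi>" for x
    using has_sort.intros(1)[of "enc (g x, h x)" L] wf_fm_vars[OF assms(1)] that assms(3)[OF that]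
    by (auto simp: fst_enc)
  from embedding.translate[OF embedding_id[of L U] assms(1), of "\<lambda>x. Var (enc (g x, h x))", OF this]
  obtain \<psi> where \<psi>: "wf_fm L \<psi> \<and> fv \<psi> = (\<Union>x\<in>fv \<phi>. tm_vars (Var (enc (g x, h x)) :: ('s, 'f) tm)) \<and>
    (\<forall>v. sat U v \<psi> \<longleftrightarrow> sat U (\<lambda>x. eval U v (Var (enc (g x, h x)))) \<phi>)"
    by (rule exE)
  then show ?thesis using assms(2) by (intro dfI[of \<psi>]) auto
qed

lemma df_not:
  assumes "df T Q"
  shows "df T (\<lambda>V. \<not> Q V)"
proof -
  obtain \<phi> where "wf_fm L \<phi>" "fv \<phi> \<subseteq> enc ` T" "Q = (\<lambda>V. sat U (untag V) \<phi>)"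
    using assms(1) by (rule dfE)
  then show ?thesis by (intro dfI[of "Neg \<phi>"]) auto
qed

lemma df_conj:
  assumes "df T Q" "df T Q'"
  shows "df T (\<lambda>V. Q V \<and> Q' V)"
proof -
  obtain \<phi> where "wf_fm L \<phi>" "fv \<phi> \<subseteq> enc ` T" "Q = (\<lambda>V. sat U (untag V) \<phi>)"
    using assms(1) by (rule dfE)
  moreover obtain \<phi>' where "wf_fm L \<phi>'" "fv \<phi>' \<subseteq> enc ` T" "Q' = (\<lambda>V. sat U (untag V) \<phi>')"
    using assms(2) by (rule dfE)
  ultimately show ?thesis by (intro dfI[of "Conj \<phi> \<phi>'"]) auto
qed

lemma df_False: "df T (\<lambda>V. False)"
  by (rule dfI[of Bot]) auto

lemma df_True: "df T (\<lambda>V. True)"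
  using df_not[OF df_False] by simp

lemma df_imp:
  assumes "df T Q" "df T Q'"
  shows "df T (\<lambda>V. Q V \<longrightarrow> Q' V)"
  using df_not[OF df_conj[OF assms(1) df_not[OF assms(2)]]] by simp

lemma df_iff:
  assumes "df T Q" "df T Q'"
  shows "df T (\<lambda>V. Q V \<longleftrightarrow> Q' V)"
  using df_conj[OF df_imp[OF assms] df_imp[OF assms(2,1)]] by (simp only: iff_conv_conj_imp)

lemma df_const_iff: "df T Q \<Longrightarrow> df T (\<lambda>V. Q V = b)"
  using df_not[of T Q] by (cases b) simp_all

lemma df_Ball: "finite S \<Longrightarrow> (\<And>q. q \<in> S \<Longrightarrow> df T (Q q)) \<Longrightarrow> df T (\<lambda>V. \<forall>q\<in>S. Q q V)"
proof (induction S rule: finite_induct)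
  case (insert q S)
  have "df T (Q q)" "df T (\<lambda>V. \<forall>q\<in>S. Q q V)" using insert by simp_all
  from df_conj[OF this] show ?case by simp
qed (simp add: df_True)

lemma df_support:
  assumes "df T Q" "\<And>t z. (t, z) \<in> T \<Longrightarrow> V t z = V' t z"
  shows "Q V \<longleftrightarrow> Q V'"
proof -
  obtain \<phi> where \<phi>: "wf_fm L \<phi>" "fv \<phi> \<subseteq> enc ` T" "Q = (\<lambda>V. sat U (untag V) \<phi>)"
    using assms(1) by (rule dfE)
  have "sat U (untag V) \<phi> \<longleftrightarrow> sat U (untag V') \<phi>"
  proof (rule sat_cong)
    fix x assume "x \<in> fv \<phi>"
    then obtain t z where "x = enc (t, z)" "(t, z) \<in> T" using \<phi>(2) by auto
    then show "untag V x = untag V' x" using assms(2) by simp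
  qed
  then show ?thesis by (simp add: \<phi>(3))
qed

lemma df_finite_support:
  assumes "df T Q"
  obtains T' where "finite T'" "T' \<subseteq> T" "df T' Q"
proof -
  obtain \<phi> where \<phi>: "wf_fm L \<phi>" "fv \<phi> \<subseteq> enc ` T" "Q = (\<lambda>V. sat U (untag V) \<phi>)"
    using assms(1) by (rule dfE)
  have "dec ` fv \<phi> \<subseteq> T" using \<phi>(2) by auto
  moreover have "df (dec ` fv \<phi>) Q" using \<phi> by (intro dfI[of \<phi>]) (auto simp: image_image)
  ultimately show ?thesis using that[of "dec ` fv \<phi>"] finite_fv[of \<phi>] by auto
qed

lemma df_subst:
  assumes "df T Q" "\<And>t z. (t, z) \<in> T \<Longrightarrow> (g t z, h t z) \<in> T'" "\<And>t z. (t, z) \<in> T \<Longrightarrow> fst (h t z) = fst z"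
  shows "df T' (\<lambda>V. Q (\<lambda>t z. V (g t z) (h t z)))"
proof -
  obtain \<phi> where \<phi>: "wf_fm L \<phi>" "fv \<phi> \<subseteq> enc ` T" "Q = (\<lambda>V. sat U (untag V) \<phi>)"
    using assms(1) by (rule dfE)
  have "df T' (\<lambda>V. sat U (\<lambda>x. V (g (fst (dec x)) (snd (dec x))) (h (fst (dec x)) (snd (dec x)))) \<phi>)"
  proof (rule df_atom[OF \<phi>(1)])
    fix x assume "x \<in> fv \<phi>"
    then obtain t z where "x = enc (t, z)" "(t, z) \<in> T" using \<phi>(2) by auto
    then show "(g (fst (dec x)) (snd (dec x)), h (fst (dec x)) (snd (dec x))) \<in> T'"
      "fst (h (fst (dec x)) (snd (dec x))) = fst x"
      using assms(2,3) by (auto simp: fst_enc)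
  qed
  then show ?thesis by (simp add: \<phi>(3) untag_def[abs_def])
qed

lemma df_ex1:
  assumes "df T Q"
  shows "df (T - {(t, z)}) (\<lambda>V. \<exists>a\<in>carr U (fst z). Q (V(t := (V t)(z := a))))"
proof (cases "fst z \<in> sorts L")
  case True
  obtain \<phi> where \<phi>: "wf_fm L \<phi>" "fv \<phi> \<subseteq> enc ` T" "Q = (\<lambda>V. sat U (untag V) \<phi>)"
    using assms(1) by (rule dfE)
  show ?thesis
  proof (rule dfI)
    show "wf_fm L (Ex (enc (t, z)) \<phi>)" using \<phi>(1) True by (simp add: fst_enc)
    show "fv (Ex (enc (t, z)) \<phi>) \<subseteq> enc ` (T - {(t, z)})" using \<phi>(2) by auto
  qed (simp add: \<phi>(3) untag_upd fst_enc)
next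
  case False
  \<comment> \<open>A quantifier over a sort outside \<open>L\<close> would not be well-formed; but
    such a sort is empty, so the predicate is simply false.\<close>
  then have "carr U (fst z) = {}" using is_struct by (simp add: is_struct_def)
  then show ?thesis by (simp add: df_False)
qed

text \<open>Overriding only the coordinates in \<open>I\<close> is what an induction adding one
  variable at a time can maintain; \<open>df_ex\<close> then replaces the whole copy.\<close>

lemma df_ex_override:
  assumes "finite I" "df T Q"
  shows "df (T - {t} \<times> I) (\<lambda>V. \<exists>u\<in>Vals I. Q (V(t := override_on (V t) u I)))"
  using assms
proof (induction I rule: finite_induct)
  case empty
  then show ?case by (simp add: Vals_def)
next
  case (insert z I)
  let ?Q = "\<lambda>V. \<exists>u\<in>Vals I. Q (V(t := override_on (V t) u I))"
  have 1: "df (T - {t} \<times> I - {(t, z)}) (\<lambda>V. \<exists>a\<in>carr U (fst z). ?Q (V(t := (V t)(z := a))))"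
    by (rule df_ex1[OF insert.IH[OF insert.prems]])
  have 2: "T - {t} \<times> I - {(t, z)} = T - {t} \<times> insert z I" by auto
  have 3: "(\<exists>a\<in>carr U (fst z). ?Q (V(t := (V t)(z := a)))) \<longleftrightarrow>
      (\<exists>u\<in>Vals (insert z I). Q (V(t := override_on (V t) u (insert z I))))" for V
  proof
    assume "\<exists>a\<in>carr U (fst z). ?Q (V(t := (V t)(z := a)))"
    then obtain a u where a: "a \<in> carr U (fst z)" "u \<in> Vals I"
      "Q (V(t := override_on ((V t)(z := a)) u I))" by auto
    have "override_on ((V t)(z := a)) u I = override_on (V t) (u(z := a)) (insert z I)"
      using insert.hyps(2) by (auto simp: override_on_def)
    moreover have "u(z := a) \<in> Vals (insert z I)" using a(1,2) by (auto simp: Vals_def)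
    ultimately show "\<exists>u\<in>Vals (insert z I). Q (V(t := override_on (V t) u (insert z I)))"
      using a(3) by (intro bexI[of _ "u(z := a)"]) auto
  next
    assume "\<exists>u\<in>Vals (insert z I). Q (V(t := override_on (V t) u (insert z I)))"
    then obtain u where u: "u \<in> Vals (insert z I)" "Q (V(t := override_on (V t) u (insert z I)))" by auto
    have "override_on ((V t)(z := u z)) u I = override_on (V t) u (insert z I)"
      by (auto simp: override_on_def)
    then show "\<exists>a\<in>carr U (fst z). ?Q (V(t := (V t)(z := a)))"
      using u by (intro bexI[of _ "u z"] bexI[of _ u]) (auto simp: Vals_def)
  qed
  show ?case using 1 by (simp only: 2 3)
qed

lemma df_ex:
  assumes "finite I" "df T Q" "\<And>z. (t, z) \<in> T \<Longrightarrow> z \<in> I"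
  shows "df (T - {t} \<times> UNIV) (\<lambda>V. \<exists>u\<in>Vals I. Q (V(t := u)))"
proof -
  have "Q (V(t := override_on (V t) u I)) \<longleftrightarrow> Q (V(t := u))" for V u
    by (rule df_support[OF assms(2)]) (use assms(3) in auto)
  moreover have "T - {t} \<times> I = T - {t} \<times> UNIV" using assms(3) by auto
  ultimately show ?thesis using df_ex_override[OF assms(1,2), of t] by simp
qed

text \<open>Copy 0 carries the element, the other copies the parameters. All variables of copy 0
  receive the same value, so two definitions can be combined without first identifying their element
  variables.\<close>

definition dset :: "('s \<times> 'a) set \<Rightarrow> 's \<Rightarrow> 'a set \<Rightarrow> bool" where
  "dset B \<sigma> A \<longleftrightarrow> (\<exists>T Q V. df T Q \<and>
     (\<forall>(t, z)\<in>T. if t = 0 then fst z = \<sigma> else (fst z, V t z) \<in> B) \<and>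
     A = {a\<in>carr U \<sigma>. Q (V(0 := \<lambda>_. a))})"

lemma dsetI:
  assumes "df T Q" "\<And>z. (0, z) \<in> T \<Longrightarrow> fst z = \<sigma>"
    "\<And>t z. (t, z) \<in> T \<Longrightarrow> t \<noteq> 0 \<Longrightarrow> (fst z, V t z) \<in> B"
    "\<And>a. a \<in> A \<longleftrightarrow> a \<in> carr U \<sigma> \<and> Q (V(0 := \<lambda>_. a))"
  shows "dset B \<sigma> A"
  unfolding dset_def
proof (intro exI conjI)
  show "df T Q" by fact
  show "\<forall>(t, z)\<in>T. if t = 0 then fst z = \<sigma> else (fst z, V t z) \<in> B" using assms(2,3) by auto
  show "A = {a\<in>carr U \<sigma>. Q (V(0 := \<lambda>_. a))}" using assms(4) by blast
qed

lemma dsetE: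
  assumes "dset B \<sigma> A"
  obtains T Q V where "finite T" "df T Q" "\<forall>z. (0, z) \<in> T \<longrightarrow> fst z = \<sigma>"
    "\<forall>t z. (t, z) \<in> T \<longrightarrow> t \<noteq> 0 \<longrightarrow> (fst z, V t z) \<in> B"
    "A = {a\<in>carr U \<sigma>. Q (V(0 := \<lambda>_. a))}"
proof -
  obtain T Q V where T: "df T Q" "\<forall>(t, z)\<in>T. if t = 0 then fst z = \<sigma> else (fst z, V t z) \<in> B"
    "A = {a\<in>carr U \<sigma>. Q (V(0 := \<lambda>_. a))}"
    using assms unfolding dset_def by (elim exE conjE)
  obtain T' where T': "finite T'" "T' \<subseteq> T" "df T' Q" using T(1) by (rule df_finite_support)
  have "if t = 0 then fst z = \<sigma> else (fst z, V t z) \<in> B" if "(t, z) \<in> T'" for t z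
    using T(2) T'(2) that by blast
  then show ?thesis using T' T(3) by (intro that[of T' Q V]) (auto split: if_splits)
qed

lemma dset_mono: "dset B \<sigma> A \<Longrightarrow> B \<subseteq> B' \<Longrightarrow> dset B' \<sigma> A"
proof -
  assume "dset B \<sigma> A" "B \<subseteq> B'"
  then obtain T Q V where T: "finite T" "df T Q" "\<forall>z. (0, z) \<in> T \<longrightarrow> fst z = \<sigma>"
    "\<forall>t z. (t, z) \<in> T \<longrightarrow> t \<noteq> 0 \<longrightarrow> (fst z, V t z) \<in> B"
    "A = {a\<in>carr U \<sigma>. Q (V(0 := \<lambda>_. a))}"
    by (elim dsetE)
  show "dset B' \<sigma> A" by (rule dsetI[OF T(2), of _ V]) (use T(3-5) \<open>B \<subseteq> B'\<close> in auto)
qed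

lemma dset_finite_param:
  assumes "dset B \<sigma> A"
  obtains B0 where "finite B0" "B0 \<subseteq> B" "dset B0 \<sigma> A"
proof -
  obtain T Q V where T: "finite T" "df T Q" "\<forall>z. (0, z) \<in> T \<longrightarrow> fst z = \<sigma>"
    "\<forall>t z. (t, z) \<in> T \<longrightarrow> t \<noteq> 0 \<longrightarrow> (fst z, V t z) \<in> B"
    "A = {a\<in>carr U \<sigma>. Q (V(0 := \<lambda>_. a))}"
    by (rule dsetE[OF assms])
  define B0 where "B0 = (\<lambda>(t, z). (fst z, V t z)) ` {i\<in>T. fst i \<noteq> 0}"
  have "dset B0 \<sigma> A" by (rule dsetI[OF T(2), of _ V]) (use T(3,5) in \<open>force simp: B0_def\<close>)+
  moreover have "finite B0" "B0 \<subseteq> B" using T(1,4) by (auto simp: B0_def)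
  ultimately show ?thesis by (intro that[of B0])
qed

lemma dset_Int:
  assumes "dset B \<sigma> A" "dset B \<sigma> A'"
  shows "dset B \<sigma> (A \<inter> A')"
proof -
  obtain T Q V where T: "finite T" "df T Q" "\<forall>z. (0, z) \<in> T \<longrightarrow> fst z = \<sigma>"
    "\<forall>t z. (t, z) \<in> T \<longrightarrow> t \<noteq> 0 \<longrightarrow> (fst z, V t z) \<in> B"
    "A = {a\<in>carr U \<sigma>. Q (V(0 := \<lambda>_. a))}"
    by (rule dsetE[OF assms(1)])
  obtain T' Q' V' where T': "finite T'" "df T' Q'" "\<forall>z. (0, z) \<in> T' \<longrightarrow> fst z = \<sigma>"
    "\<forall>t z. (t, z) \<in> T' \<longrightarrow> t \<noteq> 0 \<longrightarrow> (fst z, V' t z) \<in> B"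
    "A' = {a\<in>carr U \<sigma>. Q' (V'(0 := \<lambda>_. a))}"
    by (rule dsetE[OF assms(2)])
  \<comment> \<open>The parameters of the two sets go to the even and to the odd copies, while copy
    0 is shared.\<close>
  let ?g = "\<lambda>t. 2 * t :: nat" and ?g' = "\<lambda>t. if t = 0 then 0 else 2 * t + 1 :: nat"
  define T'' where "T'' = (\<lambda>(t, z). (?g t, z)) ` T \<union> (\<lambda>(t, z). (?g' t, z)) ` T'"
  define V'' where "V'' n = (if even n then V (n div 2) else V' (n div 2))" for n
  have "df T'' (\<lambda>V. Q (\<lambda>t. V (?g t)))"
    using df_subst[OF T(2), of "\<lambda>t z. ?g t" "\<lambda>t z. z" T''] by (force simp: T''_def)
  moreover have "df T'' (\<lambda>V. Q' (\<lambda>t. V (?g' t)))"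
    using df_subst[OF T'(2), of "\<lambda>t z. ?g' t" "\<lambda>t z. z" T''] by (force simp: T''_def)
  ultimately have df: "df T'' (\<lambda>V. Q (\<lambda>t. V (?g t)) \<and> Q' (\<lambda>t. V (?g' t)))" by (rule df_conj)
  have "(\<lambda>t. (V''(0 := \<lambda>_. a)) (?g t)) = V(0 := \<lambda>_. a)" for a by (auto simp: V''_def)
  moreover have "(\<lambda>t. (V''(0 := \<lambda>_. a)) (?g' t)) = V'(0 := \<lambda>_. a)" for a by (auto simp: V''_def)
  ultimately show ?thesis
  proof (intro dsetI[OF df, of \<sigma> V''])
    show "(fst z, V'' t z) \<in> B" if "(t, z) \<in> T''" "t \<noteq> 0" for t z
      using that T(4) T'(4) by (auto simp: T''_def V''_def split: if_splits)
    show "fst z = \<sigma>" if "(0, z) \<in> T''" for z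
      using that T(3)[rule_format, of z] T'(3)[rule_format, of z]
      by (auto simp: T''_def split: if_splits)
  qed (auto simp: T(5) T'(5))
qed

lemma dset_carr: "dset B \<sigma> (carr U \<sigma>)"
  by (rule dsetI[where T = "{}" and Q = "\<lambda>_. True"]) (auto intro: df_True)

lemma dset_INT:
  assumes "finite E" "\<And>e. e \<in> E \<Longrightarrow> dset B \<sigma> (A e)"
  shows "dset B \<sigma> (carr U \<sigma> \<inter> (\<Inter>e\<in>E. A e))"
  using assms
proof (induction E rule: finite_induct)
  case (insert e E)
  have "dset B \<sigma> (A e)" "dset B \<sigma> (carr U \<sigma> \<inter> (\<Inter>e\<in>E. A e))" using insert by simp_all
  from dset_Int[OF this] show ?case by (simp add: Int_left_commute)
qed (simp add: dset_carr)

text \<open>Saturation speaks about formulas with constants in one variable. A definable set is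
  rewritten in this form by turning its parameters into constants and all variables of copy 0 into
  \<open>(\<sigma>, 0)\<close>.\<close>

lemma saturated_dset:
  assumes "saturated L U" "B \<subseteq> elements U" "small U B" "\<sigma> \<in> sorts L"
    and dset: "\<And>A. A \<in> \<A> \<Longrightarrow> dset B \<sigma> A"
    and fip: "\<And>F. finite F \<Longrightarrow> F \<subseteq> \<A> \<Longrightarrow> \<exists>a\<in>carr U \<sigma>. \<forall>A\<in>F. a \<in> A"
  shows "\<exists>a\<in>carr U \<sigma>. \<forall>A\<in>\<A>. a \<in> A"
proof -
  let ?L = "const_lang L B" and ?U = "const_struct U B"
  have ex: "\<exists>\<psi>. \<psi> \<in> formulas ?L [(\<sigma>, 0)] \<and> (\<forall>a\<in>carr U \<sigma>. holds ?U [(\<sigma>, 0)] \<psi> [a] \<longleftrightarrow> a \<in> A)"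
    if A: "A \<in> \<A>" for A
  proof -
    obtain T Q V where T: "finite T" "df T Q" "\<forall>z. (0, z) \<in> T \<longrightarrow> fst z = \<sigma>"
      "\<forall>t z. (t, z) \<in> T \<longrightarrow> t \<noteq> 0 \<longrightarrow> (fst z, V t z) \<in> B"
      "A = {a\<in>carr U \<sigma>. Q (V(0 := \<lambda>_. a))}"
      by (rule dsetE[OF dset[OF A]])
    obtain \<phi> where \<phi>: "wf_fm L \<phi>" "fv \<phi> \<subseteq> enc ` T" "Q = (\<lambda>V. sat U (untag V) \<phi>)"
      using T(2) by (rule dfE)
    define \<tau> :: "'s var \<Rightarrow> ('s, 'f + 's \<times> 'a) tm" where
      "\<tau> x = (if fst (dec x) = 0 then Var (\<sigma>, 0)
              else Fn (Inr (fst x, V (fst (dec x)) (snd (dec x)))) [])" for x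
    have \<tau>: "has_sort ?L (\<tau> x) (fst x)" and ev: "eval ?U (\<lambda>_. a) (\<tau> x) = untag (V(0 := \<lambda>_. a)) x"
      if x: "x \<in> fv \<phi>" for x a
    proof -
      obtain t z where x: "x = enc (t, z)" "(t, z) \<in> T" using \<phi>(2) x by auto
      show "has_sort ?L (\<tau> x) (fst x)"
      proof (cases "t = 0")
        case True
        then have "fst z = \<sigma>" using T(3) x by blast
        then show ?thesis
          using has_sort.intros(1)[of "(\<sigma>, 0)" ?L] assms(4) True
          by (simp add: \<tau>_def x fst_enc const_lang_def)
      next
        case False
        then have "(fst z, V t z) \<in> B" using T(4) x by blast
        then show ?thesis
          using has_sort.intros(2)[of "Inr (fst z, V t z)" ?L "[]"] False
          by (simp add: \<tau>_def x fst_enc const_lang_def)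
      qed
      show "eval ?U (\<lambda>_. a) (\<tau> x) = untag (V(0 := \<lambda>_. a)) x"
        using T(4)[rule_format, OF x(2)] by (auto simp: \<tau>_def x fst_enc const_struct_def)
    qed
    have "\<exists>\<psi>. wf_fm ?L \<psi> \<and> fv \<psi> = (\<Union>x\<in>fv \<phi>. tm_vars (\<tau> x)) \<and>
        (\<forall>v. sat ?U v \<psi> \<longleftrightarrow> sat U (\<lambda>x. eval ?U v (\<tau> x)) \<phi>)"
      by (rule embedding.translate[OF embedding_const \<phi>(1)]) (rule \<tau>)
    then obtain \<psi> where \<psi>: "wf_fm ?L \<psi>" "fv \<psi> = (\<Union>x\<in>fv \<phi>. tm_vars (\<tau> x))"
      "\<forall>v. sat ?U v \<psi> \<longleftrightarrow> sat U (\<lambda>x. eval ?U v (\<tau> x)) \<phi>"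
      by (elim exE conjE)
    have fv: "fv \<psi> \<subseteq> {(\<sigma>, 0)}" by (auto simp: \<psi>(2) \<tau>_def split: if_splits)
    have "holds ?U [(\<sigma>, 0)] \<psi> [a] \<longleftrightarrow> a \<in> A" if "a \<in> carr U \<sigma>" for a
    proof -
      have "holds ?U [(\<sigma>, 0)] \<psi> [a] \<longleftrightarrow> sat ?U (\<lambda>_. a) \<psi>"
        unfolding holds_def by (rule sat_cong) (use fv in auto)
      also have "\<dots> \<longleftrightarrow> sat U (untag (V(0 := \<lambda>_. a))) \<phi>"
        unfolding \<psi>(3)[rule_format] by (rule sat_cong) (rule ev)
      finally show ?thesis using T(5) that by (simp add: \<phi>(3))
    qed
    then show ?thesis using \<psi>(1) fv by (intro exI[of _ \<psi>]) (auto simp: formulas_def)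
  qed
  from bchoice[OF ballI[OF ex]] obtain \<psi> where "\<forall>A\<in>\<A>. \<psi> A \<in> formulas ?L [(\<sigma>, 0)] \<and>
      (\<forall>a\<in>carr U \<sigma>. holds ?U [(\<sigma>, 0)] (\<psi> A) [a] \<longleftrightarrow> a \<in> A)"
    by (rule exE)
  then have \<psi>: "\<And>A. A \<in> \<A> \<Longrightarrow> \<psi> A \<in> formulas ?L [(\<sigma>, 0)]"
    "\<And>A a. A \<in> \<A> \<Longrightarrow> a \<in> carr U \<sigma> \<Longrightarrow> holds ?U [(\<sigma>, 0)] (\<psi> A) [a] \<longleftrightarrow> a \<in> A"
    by simp_all
  have "\<exists>a\<in>carr U \<sigma>. \<forall>\<phi>\<in>\<psi> ` \<A>. holds ?U [(\<sigma>, 0)] \<phi> [a]"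
  proof (rule assms(1)[unfolded saturated_def, THEN spec[of _ B], THEN spec[of _ \<sigma>],
        THEN spec[of _ "\<psi> ` \<A>"], THEN mp], intro conjI)
    show "\<forall>q. finite q \<and> q \<subseteq> \<psi> ` \<A> \<longrightarrow> (\<exists>a\<in>carr U \<sigma>. \<forall>\<phi>\<in>q. holds ?U [(\<sigma>, 0)] \<phi> [a])"
    proof (intro allI impI, elim conjE)
      fix q assume "finite q" "q \<subseteq> \<psi> ` \<A>"
      then obtain F where F: "finite F" "F \<subseteq> \<A>" "q = \<psi> ` F" using finite_subset_image by metis
      obtain a where "a \<in> carr U \<sigma>" "\<forall>A\<in>F. a \<in> A" using fip[OF F(1,2)] by (rule bexE)
      then show "\<exists>a\<in>carr U \<sigma>. \<forall>\<phi>\<in>q. holds ?U [(\<sigma>, 0)] \<phi> [a]"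
        using F \<psi>(2) by (intro bexI[of _ a]) auto
    qed
  qed (use assms(2-4) \<psi>(1) in auto)
  then show ?thesis using \<psi>(2) by auto
qed

text \<open>Shifting the copies by one frees copy 0 for the single coordinate
  \<open>(t0, z)\<close>; every other coordinate becomes a parameter, even within copy
  \<open>t0\<close>.\<close>

lemma dset_coord:
  assumes "df T Q" "\<And>t y. (t, y) \<in> T \<Longrightarrow> (t, y) \<noteq> (t0, z) \<Longrightarrow> (fst y, V t y) \<in> B"
  shows "dset B (fst z) {a\<in>carr U (fst z). Q (V(t0 := (V t0)(z := a)))}"
proof -
  define g where "g t y = (if (t, y) = (t0, z) then 0 else Suc t)" for t y
  define Vs where "Vs n = (case n of 0 \<Rightarrow> undefined | Suc t \<Rightarrow> V t)" for n
  have df: "df ((\<lambda>(t, y). (g t y, y)) ` T) (\<lambda>V. Q (\<lambda>t y. V (g t y) y))"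
    by (rule df_subst[OF assms(1)]) (auto intro: rev_image_eqI)
  have "(\<lambda>t y. (Vs(0 := \<lambda>_. a)) (g t y) y) = V(t0 := (V t0)(z := a))" for a
    by (auto simp: Vs_def g_def fun_eq_iff)
  then show ?thesis
  proof (intro dsetI[OF df, of _ Vs])
    show "fst y = fst z" if "(0, y) \<in> (\<lambda>(t, y). (g t y, y)) ` T" for y
      using that by (auto simp: g_def split: if_splits)
    show "(fst y, Vs t y) \<in> B" if "(t, y) \<in> (\<lambda>(t, y). (g t y, y)) ` T" "t \<noteq> 0" for t y
      using that assms(2) by (force simp: g_def Vs_def split: if_splits)
  qed simp
qed

text \<open>Here copy 1 holds the variables of the branches and copy 2 those of the nodes.\<close>

lemma df_tree:
  fixes \<phi> I
  defines "R \<equiv> \<lambda>u w. sat U (override_on w u I) \<phi>"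
  assumes \<phi>: "wf_fm L \<phi>" and I: "I \<subseteq> fv \<phi>"
    and QD: "finite TD" "df TD QD" "\<And>z. (2, z) \<in> TD \<Longrightarrow> z \<in> I" "\<And>z. (1, z) \<notin> TD"
    and QS: "finite TS" "df TS QS" "\<And>z. (1, z) \<in> TS \<Longrightarrow> z \<in> fv \<phi> - I" "\<And>z. (2, z) \<notin> TS"
  shows "df ((TS \<union> TD) - {1, 2} \<times> UNIV)
    (\<lambda>V. tree R {u\<in>Vals I. QD (V(2 := u))} r {w\<in>Vals (fv \<phi> - I). QS (V(1 := w))})"
  using QS
proof (induction r arbitrary: TS QS)
  case 0
  have "df (TS - {1} \<times> UNIV) (\<lambda>V. \<exists>w\<in>Vals (fv \<phi> - I). QS (V(1 := w)))"
    by (rule df_ex[OF _ 0(2,3)]) (simp add: finite_fv)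
  then have "df ((TS \<union> TD) - {1, 2} \<times> UNIV) (\<lambda>V. \<exists>w\<in>Vals (fv \<phi> - I). QS (V(1 := w)))"
    by (rule df_mono) (use 0(4) in auto)
  moreover have "tree R D 0 {w\<in>W. Q w} \<longleftrightarrow> (\<exists>w\<in>W. Q w)" for D W Q by auto
  ultimately show ?case by (simp only:)
next
  case (Suc r)
  let ?W = "fv \<phi> - I"
  have finI: "finite I" using I finite_fv finite_subset by blast
  have "finite (fst ` (TS \<union> TD) \<union> {0, 1, 2})" using Suc.prems(1) QD(1) by simp
  \<comment> \<open>A fresh copy holds the root. Its relation to the branches is first added to
    \<open>QS\<close>, for each of the two signs, so that the induction hypothesis expresses both
    subtrees; only then is the root quantified.\<close>
  then obtain t where t: "t \<notin> fst ` (TS \<union> TD) \<union> {0, 1, 2}"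
    using ex_new_if_finite infinite_UNIV_nat by blast
  have tT: "(t, z) \<notin> TS" "(t, z) \<notin> TD" for z using t by force+
  have t12: "t \<noteq> 1" "t \<noteq> 2" using t by auto
  let ?R = "\<lambda>V. sat U (\<lambda>z. V (if z \<in> I then t else 1) z) \<phi>"
  let ?T1 = "TS \<union> {t} \<times> I \<union> {1} \<times> ?W"
  let ?T = "((TS \<union> TD) - {1, 2} \<times> UNIV) \<union> {t} \<times> I"
  have dfR: "df ?T1 ?R" by (rule df_atom[OF \<phi>]) auto
  have dfS: "df ?T1 QS" by (rule df_mono[OF Suc.prems(2)]) auto
  have fin1: "finite ?T1" using Suc.prems(1) finI finite_fv[of \<phi>]
    by (intro finite_UnI finite_cartesian_product) simp_all
  have "(?T1 \<union> TD) - {1, 2} \<times> UNIV = ?T" using t12 by auto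
  moreover have "df ((?T1 \<union> TD) - {1, 2} \<times> UNIV) (\<lambda>V. tree R {u\<in>Vals I. QD (V(2 := u))} r
      {w\<in>Vals ?W. QS (V(1 := w)) \<and> ?R (V(1 := w))})"
    by (rule Suc.IH[OF fin1 df_conj[OF dfS dfR]]) (use Suc.prems(3,4) t12 in auto)
  moreover have "df ((?T1 \<union> TD) - {1, 2} \<times> UNIV) (\<lambda>V. tree R {u\<in>Vals I. QD (V(2 := u))} r
      {w\<in>Vals ?W. QS (V(1 := w)) \<and> \<not> ?R (V(1 := w))})"
    by (rule Suc.IH[OF fin1 df_conj[OF dfS df_not[OF dfR]]]) (use Suc.prems(3,4) t12 in auto)
  ultimately have
    1: "df ?T (\<lambda>V. tree R {u\<in>Vals I. QD (V(2 := u))} r {w\<in>Vals ?W. QS (V(1 := w)) \<and> ?R (V(1 := w))})"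
    and 2: "df ?T (\<lambda>V. tree R {u\<in>Vals I. QD (V(2 := u))} r {w\<in>Vals ?W. QS (V(1 := w)) \<and> \<not> ?R (V(1 := w))})"
    by simp_all
  have "df ?T (\<lambda>V. QD (\<lambda>t' z. V (if t' = 2 then t else t') z))"
    by (rule df_subst[OF QD(2)]) (use QD(3,4) in auto)
  moreover have "(\<lambda>t' z. V (if t' = 2 then t else t') z) = V(2 := V t)" for V :: "nat \<Rightarrow> 's var \<Rightarrow> 'a"
    by auto
  ultimately have 3: "df ?T (\<lambda>V. QD (V(2 := V t)))" by (simp only:)
  have "df (?T - {t} \<times> UNIV) (\<lambda>V. \<exists>u\<in>Vals I. QD ((V(t := u))(2 := (V(t := u)) t)) \<and>
      tree R {u'\<in>Vals I. QD ((V(t := u))(2 := u'))} r {w\<in>Vals ?W. QS ((V(t := u))(1 := w)) \<and> ?R ((V(t := u))(1 := w))} \<and>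
      tree R {u'\<in>Vals I. QD ((V(t := u))(2 := u'))} r {w\<in>Vals ?W. QS ((V(t := u))(1 := w)) \<and> \<not> ?R ((V(t := u))(1 := w))})"
    by (rule df_ex[OF finI df_conj[OF 3 df_conj[OF 1 2]]]) (use tT in auto)
  moreover have "?T - {t} \<times> UNIV = (TS \<union> TD) - {1, 2} \<times> UNIV" using tT by auto
  moreover have "QD ((V(t := u))(2 := u')) \<longleftrightarrow> QD (V(2 := u'))" for V u u'
    by (rule df_support[OF QD(2)]) (use tT in auto)
  moreover have "QS ((V(t := u))(1 := w)) \<longleftrightarrow> QS (V(1 := w))" for V u w
    by (rule df_support[OF Suc.prems(2)]) (use tT in auto)
  moreover have "(\<lambda>z. ((V(t := u))(1 := w)) (if z \<in> I then t else 1) z) = override_on w u I"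
    for V :: "nat \<Rightarrow> 's var \<Rightarrow> 'a" and u w
    using t12 by (auto simp: override_on_def)
  moreover have "(V(t := u)) t = u" for V :: "nat \<Rightarrow> 's var \<Rightarrow> 'a" and u by simp
  ultimately have "df ((TS \<union> TD) - {1, 2} \<times> UNIV) (\<lambda>V. \<exists>u\<in>Vals I. QD (V(2 := u)) \<and>
      tree R {u'\<in>Vals I. QD (V(2 := u'))} r {w\<in>Vals ?W. QS (V(1 := w)) \<and> R u w} \<and>
      tree R {u'\<in>Vals I. QD (V(2 := u'))} r {w\<in>Vals ?W. QS (V(1 := w)) \<and> \<not> R u w})"
    by (simp only: R_def)
  moreover have "tree R {u\<in>A. P u} (Suc r) {w\<in>W. Q w} \<longleftrightarrow> (\<exists>u\<in>A. P u \<and>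
      tree R {u\<in>A. P u} r {w\<in>W. Q w \<and> R u w} \<and> tree R {u\<in>A. P u} r {w\<in>W. Q w \<and> \<not> R u w})"
    for A P W Q
    by (simp add: conj_commute conj_left_commute Bex_def)
  ultimately show ?case by (simp only:)
qed

end

section \<open>Stable definable sets\<close>

lemma holds_map: "fv \<phi> \<subseteq> set xs \<Longrightarrow> holds M xs \<phi> (map v xs) \<longleftrightarrow> sat M v \<phi>"
  unfolding holds_def map_of_zip_map by (rule sat_cong) auto

lemma in_pow_map: "map v xs \<in> pow C xs \<longleftrightarrow> (\<forall>z\<in>set xs. v z \<in> C (fst z))"
  by (simp add: pow_def tuples_def list.rel_map list_all2_same)

lemma small_countable:
  assumes "countable P" "uncountable (elements U)"
  shows "small U P"
proof -
  have "\<not> |elements U| \<le>o |P|"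
  proof
    assume "|elements U| \<le>o |P|"
    then obtain f where "inj_on f (elements U)" "f ` elements U \<subseteq> P" by (auto simp: card_of_ordLeq[symmetric])
    then have "countable (elements U)"
      using assms(1) by (metis countable_image_inj_on countable_subset)
    with assms(2) show False ..
  qed
  then show ?thesis
    using not_ordLeq_iff_ordLess[OF card_of_Well_order card_of_Well_order, of "elements U" P]
    by (simp add: small_def)
qed

lemma sorted_list_of_set_strict_mono:
  fixes g :: "nat \<Rightarrow> nat"
  assumes "strict_mono g"
  shows "sorted_list_of_set (g ` {..<n}) = map g [0..<n]"
proof -
  have "sorted (map g [0..<n])"
    using assms by (auto simp: sorted_iff_nth_mono strict_mono_less_eq)
  moreover have "distinct (map g [0..<n])"
    using strict_mono_imp_inj_on[OF assms] by (simp add: distinct_map inj_on_def)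
  ultimately have "sorted_list_of_set (set (map g [0..<n])) = map g [0..<n]"
    by (rule sorted_list_of_set.idem_if_sorted_distinct)
  moreover have "set (map g [0..<n]) = g ` {..<n}" by auto
  ultimately show ?thesis by simp
qed

text \<open>\<open>X\<close> is defined by \<open>QX\<close> with the parameters \<open>VX\<close> from \<open>F\<close>. The last assumption is stability of
  the structure induced on \<open>X\<close>.\<close>

locale stable_set = fo_structure L U
  for L :: "('s, 'f, 'r) lang" and U :: "('s, 'f, 'r, 'a) fo_struct" +
  fixes F :: "('s \<times> 'a) set" and s :: 's and X :: "'a set"
    and TX :: "(nat \<times> 's var) set" and QX :: "(nat \<Rightarrow> 's var \<Rightarrow> 'a) \<Rightarrow> bool"
    and VX :: "nat \<Rightarrow> 's var \<Rightarrow> 'a"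
  assumes sat: "saturated L U" and nip: "NIP_in L U" and unc: "uncountable (elements U)"
    and F: "F \<subseteq> elements U"
    and X: "finite TX" "df TX QX" "\<And>z. (0, z) \<in> TX \<Longrightarrow> fst z = s"
      "\<And>t z. (t, z) \<in> TX \<Longrightarrow> t \<noteq> 0 \<Longrightarrow> (fst z, VX t z) \<in> F"
      "X = {a\<in>carr U s. QX (VX(0 := \<lambda>_. a))}"
    and stable: "\<And>T Q t0 A B. df T Q \<Longrightarrow> (\<And>t z. (t, z) \<in> T \<Longrightarrow> fst z = s) \<Longrightarrow>
      (\<And>i z. (t0, z) \<in> T \<Longrightarrow> A i z \<in> X) \<Longrightarrow>
      (\<And>j t z. (t, z) \<in> T \<Longrightarrow> t \<noteq> t0 \<Longrightarrow> B j t z \<in> X) \<Longrightarrow>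
      (\<And>i j :: nat. Q ((B j)(t0 := A i)) \<longleftrightarrow> i < j) \<Longrightarrow> False"
begin

section \<open>NIP and orders with one side in X\<close>

lemma X_carr: "X \<subseteq> carr U s"
  by (auto simp: X(5))

lemma s_sort: "X \<noteq> {} \<Longrightarrow> s \<in> sorts L"
  using X_carr is_struct by (auto simp: is_struct_def)

text \<open>Valuations replace tuples, and \<open>I\<close> is arbitrary, so that the bound can be
  used for either side of a formula: for tuples of \<open>X\<close> in \<open>no_order\<close>, for
  parameters of a type in \<open>extension\<close>.\<close>

lemma nip_bound:
  assumes \<phi>: "wf_fm L \<phi>" and I: "I \<subseteq> fv \<phi>"
  obtains d where "\<And>Y. finite Y \<Longrightarrow> Y \<subseteq> Vals I \<Longrightarrow>
    (\<And>b. \<exists>w\<in>Vals (fv \<phi> - I). \<forall>y\<in>Y. sat U (override_on w y I) \<phi> = b y) \<Longrightarrow> card Y \<le> d"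
proof -
  obtain xs where xs: "set xs = I" "distinct xs"
    using finite_distinct_list[OF finite_subset[OF I finite_fv]] by auto
  obtain ws where ws: "set ws = fv \<phi> - I" "distinct ws"
    using finite_distinct_list[of "fv \<phi> - I"] finite_fv by auto
  have fv: "fv \<phi> \<subseteq> set (xs @ ws)" using xs ws by auto
  have "set (xs @ ws) = fv \<phi>" using xs ws I by auto
  then have "var_tuple L (xs @ ws)" "\<phi> \<in> formulas L (xs @ ws)"
    using xs ws \<phi> wf_fm_vars[OF \<phi>] by (auto simp: var_tuple_def formulas_def)
  then have "finite_VC_dim {{as \<in> pow (carr U) xs. holds U (xs @ ws) \<phi> (as @ bs)} | bs.
      bs \<in> pow (carr U) ws}" (is "finite_VC_dim ?S")
    using nip by (simp add: NIP_in_def)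
  then obtain d where d: "\<forall>A. finite A \<and> shatters ?S A \<longrightarrow> card A \<le> d"
    unfolding finite_VC_dim_def by (rule exE)
  show ?thesis
  proof (rule that)
    fix Y assume Y: "finite Y" "Y \<subseteq> Vals I"
      and sh: "\<And>b. \<exists>w\<in>Vals (fv \<phi> - I). \<forall>y\<in>Y. sat U (override_on w y I) \<phi> = b y"
    have holds: "holds U (xs @ ws) \<phi> (map y xs @ map w ws) \<longleftrightarrow> sat U (override_on w y I) \<phi>" for y w
    proof -
      have "map y xs @ map w ws = map (override_on w y I) (xs @ ws)"
        using xs ws by (auto simp: override_on_def)
      then show ?thesis using holds_map[OF fv] by metis
    qed
    \<comment> \<open>Members of \<open>Y\<close> could differ only outside \<open>I\<close>; the
      pattern isolating one of them excludes this, so no member is lost when valuations become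
      tuples.\<close>
    have inj: "inj_on (\<lambda>y. map y xs) Y"
    proof (rule inj_onI, rule ccontr)
      fix y y' assume y: "y \<in> Y" "y' \<in> Y" "map y xs = map y' xs" "y \<noteq> y'"
      obtain w where w: "\<forall>x\<in>Y. sat U (override_on w x I) \<phi> = (x = y)" using sh[of "\<lambda>x. x = y"] by blast
      have "override_on w y I = override_on w y' I"
        using y(3) xs by (auto simp: override_on_def)
      then show False using w y by metis
    qed
    have "shatters ?S ((\<lambda>y. map y xs) ` Y)"
      unfolding shatters_def
    proof (intro allI impI)
      fix B assume B: "B \<subseteq> (\<lambda>y. map y xs) ` Y"
      obtain w where w: "w \<in> Vals (fv \<phi> - I)" "\<forall>y\<in>Y. sat U (override_on w y I) \<phi> = (map y xs \<in> B)"
        using sh[of "\<lambda>y. map y xs \<in> B"] by blast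
      have bs: "map w ws \<in> pow (carr U) ws" using w(1) ws by (simp add: in_pow_map Vals_def)
      have as: "map y xs \<in> pow (carr U) xs" if "y \<in> Y" for y
        using Y(2) that xs by (auto simp: in_pow_map Vals_def)
      let ?C = "{as \<in> pow (carr U) xs. holds U (xs @ ws) \<phi> (as @ map w ws)}"
      have "?C \<inter> (\<lambda>y. map y xs) ` Y = B"
        using B w(2) as by (auto simp: holds)
      moreover have "?C \<in> ?S" using bs by blast
      ultimately show "\<exists>C\<in>?S. C \<inter> (\<lambda>y. map y xs) ` Y = B" by (rule bexI)
    qed
    then have "card ((\<lambda>y. map y xs) ` Y) \<le> d" using d Y(1) by simp
    then show "card Y \<le> d" using card_image[OF inj] by simp
  qed
qed

text \<open>Only the \<open>u i\<close> lie in \<open>X\<close>. Pass to a sequence \<open>u\<close> that is indiscernible for the formulas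
  saying that a \<open>0\<close>-\<open>1\<close>-word of length \<open>n\<close> is realised on \<open>n\<close> members of \<open>u\<close>. If moving a letter of a
  realised word to the end destroyed realisability, there would be an order inside \<open>X\<close>; so all
  words are realised, against NIP.\<close>

lemma no_order:
  assumes \<phi>: "wf_fm L \<phi>" and I: "I \<subseteq> fv \<phi>" "\<And>z. z \<in> I \<Longrightarrow> fst z = s"
    and u: "\<And>(i::nat) z. z \<in> I \<Longrightarrow> u i z \<in> X" and w: "\<And>j. w j \<in> Vals (fv \<phi> - I)"
    and ord: "\<And>i j. sat U (override_on (w j) (u i) I) \<phi> \<longleftrightarrow> i < j"
  shows False
proof -
  let ?W = "fv \<phi> - I"
  obtain d where d: "\<And>Y. finite Y \<Longrightarrow> Y \<subseteq> Vals I \<Longrightarrow>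
    (\<And>b. \<exists>w\<in>Vals ?W. \<forall>y\<in>Y. sat U (override_on w y I) \<phi> = b y) \<Longrightarrow> card Y \<le> d"
    using nip_bound[OF \<phi> I(1)] by metis
  \<comment> \<open>One more than the NIP bound: if all words of length \<open>n\<close> are
    realised, then \<open>n\<close> members of the sequence are shattered.\<close>
  define n where "n = Suc d"
  have n0: "n > 0" by (simp add: n_def)
  \<comment> \<open>The members of the sequence occupy the copies \<open>q + 2\<close>, and copy 1
    is used for the realising tuple. As the latter is quantified away, \<open>P\<close> speaks only
    about tuples of \<open>X\<close>; this is what brings a putative order inside
    \<open>X\<close>.\<close>
  define P where "P \<eta> V \<longleftrightarrow> (\<exists>w\<in>Vals ?W. \<forall>q\<in>{..<n}. sat U (override_on w (V (q + 2)) I) \<phi> = \<eta> ! q)"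
    for \<eta> :: "bool list" and V :: "nat \<Rightarrow> 's var \<Rightarrow> 'a"
  define T2 where "T2 = (\<lambda>(q, z). (q + 2, z)) ` ({..<n} \<times> I)"
  have dfP: "df T2 (P \<eta>)" for \<eta>
  proof -
    let ?T = "T2 \<union> {1} \<times> ?W"
    let ?Q = "\<lambda>V. \<forall>q\<in>{..<n}. sat U (\<lambda>z. V (if z \<in> I then q + 2 else 1) z) \<phi> = \<eta> ! q"
    have "df ?T ?Q"
    proof (intro df_Ball df_const_iff df_atom[OF \<phi>])
      show "(if z \<in> I then q + 2 else 1, z) \<in> ?T" if "q \<in> {..<n}" "z \<in> fv \<phi>" for q z
        using that by (auto simp: T2_def)
    qed simp_all
    then have "df (?T - {1} \<times> UNIV) (\<lambda>V. \<exists>w\<in>Vals ?W. ?Q (V(1 := w)))"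
      by (rule df_ex[rotated]) (auto simp: finite_fv T2_def)
    moreover have "(\<lambda>z. (V(1 := w)) (if z \<in> I then q + 2 else 1) z) = override_on w (V (q + 2)) I"
      for V :: "nat \<Rightarrow> 's var \<Rightarrow> 'a" and w q
      by (auto simp: override_on_def)
    ultimately have "df (?T - {1} \<times> UNIV) (P \<eta>)"
      unfolding P_def[abs_def] by (simp only:)
    then show ?thesis by (rule df_mono) auto
  qed
  define word where "word \<eta> f \<longleftrightarrow> P \<eta> (\<lambda>t. u (f (t - 2)))" for \<eta> f
  have word_cong: "word \<eta> f \<longleftrightarrow> word \<eta> g" if "\<And>q. q < n \<Longrightarrow> f q = g q" for \<eta> f g
    unfolding word_def P_def using that by simp
  have "finite {\<eta> :: bool list. length \<eta> = n}"
    using finite_lists_length_eq[of "UNIV :: bool set" n] by simp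
  then obtain Y where Y: "infinite Y"
    "\<And>\<eta> S S'. \<eta> \<in> {\<eta>. length \<eta> = n} \<Longrightarrow> S \<subseteq> Y \<Longrightarrow> S' \<subseteq> Y \<Longrightarrow> finite S \<Longrightarrow> finite S' \<Longrightarrow>
       card S = n \<Longrightarrow> card S' = n \<Longrightarrow>
       word \<eta> ((!) (sorted_list_of_set S)) \<longleftrightarrow> word \<eta> ((!) (sorted_list_of_set S'))"
    using ramsey_simultaneous[of "{\<eta>. length \<eta> = n}" n "\<lambda>\<eta> S. word \<eta> ((!) (sorted_list_of_set S))"]
    by metis
  define e where "e = enumerate Y"
  have e: "strict_mono e" "\<And>i. e i \<in> Y"
    using Y(1) by (auto simp: e_def strict_mono_enumerate enumerate_in_set)
  have hom: "word \<eta> (\<lambda>i. e (f i)) \<longleftrightarrow> word \<eta> (\<lambda>i. e (g i))"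
    if "length \<eta> = n" "strict_mono f" "strict_mono g" for \<eta> and f g :: "nat \<Rightarrow> nat"
  proof -
    have *: "word \<eta> h \<longleftrightarrow> word \<eta> ((!) (sorted_list_of_set (h ` {..<n})))" "card (h ` {..<n}) = n"
      if "strict_mono h" for h :: "nat \<Rightarrow> nat"
      using that by (auto simp: sorted_list_of_set_strict_mono card_image strict_mono_imp_inj_on
          inj_on_subset intro!: word_cong)
    have m: "strict_mono (\<lambda>i. e (f i))" "strict_mono (\<lambda>i. e (g i))"
      using e(1) that(2,3) by (auto simp: strict_mono_def)
    show ?thesis
      unfolding *(1)[OF m(1)] *(1)[OF m(2)]
      by (rule Y(2)) (use that(1) e(2) *(2)[OF m(1)] *(2)[OF m(2)] in auto)
  qed
  define True_words where "True_words = {\<eta>. length \<eta> = n \<and> word \<eta> e}"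
  have TW: "word \<eta> (\<lambda>i. e (f i))" if "\<eta> \<in> True_words" "strict_mono f" for \<eta> f
    using hom[of \<eta> "\<lambda>i. i" f] that by (auto simp: True_words_def strict_mono_def)
  \<comment> \<open>These words come from the given order: \<open>w (e k)\<close> separates the
    first \<open>k\<close> members of the subsequence from the rest.\<close>
  have base: "replicate k True @ replicate (n - k) False \<in> True_words" if "k \<le> n" for k
  proof -
    have "sat U (override_on (w (e k)) (u (e q)) I) \<phi> = (replicate k True @ replicate (n - k) False) ! q"
      if "q < n" for q
      using \<open>k \<le> n\<close> that by (simp add: ord strict_mono_less[OF e(1)] nth_append)
    then have "word (replicate k True @ replicate (n - k) False) e"
      unfolding word_def P_def using w by (intro bexI[of _ "w (e k)"]) auto
    then show ?thesis using that by (simp add: True_words_def)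
  qed
  have move: "take j \<eta> @ drop (Suc j) \<eta> @ [\<eta> ! j] \<in> True_words"
    if \<eta>: "\<eta> \<in> True_words" "length \<eta> = n" and j: "j < n" for \<eta> j
  proof (rule ccontr)
    let ?\<eta> = "take j \<eta> @ drop (Suc j) \<eta> @ [\<eta> ! j]"
    assume neg: "?\<eta> \<notin> True_words"
    have len: "length ?\<eta> = n" using \<eta> j by simp
    have nth: "?\<eta> ! q = (if q < j then \<eta> ! q else if q < n - 1 then \<eta> ! Suc q else \<eta> ! j)" if "q < n" for q
      using \<eta> j that by (auto simp: nth_append min_def)
    have false: "\<not> word ?\<eta> (\<lambda>i. e (f i))" if "strict_mono f" for f
    proof
      assume "word ?\<eta> (\<lambda>i. e (f i))"
      then have "word ?\<eta> (\<lambda>i. e i)" using hom[OF len that, of "\<lambda>i. i"] by (simp add: strict_mono_def)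
      with neg len show False by (simp add: True_words_def)
    qed
    \<comment> \<open>\<open>A i\<close> begins an even block of length \<open>n\<close>; the
      entries of \<open>B l\<close> at positions beyond \<open>j\<close> lie in an odd block, those
      before \<open>j\<close> at the start. For \<open>i < l\<close> the entry \<open>A i\<close>
      falls between these two groups, and \<open>\<eta>\<close> is read along an increasing
      sequence. For \<open>i \<ge> l\<close> it comes after all of them, so realising
      \<open>\<eta>\<close> would realise the moved word.\<close>
    define A where "A i = u (e (n * (2 * i + 2)))" for i
    define B where "B l t = (if t - 2 < j then u (e (t - 2)) else u (e (n * (2 * l + 1) + (t - 2))))"
      for l and t :: nat
    have PAB: "P \<eta> ((B l)(j + 2 := A i)) \<longleftrightarrow> i < l" for i l
    proof (cases "i < l")
      case True
      define g where "g q = (if q < j then q else if q = j then n * (2 * i + 2) else n * (2 * l + 1) + q)" for q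
      have "n * (2 * i + 2) \<le> n * (2 * l)" using True by (intro mult_le_mono2) simp
      then have "n * (2 * i + 2) < n * (2 * l + 1)" using n0 by simp
      moreover have "n \<le> n * (2 * i + 2)" by simp
      ultimately have "g q < g (Suc q)" for q using j by (auto simp: g_def)
      then have "strict_mono g" by (simp add: strict_mono_Suc_iff)
      then have "word \<eta> (\<lambda>i. e (g i))" by (rule TW[OF \<eta>(1)])
      moreover have "((B l)(j + 2 := A i)) (q + 2) = u (e (g q))" for q
        by (auto simp: B_def A_def g_def)
      ultimately show ?thesis using True by (simp add: word_def P_def)
    next
      case False
      define g where "g q = (if q < j then q else if q < n - 1 then n * (2 * l + 1) + Suc q
        else n * (2 * i + 2) + (q - (n - 1)))" for q
      have "n * (2 * l + 2) \<le> n * (2 * i + 2)" using False by (intro mult_le_mono2) simp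
      then have "n * (2 * l + 1) + n \<le> n * (2 * i + 2)" by (simp add: algebra_simps)
      moreover have "n * (2 * l) \<le> n * (2 * i)" using False by (intro mult_le_mono2) simp
      moreover have "n \<le> n * (2 * l + 1)" by simp
      ultimately have "g q < g (Suc q)" for q using j by (auto simp: g_def less_Suc_eq_le)
      then have "strict_mono g" by (simp add: strict_mono_Suc_iff)
      then have "\<not> word ?\<eta> (\<lambda>i. e (g i))" by (rule false)
      moreover have "word ?\<eta> (\<lambda>i. e (g i))" if PAi: "P \<eta> ((B l)(j + 2 := A i))"
      proof -
        obtain v where v: "v \<in> Vals ?W"
          "\<forall>q\<in>{..<n}. sat U (override_on v (((B l)(j + 2 := A i)) (q + 2)) I) \<phi> = \<eta> ! q"
          using PAi unfolding P_def by (rule bexE)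
        have "sat U (override_on v (u (e (g q))) I) \<phi> = ?\<eta> ! q" if "q < n" for q
        proof -
          define p where "p = (if q < j then q else if q < n - 1 then Suc q else j)"
          have p: "p < n" using that j by (auto simp: p_def)
          have 1: "((B l)(j + 2 := A i)) (p + 2) = u (e (g q))"
            using that j by (auto simp: B_def A_def g_def p_def)
          have 2: "?\<eta> ! q = \<eta> ! p" using nth[OF that] by (simp add: p_def)
          have "sat U (override_on v (((B l)(j + 2 := A i)) (p + 2)) I) \<phi> = \<eta> ! p"
            by (rule bspec[OF v(2)]) (use p in simp)
          then show ?thesis unfolding 1 2 .
        qed
        then show ?thesis unfolding word_def P_def using v(1) by (intro bexI[of _ v]) auto
      qed
      ultimately show ?thesis using False by blast
    qed
    show False
    proof (rule stable[OF dfP[of \<eta>], of "j + 2" A B])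
      show "fst z = s" if "(t, z) \<in> T2" for t z using that I(2) by (auto simp: T2_def)
      show "A i z \<in> X" if "(j + 2, z) \<in> T2" for i z using that u by (auto simp: T2_def A_def)
      show "B l t z \<in> X" if "(t, z) \<in> T2" "t \<noteq> j + 2" for l t z
        using that u by (auto simp: T2_def B_def)
    qed (rule PAB)
  qed
  have all: "\<eta> \<in> True_words" if "length \<eta> = n" for \<eta>
    using words_closed_under_moves[of n True_words \<eta>] base move that by blast
  have "inj (\<lambda>i. u (e i))"
  proof (rule linorder_injI)
    fix i j :: nat assume "i < j"
    then have "e i < e j" using e(1) by (simp add: strict_mono_less)
    then show "u (e i) \<noteq> u (e j)" using ord[of "e j" "e i"] ord[of "e j" "e j"] by auto
  qed
  then have inj: "inj_on (\<lambda>i. u (e i)) {..<n}" by (rule inj_on_subset) simp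
  have "card ((\<lambda>i. u (e i)) ` {..<n}) \<le> d"
  proof (rule d)
    show "(\<lambda>i. u (e i)) ` {..<n} \<subseteq> Vals I" using u I(2) X_carr by (auto simp: Vals_def)
    fix b
    have "map (\<lambda>q. b (u (e q))) [0..<n] \<in> True_words" by (rule all) simp
    then obtain v where "v \<in> Vals ?W"
      "\<forall>q\<in>{..<n}. sat U (override_on v (u (e q)) I) \<phi> = map (\<lambda>q. b (u (e q))) [0..<n] ! q"
      unfolding True_words_def word_def P_def by auto
    then show "\<exists>w\<in>Vals ?W. \<forall>y\<in>(\<lambda>i. u (e i)) ` {..<n}. sat U (override_on w y I) \<phi> = b y"
      by (intro bexI[of _ v]) auto
  qed simp
  then show False using card_image[OF inj] by (simp add: n_def)
qed

lemma no_order_df: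
  assumes "df T Q" "\<And>z. (t0, z) \<in> T \<Longrightarrow> fst z = s" "\<And>i z. (t0, z) \<in> T \<Longrightarrow> A i z \<in> X"
    and B: "\<And>j t z. (t, z) \<in> T \<Longrightarrow> t \<noteq> t0 \<Longrightarrow> B j t z \<in> carr U (fst z)"
    and ord: "\<And>i j :: nat. Q ((B j)(t0 := A i)) \<longleftrightarrow> i < j"
  shows False
proof -
  obtain \<phi> where \<phi>: "wf_fm L \<phi>" "fv \<phi> \<subseteq> enc ` T" "Q = (\<lambda>V. sat U (untag V) \<phi>)"
    using assms(1) by (rule dfE)
  define I where "I = {x\<in>fv \<phi>. fst (dec x) = t0}"
  have dec: "(fst (dec x), snd (dec x)) \<in> T" "fst (snd (dec x)) = fst x" if "x \<in> fv \<phi>" for x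
    using \<phi>(2) that by (auto simp: fst_enc)
  show False
  proof (rule no_order[OF \<phi>(1), of I "\<lambda>i x. A i (snd (dec x))" "\<lambda>j. untag (B j)"])
    show "I \<subseteq> fv \<phi>" by (auto simp: I_def)
    show "fst z = s" "A i (snd (dec z)) \<in> X" if "z \<in> I" for i z
      using that dec[of z] assms(2,3) by (auto simp: I_def)
    show "untag (B j) \<in> Vals (fv \<phi> - I)" for j
      unfolding Vals_def
    proof (intro CollectI ballI)
      fix z assume z: "z \<in> fv \<phi> - I"
      then have "fst (dec z) \<noteq> t0" by (auto simp: I_def)
      with z show "untag (B j) z \<in> carr U (fst z)"
        using B[OF dec(1)[of z], of j] dec(2)[of z] by (simp add: untag_def)
    qed
    fix i j
    have "sat U (override_on (untag (B j)) (\<lambda>x. A i (snd (dec x))) I) \<phi> \<longleftrightarrow>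
        sat U (untag ((B j)(t0 := A i))) \<phi>"
      by (rule sat_cong) (auto simp: override_on_def I_def untag_def)
    also have "\<dots> \<longleftrightarrow> i < j" using ord[of j i] \<phi>(3) by simp
    finally show "sat U (override_on (untag (B j)) (\<lambda>x. A i (snd (dec x))) I) \<phi> \<longleftrightarrow> i < j" .
  qed
qed

text \<open>Membership of the variable \<open>(t, z)\<close> in \<open>X\<close>; the copies of the parameters are placed by \<open>p\<close>.\<close>

definition inX :: "nat \<Rightarrow> 's var \<Rightarrow> (nat \<Rightarrow> nat) \<Rightarrow> (nat \<Rightarrow> 's var \<Rightarrow> 'a) \<Rightarrow> bool" where
  "inX t z p V \<longleftrightarrow> QX (\<lambda>t' z'. V (if t' = 0 then t else p t') (if t' = 0 then z else z'))"

section \<open>Compactness for tuples and finiteness of the rank over X\<close>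

lemma df_inX:
  assumes "fst z = s" "(t, z) \<in> T" "\<And>t' z'. (t', z') \<in> TX \<Longrightarrow> t' \<noteq> 0 \<Longrightarrow> (p t', z') \<in> T"
  shows "df T (inX t z p)"
  unfolding inX_def[abs_def] by (rule df_subst[OF X(2)]) (use assms X(3) in auto)

lemma inX_iff:
  assumes "V t z \<in> carr U s" "\<And>t'. t' \<noteq> 0 \<Longrightarrow> V (p t') = VX t'"
  shows "inX t z p V \<longleftrightarrow> V t z \<in> X"
proof -
  have "inX t z p V \<longleftrightarrow> QX (VX(0 := \<lambda>_. V t z))"
    unfolding inX_def by (rule df_support[OF X(2)]) (use assms(2) in auto)
  then show ?thesis using assms(1) by (simp add: X(5))
qed

text \<open>The coordinates are fixed one after another. The projections of the chain to a
  coordinate again decrease and are non-empty, so finitely many of them intersect in the last one,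
  and countably many parameters suffice for all of them.\<close>

lemma chain_saturated:
  assumes "finite I" "\<And>r. df (T r) (Q r)"
    "\<And>r t z. (t, z) \<in> T r \<Longrightarrow> (t, z) \<notin> {t0} \<times> I \<Longrightarrow> V t z \<in> carr U (fst z)"
    "\<And>r u. u \<in> Vals I \<Longrightarrow> Q (Suc r) (V(t0 := override_on (V t0) u I)) \<Longrightarrow>
       Q r (V(t0 := override_on (V t0) u I))"
    "\<And>r :: nat. \<exists>u\<in>Vals I. Q r (V(t0 := override_on (V t0) u I))"
  shows "\<exists>u\<in>Vals I. \<forall>r. Q r (V(t0 := override_on (V t0) u I))"
  using assms
proof (induction I arbitrary: V rule: finite_induct)
  case empty
  then have "\<forall>r. Q r V" by simp
  then show ?case by (simp add: Vals_def)
next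
  case (insert z I)
  define Q1 where "Q1 r V = (\<exists>u\<in>Vals I. Q r (V(t0 := override_on (V t0) u I)))" for r V
  define Va where "Va a = V(t0 := (V t0)(z := a))" for a
  have df1: "df (T r - {t0} \<times> I) (Q1 r)" for r
    unfolding Q1_def[abs_def] by (rule df_ex_override[OF insert.hyps(1) insert.prems(1)])
  have ov: "(Va a)(t0 := override_on (Va a t0) u I) = V(t0 := override_on (V t0) (u(z := a)) (insert z I))"
    for a u
    using insert.hyps(2) by (auto simp: Va_def override_on_def fun_eq_iff)
  define E where "E r = {a\<in>carr U (fst z). Q1 r (Va a)}" for r
  have E_ne: "E r \<noteq> {}" for r
  proof -
    obtain u where u: "u \<in> Vals (insert z I)" "Q r (V(t0 := override_on (V t0) u (insert z I)))"
      using insert.prems(4)[of r] by (rule bexE)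
    have "u(z := u z) = u" by simp
    then have "Q1 r (Va (u z))"
      unfolding Q1_def ov using u by (intro bexI[of _ u]) (auto simp: Vals_def)
    then show ?thesis using u(1) by (auto simp: E_def Vals_def)
  qed
  have upd: "u(z := a) \<in> Vals (insert z I)" if "u \<in> Vals I" "a \<in> carr U (fst z)" for u a
    using that by (auto simp: Vals_def)
  have "E (Suc r) \<subseteq> E r" for r
  proof
    fix a assume "a \<in> E (Suc r)"
    then have a: "a \<in> carr U (fst z)" and "Q1 (Suc r) (Va a)" by (auto simp: E_def)
    then obtain u where "u \<in> Vals I" "Q (Suc r) (V(t0 := override_on (V t0) (u(z := a)) (insert z I)))"
      unfolding Q1_def ov by (elim bexE)
    then have "Q1 r (Va a)"
      unfolding Q1_def ov using insert.prems(3)[OF upd[OF _ a]] by (intro bexI[of _ u])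
    then show "a \<in> E r" using a by (simp add: E_def)
  qed
  then have E_anti: "E r' \<subseteq> E r" if "r \<le> r'" for r r'
    using lift_Suc_antimono_le[of E r r'] that by blast
  have "\<exists>T'. finite T' \<and> T' \<subseteq> T r - {t0} \<times> I \<and> df T' (Q1 r)" for r
    using df_finite_support[OF df1[of r]] by metis
  then obtain T' where T': "\<And>r. finite (T' r)" "\<And>r. T' r \<subseteq> T r - {t0} \<times> I" "\<And>r. df (T' r) (Q1 r)"
    by metis
  define B where "B = (\<Union>r. (\<lambda>(t, y). (fst y, V t y)) ` (T' r - {(t0, z)}))"
  have "countable B" unfolding B_def
    by (intro countable_UN countable_image) (simp_all add: T'(1) countable_finite)
  then have small: "small U B" using unc by (rule small_countable)
  have BU: "B \<subseteq> elements U"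
  proof
    fix b assume "b \<in> B"
    then obtain r t y where y: "(t, y) \<in> T' r" "(t, y) \<noteq> (t0, z)" "b = (fst y, V t y)"
      by (auto simp: B_def)
    then have "V t y \<in> carr U (fst y)" using T'(2)[of r] by (intro insert.prems(2)[of t y r]) auto
    then show "b \<in> elements U" by (simp add: y(3) elements_def)
  qed
  have dsetE': "dset B (fst z) (E r)" for r
    unfolding E_def Va_def by (rule dset_coord[OF T'(3)]) (auto simp: B_def intro: rev_image_eqI)
  have "fst z \<in> sorts L"
    using E_ne[of 0] is_struct by (auto simp: E_def is_struct_def)
  then have "\<exists>a\<in>carr U (fst z). \<forall>A\<in>range E. a \<in> A"
  proof (rule saturated_dset[OF sat BU small])
    show "dset B (fst z) A" if "A \<in> range E" for A using that dsetE' by auto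
    fix G assume "finite G" "G \<subseteq> range E"
    then obtain R where R: "finite R" "G = E ` R" using finite_subset_image by metis
    obtain a where "a \<in> E (Max (insert 0 R))" using E_ne by blast
    then have "a \<in> E r" if "r \<in> R" for r
      using E_anti[of r "Max (insert 0 R)"] that R(1) by auto
    moreover have "a \<in> carr U (fst z)" using \<open>a \<in> E _\<close> by (simp add: E_def)
    ultimately show "\<exists>a\<in>carr U (fst z). \<forall>A\<in>G. a \<in> A" using R(2) by auto
  qed
  then obtain a where a: "a \<in> carr U (fst z)" "\<And>r. Q1 r (Va a)"
    by (auto simp: E_def)
  have "\<exists>u\<in>Vals I. \<forall>r. Q r ((Va a)(t0 := override_on (Va a t0) u I))"
  proof (rule insert.IH)
    show "df (T r) (Q r)" for r by (rule insert.prems(1))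
    show "Va a t y \<in> carr U (fst y)" if "(t, y) \<in> T r" "(t, y) \<notin> {t0} \<times> I" for r t y
      using insert.prems(2)[OF that(1)] that(2) a(1) by (auto simp: Va_def)
    show "Q r ((Va a)(t0 := override_on (Va a t0) u I))"
      if "u \<in> Vals I" "Q (Suc r) ((Va a)(t0 := override_on (Va a t0) u I))" for r u
      using insert.prems(3)[OF upd[OF that(1) a(1)], of r] that(2) unfolding ov .
    show "\<exists>u\<in>Vals I. Q r ((Va a)(t0 := override_on (Va a t0) u I))" for r
      using a(2)[of r] unfolding Q1_def .
  qed
  then obtain u where "u \<in> Vals I" "\<forall>r. Q r (V(t0 := override_on (V t0) (u(z := a)) (insert z I)))"
    unfolding ov by (rule bexE)
  then show ?case using upd[OF _ a(1)] by (intro bexI[of _ "u(z := a)"])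
qed

definition Xvals :: "'s var set \<Rightarrow> ('s var \<Rightarrow> 'a) set" where
  "Xvals I = {u. \<forall>z\<in>I. u z \<in> X}"

lemma Xvals_Vals: "(\<And>z. z \<in> I \<Longrightarrow> fst z = s) \<Longrightarrow> Xvals I \<subseteq> Vals I"
  using X_carr by (auto simp: Xvals_def Vals_def)

text \<open>Copy \<open>3 * t + 3\<close> holds the parameters of \<open>X\<close>, and the copies \<open>3 * q + 4\<close> and
  \<open>3 * q + 5\<close> hold given branches and nodes.\<close>

definition place :: "(nat \<Rightarrow> 's var \<Rightarrow> 'a) \<Rightarrow> (nat \<Rightarrow> 's var \<Rightarrow> 'a) \<Rightarrow> nat \<Rightarrow> 's var \<Rightarrow> 'a" where
  "place ws us n = (if n mod 3 = 0 then VX (n div 3 - 1)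
     else if n mod 3 = 1 then ws (n div 3 - 1) else us (n div 3 - 1))"

lemma place_simps: "place ws us (3 * t + 3) = VX t" "place ws us (3 * q + 4) = ws q"
  "place ws us (3 * q + 5) = us q"
proof -
  have "(3 * t + 3) mod 3 = 0" "(3 * t + 3) div 3 = t + 1" "(3 * q + 4) mod 3 = 1"
    "(3 * q + 4) div 3 = q + 1" "(3 * q + 5) mod 3 = 2" "(3 * q + 5) div 3 = q + 1"
    by presburger+
  then show "place ws us (3 * t + 3) = VX t" "place ws us (3 * q + 4) = ws q"
    "place ws us (3 * q + 5) = us q" by (simp_all add: place_def)
qed

definition params :: "(nat \<times> 's var) set" where
  "params = (\<lambda>(t, z). (3 * t + 3, z)) ` {i\<in>TX. fst i \<noteq> 0}"

lemma params_iff: "(n, z) \<in> params \<longleftrightarrow> (\<exists>t. n = 3 * t + 3 \<and> t \<noteq> 0 \<and> (t, z) \<in> TX)"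
  by (cases z) (auto simp: params_def image_iff)

lemma finite_params: "finite params"
  using X(1) by (simp add: params_def)

lemma place_params: "(n, z) \<in> params \<Longrightarrow> (fst z, place ws us n z) \<in> F"
  using X(4)[of _ z] by (auto simp: params_iff place_simps)

lemma F_carr: "(\<sigma>, a) \<in> F \<Longrightarrow> a \<in> carr U \<sigma>"
  using F by (auto simp: elements_def)

lemma df_inX_params:
  "fst z = s \<Longrightarrow> (t, z) \<in> T \<Longrightarrow> params \<subseteq> T \<Longrightarrow> df T (inX t z (\<lambda>t. 3 * t + 3))"
  by (rule df_inX) (auto simp: params_iff subset_iff)

text \<open>Infinite rank would give, by \<open>tall_order\<close>, an order between tuples of
  \<open>X\<close> and arbitrary tuples for the relation or its negation, against
  \<open>no_order\<close>. There a single root must serve all heights: a tree of height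
  \<open>Suc r\<close> has a root that serves height \<open>r\<close>, and these conditions on the
  root form a decreasing definable chain.\<close>

lemma no_tall:
  assumes \<phi>: "wf_fm L \<phi>" and I: "I \<subseteq> fv \<phi>" "\<And>z. z \<in> I \<Longrightarrow> fst z = s"
  shows "\<not> tall (\<lambda>u w. sat U (override_on w u I) \<phi>) (Xvals I) (Vals (fv \<phi> - I))"
proof
  define R where "R = (\<lambda>u w. sat U (override_on w u I) \<phi>)"
  let ?W = "fv \<phi> - I"
  let ?p = "\<lambda>t :: nat. 3 * t + 3"
  have XV: "Xvals I \<subseteq> Vals I" using Xvals_Vals[of I] I(2) by simp
  have finI: "finite I" using I(1) finite_fv finite_subset by blast
  assume "tall (\<lambda>u w. sat U (override_on w u I) \<phi>) (Xvals I) (Vals ?W)"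
  then have tall: "tall R (Xvals I) (Vals ?W)" by (simp add: R_def)
  have step: "\<exists>u\<in>{u\<in>Xvals I. \<forall>(w, e)\<in>set ws. R u w = e}.
      tall R {u\<in>Xvals I. \<forall>(w, e)\<in>set ws. R u w = e} {w\<in>Vals ?W. \<forall>(u, e)\<in>set ((u, True) # us). R u w = e} \<and>
      tall R {u\<in>Xvals I. \<forall>(w, e)\<in>set ws. R u w = e} {w\<in>Vals ?W. \<forall>(u, e)\<in>set ((u, False) # us). R u w = e}"
    if ws: "fst ` set ws \<subseteq> Vals ?W" and us: "fst ` set us \<subseteq> Xvals I"
      and tl: "tall R {u\<in>Xvals I. \<forall>(w, e)\<in>set ws. R u w = e} {w\<in>Vals ?W. \<forall>(u, e)\<in>set us. R u w = e}"
    for ws us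
  proof -
    define Dr where "Dr = {u\<in>Xvals I. \<forall>(w, e)\<in>set ws. R u w = e}"
    define Sr where "Sr = {w\<in>Vals ?W. \<forall>(u, e)\<in>set us. R u w = e}"
    define V0 where "V0 = place (\<lambda>q. fst (ws ! q)) (\<lambda>q. fst (us ! q))"
    define QD where "QD V \<longleftrightarrow> (\<forall>z\<in>I. inX 2 z ?p V) \<and>
      (\<forall>q\<in>{..<length ws}. sat U (\<lambda>z. V (if z \<in> I then 2 else 3 * q + 4) z) \<phi> = snd (ws ! q))" for V
    define QS where "QS V \<longleftrightarrow>
      (\<forall>q\<in>{..<length us}. sat U (\<lambda>z. V (if z \<in> I then 3 * q + 5 else 1) z) \<phi> = snd (us ! q))" for V
    define QR where "QR V \<longleftrightarrow> sat U (\<lambda>z. V (if z \<in> I then 0 else 1) z) \<phi>" for V :: "nat \<Rightarrow> 's var \<Rightarrow> 'a"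
    define TD where "TD = {2} \<times> I \<union> params \<union> (\<lambda>(q, z). (3 * q + 4, z)) ` ({..<length ws} \<times> ?W)"
    define TS where "TS = {1} \<times> ?W \<union> {0} \<times> I \<union> (\<lambda>(q, z). (3 * q + 5, z)) ` ({..<length us} \<times> I)"
    have fin: "finite TD" "finite TS"
      using finI finite_params finite_fv[of \<phi>] by (auto simp: TD_def TS_def)
    have dfD: "df TD QD"
      unfolding QD_def[abs_def]
    proof (intro df_conj df_Ball df_const_iff df_atom[OF \<phi>])
      show "df TD (inX 2 z ?p)" if "z \<in> I" for z
        using that I(2) by (intro df_inX_params) (auto simp: TD_def)
      show "(if z \<in> I then 2 else 3 * q + 4, z) \<in> TD" if "q \<in> {..<length ws}" "z \<in> fv \<phi>" for q z
        using that by (auto simp: TD_def)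
    qed (auto simp: finI)
    have dfR: "df TS QR"
      unfolding QR_def[abs_def] by (rule df_atom[OF \<phi>]) (auto simp: TS_def)
    have dfS: "df TS QS"
      unfolding QS_def[abs_def]
    proof (intro df_Ball df_const_iff df_atom[OF \<phi>])
      show "(if z \<in> I then 3 * q + 5 else 1, z) \<in> TS" if "q \<in> {..<length us}" "z \<in> fv \<phi>" for q z
        using that by (auto simp: TS_def)
    qed auto
    let ?tree = "\<lambda>r Q V. tree R {u\<in>Vals I. QD (V(2 := u))} r {w\<in>Vals ?W. Q (V(1 := w))}"
    define TT where "TT = ((TS \<union> TD) - {1, 2} \<times> UNIV) \<union> {0} \<times> I"
    have dft: "df TT (?tree r Q)" if "df TS Q" for r Q
    proof -
      have "df ((TS \<union> TD) - {1, 2} \<times> UNIV) (?tree r Q)"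
        unfolding R_def
        by (rule df_tree[OF \<phi> I(1) fin(1) dfD _ _ fin(2) that]) (auto simp: TD_def TS_def params_iff)
      then show ?thesis by (rule df_mono) (auto simp: TT_def)
    qed
    have dfD2: "df TT (\<lambda>V. QD (V(2 := V 0)))"
    proof -
      have "df TT (\<lambda>V. QD (\<lambda>t z. V (if t = 2 then 0 else t) z))"
        by (rule df_subst[OF dfD]) (auto simp: TT_def TD_def params_iff)
      moreover have "(\<lambda>t z. V (if t = 2 then 0 else t) z) = V(2 := V 0)" for V :: "nat \<Rightarrow> 's var \<Rightarrow> 'a"
        by auto
      ultimately show ?thesis by (simp only:)
    qed
    \<comment> \<open>The candidate root sits in copy 0, whereas \<open>QD\<close> is about copy 2;
      hence the update by \<open>V 0\<close>.\<close>
    define Q where "Q r V \<longleftrightarrow> QD (V(2 := V 0)) \<and> ?tree r (\<lambda>V. QS V \<and> QR V) V \<and>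
      ?tree r (\<lambda>V. QS V \<and> \<not> QR V) V" for r V
    have dfQ: "df TT (Q r)" for r
      unfolding Q_def[abs_def] by (intro df_conj dfD2 dft dfS df_not dfR)
    have DrI: "QD ((V0(0 := u'))(2 := u)) \<longleftrightarrow> u \<in> Dr" if "u \<in> Vals I" for u u'
    proof -
      have "inX 2 z ?p ((V0(0 := u'))(2 := u)) \<longleftrightarrow> u z \<in> X" if "z \<in> I" for z
        using inX_iff[of "(V0(0 := u'))(2 := u)" 2 z ?p] \<open>u \<in> Vals I\<close> that I(2)
        by (auto simp: Vals_def V0_def place_simps)
      moreover have "(\<lambda>z. ((V0(0 := u'))(2 := u)) (if z \<in> I then 2 else 3 * q + 4) z) =
          override_on (fst (ws ! q)) u I" for q
        by (auto simp: override_on_def V0_def place_simps)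
      ultimately show ?thesis
        unfolding QD_def Dr_def R_def by (auto simp: Xvals_def all_set_conv_all_nth split_beta)
    qed
    have Dr: "{u\<in>Vals I. QD ((V0(0 := u'))(2 := u))} = Dr" for u'
      using DrI[of _ u'] XV by (auto simp: Dr_def)
    have SrI: "QS ((V0(0 := u'))(1 := w)) \<longleftrightarrow> (\<forall>(u, e)\<in>set us. R u w = e)" for u' w
    proof -
      have "(\<lambda>z. ((V0(0 := u'))(1 := w)) (if z \<in> I then 3 * q + 5 else 1) z) =
          override_on w (fst (us ! q)) I" for q
        by (auto simp: override_on_def V0_def place_simps)
      then show ?thesis
        unfolding QS_def R_def by (auto simp: all_set_conv_all_nth split_beta)
    qed
    have RI: "QR ((V0(0 := u'))(1 := w)) \<longleftrightarrow> R u' w" for u' w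
    proof -
      have "(\<lambda>z. ((V0(0 := u'))(1 := w)) (if z \<in> I then 0 else 1) z) = override_on w u' I"
        by (auto simp: override_on_def)
      then show ?thesis by (simp add: QR_def R_def)
    qed
    have QI: "Q r (V0(0 := u)) \<longleftrightarrow> u \<in> Dr \<and> tree R Dr r {w\<in>Sr. R u w} \<and> tree R Dr r {w\<in>Sr. \<not> R u w}"
      if "u \<in> Vals I" for r u
    proof -
      have "{w\<in>Vals ?W. QS ((V0(0 := u))(1 := w)) \<and> QR ((V0(0 := u))(1 := w))} = {w\<in>Sr. R u w}"
        "{w\<in>Vals ?W. QS ((V0(0 := u))(1 := w)) \<and> \<not> QR ((V0(0 := u))(1 := w))} = {w\<in>Sr. \<not> R u w}"
        unfolding SrI RI Sr_def by auto
      then show ?thesis unfolding Q_def Dr using DrI[OF that, of u] by simp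
    qed
    let ?u = "\<lambda>u. override_on (V0 0) u I"
    have ou: "?u u \<in> Vals I" if "u \<in> Vals I" for u using that by (auto simp: Vals_def)
    have "\<exists>u\<in>Vals I. \<forall>r. Q r (V0(0 := ?u u))"
    proof (rule chain_saturated[OF finI dfQ])
      show "V0 t z \<in> carr U (fst z)" if tz: "(t, z) \<in> TT" "(t, z) \<notin> {0} \<times> I" for t z
      proof -
        consider "(t, z) \<in> params" | q where "t = 3 * q + 4" "q < length ws" "z \<in> ?W"
          | q where "t = 3 * q + 5" "q < length us" "z \<in> I"
          using tz by (auto simp: TT_def TS_def TD_def)
        then show ?thesis
        proof cases
          case 1
          then show ?thesis using place_params F_carr unfolding V0_def by blast
        next
          case 2
          then have "fst (ws ! q) \<in> Vals ?W" using ws by auto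
          then show ?thesis using 2 by (simp add: V0_def place_simps Vals_def)
        next
          case 3
          then have "fst (us ! q) \<in> Vals I" using subsetD[OF us imageI[OF nth_mem[of q us]]] XV by auto
          then show ?thesis using 3 by (simp add: V0_def place_simps Vals_def)
        qed
      qed
      show "Q r (V0(0 := ?u u))" if "u \<in> Vals I" "Q (Suc r) (V0(0 := ?u u))" for r u
        using that(2) tree_SucD unfolding QI[OF ou[OF that(1)]] by blast
      show "\<exists>u\<in>Vals I. Q r (V0(0 := ?u u))" for r
      proof -
        have "tree R Dr (Suc r) Sr" using tl unfolding tall_def Dr_def Sr_def by (rule spec)
        then obtain u where u: "u \<in> Dr" "tree R Dr r {w\<in>Sr. R u w}" "tree R Dr r {w\<in>Sr. \<not> R u w}"
          by auto
        then have uV: "u \<in> Vals I" using XV by (auto simp: Dr_def)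
        have R: "R (?u u) w = R u w" for w
        proof -
          have "override_on w (?u u) I = override_on w u I" by (auto simp: override_on_def)
          then show ?thesis by (simp add: R_def)
        qed
        then have "?u u \<in> Dr" using u(1) by (simp add: Dr_def Xvals_def)
        then have "Q r (V0(0 := ?u u))" using u R QI[OF ou[OF uV]] by simp
        then show ?thesis using uV by blast
      qed
    qed
    then obtain u where u: "u \<in> Vals I" "\<And>r. Q r (V0(0 := ?u u))" by blast
    have "{w\<in>Vals ?W. \<forall>(u, e)\<in>set ((?u u, True) # us). R u w = e} = {w\<in>Sr. R (?u u) w}"
      "{w\<in>Vals ?W. \<forall>(u, e)\<in>set ((?u u, False) # us). R u w = e} = {w\<in>Sr. \<not> R (?u u) w}"
      by (auto simp: Sr_def)
    moreover have "?u u \<in> Dr" "tall R Dr {w\<in>Sr. R (?u u) w}" "tall R Dr {w\<in>Sr. \<not> R (?u u) w}"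
      using u(2) unfolding QI[OF ou[OF u(1)]] tall_def by auto
    ultimately show ?thesis unfolding Dr_def[symmetric] by (intro bexI[of _ "?u u"]) auto
  qed
  obtain u :: "nat \<Rightarrow> 's var \<Rightarrow> 'a" and w where uw: "\<And>i. u i \<in> Xvals I" "\<And>i. w i \<in> Vals ?W"
    "(\<forall>i j. R (u i) (w j) \<longleftrightarrow> i < j) \<or> (\<forall>i j. \<not> R (u i) (w j) \<longleftrightarrow> i < j)"
    by (rule tall_order[OF step tall]) auto
  from uw(3) show False
  proof
    assume "\<forall>i j. R (u i) (w j) \<longleftrightarrow> i < j"
    then show False
      using no_order[OF \<phi> I, of u w] uw(1,2) by (auto simp: R_def Xvals_def)
  next
    assume "\<forall>i j. \<not> R (u i) (w j) \<longleftrightarrow> i < j"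
    then show False
      using no_order[of "Neg \<phi>" I u w] \<phi> I uw(1,2) by (auto simp: R_def Xvals_def)
  qed
qed

text \<open>Definability of local types by rank. Among the sets of tuples that agree with
  \<open>m\<close> on finitely many tuples of \<open>X\<close>, take one of least rank
  \<open>r\<close>. For \<open>u\<close> in \<open>X\<close> the part on the side of
  \<open>m\<close> still has rank at least \<open>r\<close>, and the two parts cannot both have it.
  So \<open>R u m\<close> amounts to the definable statement that the positive part has rank at
  least \<open>r\<close>.\<close>

lemma definable_trace:
  fixes \<phi> I
  defines "R \<equiv> \<lambda>u w. sat U (override_on w u I) \<phi>"
  assumes \<phi>: "wf_fm L \<phi>" and I: "I \<subseteq> fv \<phi>" "\<And>z. z \<in> I \<Longrightarrow> fst z = s"
    and m: "m \<in> Vals (fv \<phi> - I)"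
  obtains T Q V where "finite T" "df T Q" "\<forall>z. (0, z) \<in> T \<longrightarrow> z \<in> I"
    "\<forall>z. (1, z) \<in> T \<longrightarrow> fst z = s \<and> V 1 z \<in> X"
    "\<forall>t z. (t, z) \<in> T \<longrightarrow> t \<noteq> 0 \<longrightarrow> t \<noteq> 1 \<longrightarrow> (fst z, V t z) \<in> F"
    "\<forall>u\<in>Xvals I. R u m \<longleftrightarrow> Q (V(0 := u))"
proof -
  let ?W = "fv \<phi> - I"
  let ?p = "\<lambda>t :: nat. 3 * t + 3"
  have XV: "Xvals I \<subseteq> Vals I" using Xvals_Vals[of I] I(2) by simp
  have finI: "finite I" using I(1) finite_fv finite_subset by blast
  define C where "C us = {w\<in>Vals ?W. \<forall>u\<in>set us. R u w \<longleftrightarrow> R u m}" for us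
  have "\<not> tall R (Xvals I) (Vals ?W)" unfolding R_def by (rule no_tall[OF \<phi> I])
  then obtain r0 where r0: "\<not> tree R (Xvals I) r0 (Vals ?W)" by (auto simp: tall_def)
  have C0: "C [] = Vals ?W" by (simp add: C_def)
  have mC: "m \<in> C us" for us using m by (simp add: C_def)
  \<comment> \<open>A tree of height 0 needs just one branch, and \<open>m\<close> is one; so the
    missing height is positive.\<close>
  obtain r1 where "r0 = Suc r1" using r0 m by (cases r0) auto
  then have ex: "\<exists>us. set us \<subseteq> Xvals I \<and> \<not> tree R (Xvals I) (Suc r1) (C us)"
    using r0 C0 by (intro exI[of _ "[]"]) simp
  define r where "r = (LEAST r. \<exists>us. set us \<subseteq> Xvals I \<and> \<not> tree R (Xvals I) (Suc r) (C us))"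
  have "\<exists>us. set us \<subseteq> Xvals I \<and> \<not> tree R (Xvals I) (Suc r) (C us)"
    unfolding r_def by (rule LeastI[where P = "\<lambda>r. \<exists>us. set us \<subseteq> Xvals I \<and> \<not> tree R (Xvals I) (Suc r) (C us)", OF ex])
  then obtain us where us: "set us \<subseteq> Xvals I" "\<not> tree R (Xvals I) (Suc r) (C us)" by blast
  have low: "tree R (Xvals I) r (C us')" if "set us' \<subseteq> Xvals I" for us'
  proof (cases r)
    case 0
    then show ?thesis using mC by auto
  next
    case (Suc r')
    then have "r' < r" by simp
    from not_less_Least[OF this[unfolded r_def]] that show ?thesis unfolding Suc by blast
  qed
  have key: "R u m \<longleftrightarrow> tree R (Xvals I) r {w\<in>C us. R u w}" if u: "u \<in> Xvals I" for u
  proof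
    assume "R u m"
    then have "C (u # us) = {w\<in>C us. R u w}" by (auto simp: C_def)
    then show "tree R (Xvals I) r {w\<in>C us. R u w}" using low[of "u # us"] u us(1) by simp
  next
    assume t: "tree R (Xvals I) r {w\<in>C us. R u w}"
    show "R u m"
    proof (rule ccontr)
      assume "\<not> R u m"
      then have "C (u # us) = {w\<in>C us. \<not> R u w}" by (auto simp: C_def)
      then have "tree R (Xvals I) r {w\<in>C us. \<not> R u w}" using low[of "u # us"] u us(1) by simp
      with t us(2) u show False by auto
    qed
  qed
  define V0 where "V0 = place (\<lambda>_. undefined) (\<lambda>q. us ! q)"
  define QD where "QD V \<longleftrightarrow> (\<forall>z\<in>I. inX 2 z ?p V)" for V
  define QS where "QS V \<longleftrightarrow>
    (\<forall>q\<in>{..<length us}. sat U (\<lambda>z. V (if z \<in> I then 3 * q + 5 else 1) z) \<phi> = R (us ! q) m) \<and>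
    sat U (\<lambda>z. V (if z \<in> I then 0 else 1) z) \<phi>" for V
  define TD where "TD = {2} \<times> I \<union> params"
  define TS where "TS = {1} \<times> ?W \<union> {0} \<times> I \<union> (\<lambda>(q, z). (3 * q + 5, z)) ` ({..<length us} \<times> I)"
  have fin: "finite TD" "finite TS"
    using finI finite_params finite_fv[of \<phi>] by (auto simp: TD_def TS_def)
  have dfD: "df TD QD"
    unfolding QD_def[abs_def]
    by (intro df_Ball df_inX_params finI) (auto simp: TD_def I(2))
  have dfS: "df TS QS"
    unfolding QS_def[abs_def]
  proof (intro df_conj df_Ball df_const_iff df_atom[OF \<phi>])
    show "(if z \<in> I then 3 * q + 5 else 1, z) \<in> TS" if "q \<in> {..<length us}" "z \<in> fv \<phi>" for q z
      using that by (auto simp: TS_def)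
  qed (auto simp: TS_def)
  define TT where "TT = (TS \<union> TD) - {1, 2} \<times> UNIV"
  define Q where "Q V \<longleftrightarrow> tree R {u\<in>Vals I. QD (V(2 := u))} r {w\<in>Vals ?W. QS (V(1 := w))}" for V
  have dfQ: "df TT Q"
    unfolding TT_def Q_def[abs_def] R_def
    by (rule df_tree[OF \<phi> I(1) fin(1) dfD _ _ fin(2) dfS]) (auto simp: TD_def TS_def params_iff)
  have Q: "Q (V0(0 := u)) \<longleftrightarrow> R u m" if u: "u \<in> Xvals I" for u
  proof -
    have "QD ((V0(0 := u))(2 := u')) \<longleftrightarrow> u' \<in> Xvals I" if "u' \<in> Vals I" for u'
    proof -
      have "inX 2 z ?p ((V0(0 := u))(2 := u')) \<longleftrightarrow> u' z \<in> X" if "z \<in> I" for z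
        using inX_iff[of "(V0(0 := u))(2 := u')" 2 z ?p] \<open>u' \<in> Vals I\<close> that I(2)
        by (auto simp: Vals_def V0_def place_simps)
      then show ?thesis by (simp add: QD_def Xvals_def)
    qed
    then have D: "{u'\<in>Vals I. QD ((V0(0 := u))(2 := u'))} = Xvals I" using XV by auto
    have "(\<lambda>z. ((V0(0 := u))(1 := w)) (if z \<in> I then 3 * q + 5 else 1) z) = override_on w (us ! q) I" for q w
      by (auto simp: override_on_def V0_def place_simps)
    moreover have "(\<lambda>z. ((V0(0 := u))(1 := w)) (if z \<in> I then 0 else 1) z) = override_on w u I" for w
      by (auto simp: override_on_def)
    ultimately have "QS ((V0(0 := u))(1 := w)) \<longleftrightarrow> (\<forall>q<length us. R (us ! q) w = R (us ! q) m) \<and> R u w" for w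
      by (auto simp: QS_def R_def)
    then have "{w\<in>Vals ?W. QS ((V0(0 := u))(1 := w))} = {w\<in>C us. R u w}"
      by (auto simp: C_def all_set_conv_all_nth)
    then show ?thesis unfolding Q_def D key[OF u] by simp
  qed
  \<comment> \<open>The parameters from \<open>X\<close>, held in copies congruent to 2 modulo 3,
    are gathered in copy 1, the old copy number being coded into the variable by \<open>enc\<close>.
    In this form \<open>meets_union\<close> can treat them as one tuple.\<close>
  define g where "g t = (if t mod 3 = 2 then 1 else t)" for t :: nat
  define h where "h t z = (if t mod 3 = 2 then enc (t, z) else z)" for t :: nat and z :: "'s var"
  define T' where "T' = (\<lambda>(t, z). (g t, h t z)) ` TT"
  define V' where "V' = (\<lambda>t. if t = 1 then untag V0 else V0 t)"
  have mods: "(3 * q + 5) mod 3 = 2" "(3 * q + 3) mod 3 = 0" for q :: nat by presburger+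
  have TT: "(t = 0 \<and> z \<in> I) \<or> (t, z) \<in> params \<or> (\<exists>q<length us. t = 3 * q + 5 \<and> z \<in> I)"
    if "(t, z) \<in> TT" for t z
    using that by (auto simp: TT_def TS_def TD_def)
  have T': "(t' = 0 \<and> z' \<in> I) \<or> (t' = 1 \<and> (\<exists>q<length us. \<exists>z\<in>I. z' = enc (3 * q + 5, z))) \<or>
      (t' \<noteq> 0 \<and> t' \<noteq> 1 \<and> (t', z') \<in> params)" if tz': "(t', z') \<in> T'" for t' z'
  proof -
    obtain i where i: "i \<in> TT" "(t', z') = (case i of (t, z) \<Rightarrow> (g t, h t z))"
      using tz' unfolding T'_def by (elim imageE)
    obtain t z where "i = (t, z)" by (rule prod.exhaust)
    with i have tz: "(t, z) \<in> TT" "t' = g t" "z' = h t z" by simp_all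
    from TT[OF tz(1)] show ?thesis
      using tz(2,3) by (auto simp: g_def h_def mods params_iff)
  qed
  show ?thesis
  proof (rule that)
    show "finite T'" using fin by (simp add: T'_def TT_def)
    show "df T' (\<lambda>V. Q (\<lambda>t z. V (g t) (h t z)))"
      by (rule df_subst[OF dfQ]) (auto simp: T'_def h_def fst_enc intro: rev_image_eqI)
    show "\<forall>z. (0, z) \<in> T' \<longrightarrow> z \<in> I"
    proof (intro allI impI)
      fix z assume "(0, z) \<in> T'"
      from T'[OF this] show "z \<in> I" by simp
    qed
    show "\<forall>z. (1, z) \<in> T' \<longrightarrow> fst z = s \<and> V' 1 z \<in> X"
    proof (intro allI impI)
      fix z' assume "(1, z') \<in> T'"
      from T'[OF this] obtain q z where "q < length us" "z \<in> I" "z' = enc (3 * q + 5, z)" by auto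
      moreover from this have "us ! q \<in> Xvals I" using us(1) by auto
      ultimately show "fst z' = s \<and> V' 1 z' \<in> X"
        using I(2) by (simp add: V'_def V0_def place_simps fst_enc Xvals_def)
    qed
    show "\<forall>t z. (t, z) \<in> T' \<longrightarrow> t \<noteq> 0 \<longrightarrow> t \<noteq> 1 \<longrightarrow> (fst z, V' t z) \<in> F"
    proof (intro allI impI)
      fix t z assume "(t, z) \<in> T'" "t \<noteq> 0" "t \<noteq> 1"
      then have "(t, z) \<in> params" using T'[of t z] by simp
      then show "(fst z, V' t z) \<in> F" using place_params \<open>t \<noteq> 1\<close> by (simp add: V'_def V0_def)
    qed
    show "\<forall>u\<in>Xvals I. R u m \<longleftrightarrow> Q (\<lambda>t z. (V'(0 := u)) (g t) (h t z))"
    proof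
      fix u assume "u \<in> Xvals I"
      have "Q (\<lambda>t z. (V'(0 := u)) (g t) (h t z)) \<longleftrightarrow> Q (V0(0 := u))"
      proof (rule df_support[OF dfQ])
        fix t z assume "(t, z) \<in> TT"
        from TT[OF this] show "(V'(0 := u)) (g t) (h t z) = (V0(0 := u)) t z"
          by (auto simp: g_def h_def V'_def mods params_iff)
      qed
      then show "R u m \<longleftrightarrow> Q (\<lambda>t z. (V'(0 := u)) (g t) (h t z))" using Q[OF \<open>u \<in> Xvals I\<close>] by simp
    qed
  qed
qed

section \<open>Parameter sets that meet a subset of X\<close>

definition meets :: "('s \<times> 'a) set \<Rightarrow> 'a set \<Rightarrow> bool" where
  "meets B N \<longleftrightarrow> (\<forall>A. dset B s A \<longrightarrow> A \<inter> X \<noteq> {} \<longrightarrow> A \<inter> N \<noteq> {})"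

text \<open>The tuple is found coordinate by coordinate: an entry already chosen in \<open>N\<close>
  belongs to \<open>B\<close> and is a parameter for the next one. The condition must force all
  entries into \<open>X\<close>, since only there does \<open>B\<close> give control.\<close>

lemma meets_tuple:
  assumes "finite E" and m: "meets B N" "\<And>a. a \<in> N \<Longrightarrow> (s, a) \<in> B" and Q: "df T Q"
    and "\<And>z. z \<in> E \<Longrightarrow> fst z = s"
    "\<And>t z. (t, z) \<in> T \<Longrightarrow> (t, z) \<notin> {t0} \<times> E \<Longrightarrow> (fst z, V t z) \<in> B"
    "\<And>u. u \<in> Vals E \<Longrightarrow> Q (V(t0 := override_on (V t0) u E)) \<Longrightarrow> \<forall>z\<in>E. u z \<in> X"
    "\<exists>u\<in>Vals E. Q (V(t0 := override_on (V t0) u E))"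
  shows "\<exists>u. (\<forall>z\<in>E. u z \<in> N) \<and> Q (V(t0 := override_on (V t0) u E))"
  using assms(1,5-)
proof (induction E arbitrary: V rule: finite_induct)
  case empty
  then show ?case by simp
next
  case (insert z E)
  define Q1 where "Q1 V = (\<exists>u\<in>Vals E. Q (V(t0 := override_on (V t0) u E)))" for V
  define Va where "Va a = V(t0 := (V t0)(z := a))" for a
  have z: "fst z = s" by (rule insert.prems(1)) simp
  have df1: "df (T - {t0} \<times> E) Q1"
    unfolding Q1_def[abs_def] by (rule df_ex_override[OF insert.hyps(1) Q])
  have ov: "(Va a)(t0 := override_on (Va a t0) u E) = V(t0 := override_on (V t0) (u(z := a)) (insert z E))"
    for a u
    using insert.hyps(2) by (auto simp: Va_def override_on_def fun_eq_iff)
  have upd: "u(z := a) \<in> Vals (insert z E)" if "u \<in> Vals E" "a \<in> carr U s" for u a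
    using that z by (auto simp: Vals_def)
  define A where "A = {a\<in>carr U s. Q1 (Va a)}"
  have "dset B (fst z) {a\<in>carr U (fst z). Q1 (V(t0 := (V t0)(z := a)))}"
    by (rule dset_coord[OF df1]) (use insert.prems(2) in auto)
  then have "dset B s A" by (simp add: A_def Va_def z)
  moreover have "A \<inter> X \<noteq> {}"
  proof -
    obtain u where u: "u \<in> Vals (insert z E)" "Q (V(t0 := override_on (V t0) u (insert z E)))"
      using insert.prems(4) by (rule bexE)
    have uE: "u \<in> Vals E" using u(1) by (simp add: Vals_def)
    have Qu: "Q ((Va (u z))(t0 := override_on (Va (u z) t0) u E))" unfolding ov using u(2) by simp
    have "Q1 (Va (u z))"
      unfolding Q1_def by (rule bexI[where x = u]) (rule Qu, rule uE)
    moreover have "u z \<in> carr U s" using u(1) z by (auto simp: Vals_def)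
    moreover have "u z \<in> X" using insert.prems(3)[OF u] by simp
    ultimately show ?thesis by (auto simp: A_def)
  qed
  ultimately obtain a where a: "a \<in> A" "a \<in> N" using m(1) unfolding meets_def by blast
  then have aU: "a \<in> carr U s" by (simp add: A_def)
  have "\<exists>u. (\<forall>z\<in>E. u z \<in> N) \<and> Q ((Va a)(t0 := override_on (Va a t0) u E))"
  proof (rule insert.IH)
    show "fst y = s" if "y \<in> E" for y using that insert.prems(1) by simp
    show "(fst y, Va a t y) \<in> B" if "(t, y) \<in> T" "(t, y) \<notin> {t0} \<times> E" for t y
      using that insert.prems(2)[OF that(1)] m(2)[OF a(2)] z by (auto simp: Va_def)
    show "\<forall>z\<in>E. u z \<in> X" if h: "u \<in> Vals E" "Q ((Va a)(t0 := override_on (Va a t0) u E))" for u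
    proof
      fix y assume y: "y \<in> E"
      have "\<forall>x\<in>insert z E. (u(z := a)) x \<in> X"
        by (rule insert.prems(3)[OF upd[OF h(1) aU]]) (rule h(2)[unfolded ov])
      then have "(u(z := a)) y \<in> X" using y by (rule bspec[OF _ insertI2])
      moreover have "y \<noteq> z" using y insert.hyps(2) by auto
      ultimately show "u y \<in> X" by simp
    qed
    show "\<exists>u\<in>Vals E. Q ((Va a)(t0 := override_on (Va a t0) u E))"
      using a(1) by (simp add: A_def Q1_def)
  qed
  then obtain u where "\<forall>z\<in>E. u z \<in> N" "Q (V(t0 := override_on (V t0) (u(z := a)) (insert z E)))"
    unfolding ov by (elim exE conjE)
  then show ?case
  proof (intro exI[of _ "u(z := a)"] conjI)
    assume "\<forall>z\<in>E. u z \<in> N"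
    then show "\<forall>y\<in>insert z E. (u(z := a)) y \<in> N" using a(2) by simp
  qed
qed

text \<open>The parameters in \<open>B1\<close> matter only through a trace on \<open>X\<close>, and
  this trace is definable over \<open>F\<close> and \<open>X\<close>. That a tuple \<open>e\<close>
  of \<open>X\<close> yields such a definition is a condition over \<open>B1\<close>, so
  \<open>e\<close> can be found in \<open>N1\<close>. On \<open>X\<close> the given set then agrees
  with one definable over \<open>F\<close> and \<open>N2\<close>, which intersects \<open>N2\<close>
  by hypothesis.\<close>

lemma meets_union:
  assumes m1: "meets B1 N1" and B1: "F \<subseteq> B1" "{s} \<times> N1 \<subseteq> B1" "B1 \<subseteq> elements U"
    and m2: "meets (F \<union> {s} \<times> N2) N2" and N: "N1 \<subseteq> N2" "N2 \<subseteq> X"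
  shows "meets (B1 \<union> {s} \<times> N2) N2"
  unfolding meets_def
proof (intro allI impI)
  fix A assume A: "dset (B1 \<union> {s} \<times> N2) s A" and "A \<inter> X \<noteq> {}"
  then obtain a where a: "a \<in> A" "a \<in> X" by blast
  obtain T Q V where T: "finite T" "df T Q" "\<forall>z. (0, z) \<in> T \<longrightarrow> fst z = s"
    "\<forall>t z. (t, z) \<in> T \<longrightarrow> t \<noteq> 0 \<longrightarrow> (fst z, V t z) \<in> B1 \<union> {s} \<times> N2"
    "A = {a\<in>carr U s. Q (V(0 := \<lambda>_. a))}"
    by (rule dsetE[OF A])
  obtain \<phi> where \<phi>: "wf_fm L \<phi>" "fv \<phi> \<subseteq> enc ` T" "Q = (\<lambda>V. sat U (untag V) \<phi>)"
    using T(2) by (rule dfE)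
  have dec: "(fst (dec x), snd (dec x)) \<in> T" "fst (snd (dec x)) = fst x" if "x \<in> fv \<phi>" for x
    using \<phi>(2) that by (auto simp: fst_enc)
  have tag0: "fst x = s" if "x \<in> fv \<phi>" "fst (dec x) = 0" for x
    using dec[OF that(1)] that(2) T(3) by simp
  have tag: "(fst x, untag V x) \<in> B1 \<union> {s} \<times> N2" if "x \<in> fv \<phi>" "fst (dec x) \<noteq> 0" for x
    using dec[OF that(1)] that(2) T(4)[rule_format, of "fst (dec x)" "snd (dec x)"]
    by (simp add: untag_def)
  \<comment> \<open>The variables that take values in \<open>X\<close>: the element itself and the
    parameters outside \<open>B1\<close>, which come from \<open>N2\<close>. The remaining ones form
    the tuple whose trace has to be defined.\<close>
  define I where "I = {x\<in>fv \<phi>. fst (dec x) = 0 \<or> (fst x, untag V x) \<notin> B1}"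
  let ?W = "fv \<phi> - I"
  have I: "I \<subseteq> fv \<phi>" by (auto simp: I_def)
  have finI: "finite I" using I finite_fv finite_subset by blast
  have Is: "fst x = s" if "x \<in> I" for x
    using that tag0[of x] tag[of x] by (auto simp: I_def)
  have IN: "untag V x \<in> N2" if "x \<in> I" "fst (dec x) \<noteq> 0" for x
    using that tag[of x] by (auto simp: I_def)
  have WB: "(fst x, untag V x) \<in> B1" if "x \<in> ?W" for x using that by (auto simp: I_def)
  then have m: "untag V \<in> Vals ?W" using B1(3) by (auto simp: Vals_def elements_def subset_iff)
  define u where "u a x = (if fst (dec x) = 0 then a else untag V x)" for a x
  have uX: "u a' \<in> Xvals I" if "a' \<in> X" for a'
    using that IN N(2) by (auto simp: u_def Xvals_def)
  have uQ: "sat U (override_on (untag V) (u a') I) \<phi> \<longleftrightarrow> Q (V(0 := \<lambda>_. a'))" for a'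
    unfolding \<phi>(3) by (rule sat_cong) (auto simp: override_on_def u_def untag_def I_def)
  obtain Td Qd Vd where Td: "finite Td" "df Td Qd" "\<forall>z. (0, z) \<in> Td \<longrightarrow> z \<in> I"
    "\<forall>z. (1, z) \<in> Td \<longrightarrow> fst z = s \<and> Vd 1 z \<in> X"
    "\<forall>t z. (t, z) \<in> Td \<longrightarrow> t \<noteq> 0 \<longrightarrow> t \<noteq> 1 \<longrightarrow> (fst z, Vd t z) \<in> F"
    "\<forall>u\<in>Xvals I. sat U (override_on (untag V) u I) \<phi> \<longleftrightarrow> Qd (Vd(0 := u))"
    by (rule definable_trace[OF \<phi>(1) I Is m])
  define E where "E = {z. (1, z) \<in> Td}"
  have finE: "finite E"
  proof -
    have "E \<subseteq> snd ` Td" by (force simp: E_def)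
    then show ?thesis using Td(1) finite_surj by blast
  qed
  let ?p = "\<lambda>t :: nat. 3 * t + 1"
  \<comment> \<open>Layout of the copies: 0 for \<open>u\<close>, 1 for the sought \<open>e\<close>,
    2 for the parameters in \<open>B1\<close>, \<open>3 * t\<close> for the
    \<open>F\<close>-parameters of \<open>Qd\<close>, and \<open>3 * t + 1\<close> for the
    parameters in the definition of \<open>X\<close>.\<close>
  define g where "g t = (if t < 2 then t else 3 * t)" for t :: nat
  define Ve where "Ve n = (if n = 1 then Vd 1 else if n = 2 then untag V
    else if n mod 3 = 0 then Vd (n div 3) else VX (n div 3))" for n
  have Ve: "Ve 1 = Vd 1" "Ve 2 = untag V" "\<And>t. t \<noteq> 0 \<Longrightarrow> Ve (3 * t) = Vd t"
    "\<And>t. t \<noteq> 0 \<Longrightarrow> Ve (3 * t + 1) = VX t"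
  proof -
    show "Ve (3 * t) = Vd t" if "t \<noteq> 0" for t
    proof -
      have "3 * t \<noteq> 1" "3 * t \<noteq> 2" by presburger+
      then show ?thesis by (simp add: Ve_def)
    qed
    show "Ve (3 * t + 1) = VX t" if "t \<noteq> 0" for t
    proof -
      have "3 * t + 1 \<noteq> 1" "3 * t + 1 \<noteq> 2" "(3 * t + 1) mod 3 = 1" "(3 * t + 1) div 3 = t"
        using that by presburger+
      then show ?thesis by (simp add: Ve_def)
    qed
  qed (simp_all add: Ve_def)
  define Tp where "Tp = (\<lambda>(t, z). (3 * t + 1, z)) ` {i\<in>TX. fst i \<noteq> 0}"
  define Tg where "Tg = (\<lambda>(t, z). (g t, z)) ` Td"
  define TT where "TT = {0} \<times> I \<union> {1} \<times> E \<union> {2} \<times> ?W \<union> Tp \<union> Tg"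
  have Tp: "(t, z) \<in> Tp \<longleftrightarrow> (\<exists>t'. t = 3 * t' + 1 \<and> t' \<noteq> 0 \<and> (t', z) \<in> TX)" for t z
    by (cases z) (auto simp: Tp_def image_iff)
  have Tg: "(t, z) \<in> Tg \<longleftrightarrow> (t = 0 \<and> (0, z) \<in> Td) \<or> (t = 1 \<and> z \<in> E) \<or>
      (\<exists>t'. t = 3 * t' \<and> t' \<noteq> 0 \<and> t' \<noteq> 1 \<and> (t', z) \<in> Td)" for t z
  proof -
    have "(t, z) \<in> Tg \<longleftrightarrow> (\<exists>t'. t = g t' \<and> (t', z) \<in> Td)"
      by (auto simp: Tg_def intro: rev_image_eqI)
    also have "\<dots> \<longleftrightarrow> (t = g 0 \<and> (0, z) \<in> Td) \<or> (t = g 1 \<and> (1, z) \<in> Td) \<or>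
        (\<exists>t'. t = g t' \<and> t' \<noteq> 0 \<and> t' \<noteq> 1 \<and> (t', z) \<in> Td)" by metis
    also have "(\<exists>t'. t = g t' \<and> t' \<noteq> 0 \<and> t' \<noteq> 1 \<and> (t', z) \<in> Td) \<longleftrightarrow>
        (\<exists>t'. t = 3 * t' \<and> t' \<noteq> 0 \<and> t' \<noteq> 1 \<and> (t', z) \<in> Td)"
    proof -
      have "g t' = 3 * t'" if "t' \<noteq> 0" "t' \<noteq> 1" for t' using that by (auto simp: g_def)
      then show ?thesis by metis
    qed
    finally show ?thesis by (simp add: g_def E_def)
  qed
  define QQ where "QQ V \<longleftrightarrow> (\<forall>z\<in>I. inX 0 z ?p V) \<and>
    \<not> (sat U (\<lambda>z. V (if z \<in> I then 0 else 2) z) \<phi> \<longleftrightarrow> Qd (\<lambda>t z. V (g t) z))" for V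
  \<comment> \<open>\<open>QQ\<close> describes a tuple of \<open>X\<close> at which
    \<open>Qd\<close> fails to define the trace; \<open>Qe\<close> says that there is none and that
    \<open>e\<close> itself lies in \<open>X\<close>.\<close>
  define Qe where "Qe V \<longleftrightarrow> \<not> (\<exists>u\<in>Vals I. QQ (V(0 := u))) \<and> (\<forall>z\<in>E. inX 1 z ?p V)" for V
  have Es: "fst z = s" if "z \<in> E" for z using that Td(4)[rule_format, of z] by (simp add: E_def)
  have "df TT QQ"
    unfolding QQ_def[abs_def]
  proof (intro df_conj df_Ball df_not df_iff df_atom[OF \<phi>(1)] finI)
    show "df TT (inX 0 z ?p)" if "z \<in> I" for z
      by (rule df_inX) (use that Is Tp in \<open>auto simp: TT_def\<close>)
    show "df TT (\<lambda>V. Qd (\<lambda>t z. V (g t) z))"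
      by (rule df_subst[OF Td(2)]) (auto simp: TT_def Tg_def intro: rev_image_eqI)
  qed (auto simp: TT_def)
  then have "df (TT - {0} \<times> UNIV) (\<lambda>V. \<exists>u\<in>Vals I. QQ (V(0 := u)))"
    by (rule df_ex[OF finI]) (use Td(3) Tp Tg in \<open>auto simp: TT_def\<close>)
  moreover have "df (TT - {0} \<times> UNIV) (inX 1 z ?p)" if "z \<in> E" for z
    by (rule df_inX) (use that Es Tp in \<open>auto simp: TT_def\<close>)
  ultimately have dfe: "df (TT - {0} \<times> UNIV) Qe"
    unfolding Qe_def[abs_def] by (intro df_conj df_not df_Ball finE)
  let ?o = "\<lambda>e. Ve(1 := override_on (Ve 1) e E)"
  have p: "(?o e) (?p t) = VX t" "((?o e)(0 := u)) (?p t) = VX t" if "t \<noteq> 0" for t e u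
    using that Ve(4)[OF that] by simp_all
  have inE: "inX 1 z ?p (?o e) \<longleftrightarrow> e z \<in> X" if "e \<in> Vals E" "z \<in> E" for e z
    using inX_iff[of "?o e" 1 z ?p] p(1) that Es[OF that(2)] by (auto simp: Vals_def)
  have QQ: "QQ ((?o e)(0 := u)) \<longleftrightarrow> u \<in> Xvals I \<and>
      \<not> (sat U (override_on (untag V) u I) \<phi> \<longleftrightarrow> Qd (Vd(1 := override_on (Vd 1) e E, 0 := u)))"
    if "u \<in> Vals I" for e u
  proof -
    have "inX 0 z ?p ((?o e)(0 := u)) \<longleftrightarrow> u z \<in> X" if "z \<in> I" for z
      using inX_iff[of "(?o e)(0 := u)" 0 z ?p] p(2) that Is[OF that] \<open>u \<in> Vals I\<close>
      by (auto simp: Vals_def)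
    moreover have "(\<lambda>z. ((?o e)(0 := u)) (if z \<in> I then 0 else 2) z) = override_on (untag V) u I"
      using Ve(2) by (auto simp: override_on_def)
    moreover have "Qd (\<lambda>t z. ((?o e)(0 := u)) (g t) z) \<longleftrightarrow> Qd (Vd(1 := override_on (Vd 1) e E, 0 := u))"
    proof (rule df_support[OF Td(2)])
      fix t z
      show "((?o e)(0 := u)) (g t) z = (Vd(1 := override_on (Vd 1) e E, 0 := u)) t z"
      proof (cases "t < 2")
        case True
        then have "t = 0 \<or> t = 1" by auto
        then show ?thesis using Ve(1) by (auto simp: g_def)
      next
        case False
        then have "3 * t \<noteq> 1" "t \<noteq> 0" "t \<noteq> 1" by presburger+
        then show ?thesis using False Ve(3)[of t] by (simp add: g_def)
      qed
    qed
    ultimately show ?thesis by (simp add: QQ_def Xvals_def)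
  qed
  have Qe: "Qe (?o e) \<longleftrightarrow> (\<forall>u\<in>Xvals I. sat U (override_on (untag V) u I) \<phi> \<longleftrightarrow>
      Qd (Vd(1 := override_on (Vd 1) e E, 0 := u))) \<and> (\<forall>z\<in>E. e z \<in> X)" if "e \<in> Vals E" for e
    using QQ[of _ e] inE[OF that] Xvals_Vals[of I, OF Is] unfolding Qe_def by blast
  have VdE: "override_on (Vd 1) (Vd 1) E = Vd 1" by (simp add: override_on_def)
  have "\<exists>e. (\<forall>z\<in>E. e z \<in> N1) \<and> Qe (?o e)"
  proof (rule meets_tuple[OF finE m1 _ dfe Es])
    show "(s, a) \<in> B1" if "a \<in> N1" for a using B1(2) that by blast
    show "(fst z, Ve t z) \<in> B1" if tz: "(t, z) \<in> TT - {0} \<times> UNIV" "(t, z) \<notin> {1} \<times> E" for t z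
    proof -
      consider "t = 2" "z \<in> ?W" | t' where "t = 3 * t' + 1" "t' \<noteq> 0" "(t', z) \<in> TX"
        | t' where "t = 3 * t'" "t' \<noteq> 0" "t' \<noteq> 1" "(t', z) \<in> Td"
        using tz Tp Tg by (auto simp: TT_def)
      then show ?thesis
      proof cases
        case 1 then show ?thesis using WB Ve(2) by simp
      next
        case 2 then show ?thesis using X(4)[of t' z] Ve(4)[of t'] B1(1) by auto
      next
        case 3 then show ?thesis using Td(5)[rule_format, of t' z] Ve(3)[of t'] B1(1) by auto
      qed
    qed
    show "\<forall>z\<in>E. e z \<in> X" if "e \<in> Vals E" "Qe (?o e)" for e using that Qe by blast
    show "\<exists>e\<in>Vals E. Qe (?o e)"
    proof
      show e: "Vd 1 \<in> Vals E" using Td(4) X_carr by (auto simp: Vals_def E_def)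
      show "Qe (?o (Vd 1))" unfolding Qe[OF e] VdE using Td(4,6) by (simp add: E_def)
    qed
  qed auto
  then obtain e where e: "\<forall>z\<in>E. e z \<in> N1" "Qe (?o e)" by (elim exE conjE)
  have eV: "e \<in> Vals E" using e(1) N X_carr Es by (auto simp: Vals_def)
  define A' where "A' = {a'\<in>carr U s. Qd (Vd(1 := override_on (Vd 1) e E, 0 := u a'))}"
  have iff: "a' \<in> A \<longleftrightarrow> a' \<in> A'" if "a' \<in> X" for a'
    using e(2) uX[OF that] uQ[of a'] X_carr that unfolding Qe[OF eV] T(5) A'_def by blast
  have "dset (F \<union> {s} \<times> N2) s A'"
  proof -
    define g' where "g' t x = (if t = 0 then if fst (dec x) = 0 then 0 else 2 else if t = 1 then 1 else t + 1)"
      for t :: nat and x :: "'s var"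
    define V' where "V' n = (if n = 1 then override_on (Vd 1) e E else if n = 2 then untag V else Vd (n - 1))" for n
    let ?T = "(\<lambda>(t, x). (g' t x, x)) ` Td"
    have df: "df ?T (\<lambda>V. Qd (\<lambda>t x. V (g' t x) x))"
      by (rule df_subst[OF Td(2)]) (auto intro: rev_image_eqI)
    have eq: "(\<lambda>t x. (V'(0 := \<lambda>_. a')) (g' t x) x) = Vd(1 := override_on (Vd 1) e E, 0 := u a')" for a'
      by (auto simp: g'_def V'_def u_def fun_eq_iff)
    have T': "\<exists>t'. (t', x) \<in> Td \<and> t = g' t' x" if "(t, x) \<in> ?T" for t x
      using that by (auto simp: image_iff)
    show ?thesis
    proof (rule dsetI[OF df, of _ V'])
      show "fst x = s" if "(0, x) \<in> ?T" for x
        using T'[OF that] Td(3)[rule_format, of x] Is[of x] by (auto simp: g'_def split: if_splits)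
      show "(fst x, V' t x) \<in> F \<union> {s} \<times> N2" if tx: "(t, x) \<in> ?T" "t \<noteq> 0" for t x
      proof -
        obtain t' where t': "(t', x) \<in> Td" "t = g' t' x" using T'[OF tx(1)] by blast
        consider "t' = 0" "fst (dec x) \<noteq> 0" | "t' = 1" | "t' \<noteq> 0" "t' \<noteq> 1"
          using t'(2) tx(2) by (auto simp: g'_def split: if_splits)
        then show ?thesis
        proof cases
          case 1
          then have "x \<in> I" using t'(1) Td(3)[rule_format, of x] by simp
          then show ?thesis using 1 t'(2) Is[of x] IN[of x] by (simp add: g'_def V'_def)
        next
          case 2
          then have "x \<in> E" using t'(1) by (simp add: E_def)
          then show ?thesis using 2 t'(2) e(1) N(1) Es[of x] by (auto simp: g'_def V'_def)
        next
          case 3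
          then show ?thesis using t' Td(5)[rule_format, of t' x] by (auto simp: g'_def V'_def)
        qed
      qed
      show "a' \<in> A' \<longleftrightarrow> a' \<in> carr U s \<and> Qd (\<lambda>t x. (V'(0 := \<lambda>_. a')) (g' t x) x)" for a'
        unfolding eq A'_def by simp
    qed
  qed
  moreover have "A' \<inter> X \<noteq> {}" using iff a by blast
  ultimately obtain a' where "a' \<in> A'" "a' \<in> N2" using m2 unfolding meets_def by blast
  then show "A \<inter> N2 \<noteq> {}" using iff N(2) by blast
qed

text \<open>The key step: \<open>c\<close> realises a type over \<open>B\<close> that is compressible with respect to every formula.
  If a \<open>B \<union> {c}\<close>-definable set met \<open>X\<close> but not \<open>N\<close>, compressibility would cover \<open>N\<close> by
  a family of \<open>B\<close>-definable sets, by stability already finitely many of them would cover \<open>N\<close>, and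
  the complement of their union would contradict the hypothesis on \<open>B\<close>.\<close>

lemma extension:
  assumes "countable_lang L"
    and m: "meets B N" and B: "{s} \<times> N \<subseteq> B" "B \<subseteq> elements U" "small U B" and N: "N \<subseteq> X"
    and \<Theta>: "dset B \<sigma> \<Theta>" "\<Theta> \<noteq> {}"
  obtains c where "c \<in> \<Theta>" "meets (insert (\<sigma>, c) B) N"
proof -
  \<comment> \<open>A formula is indexed together with the set of its variables that are to be
    evaluated at \<open>c\<close>. As \<open>L\<close> is countable, all these pairs fit into one
    sequence, as the filter construction requires.\<close>
  define Idx where "Idx = (SIGMA \<phi>:{\<phi>. wf_fm L \<phi>}. {Z. Z \<subseteq> fv \<phi> \<and> fst ` Z \<subseteq> {\<sigma>}})"
  have "countable Idx"
    unfolding Idx_def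
  proof (intro countable_SIGMA)
    show "countable {\<phi>. wf_fm L \<phi>}" by (rule countable_wf_fm[OF assms(1)])
    show "countable {Z. Z \<subseteq> fv \<phi> \<and> fst ` Z \<subseteq> {\<sigma>}}" for \<phi>
    proof (rule countable_finite, rule finite_subset)
      show "{Z. Z \<subseteq> fv \<phi> \<and> fst ` Z \<subseteq> {\<sigma>}} \<subseteq> Pow (fv \<phi>)" by auto
    qed (simp add: finite_fv)
  qed
  have "(Bot, {}) \<in> Idx" by (simp add: Idx_def)
  then have "Idx \<noteq> {}" by blast
  define f where "f i = fst (from_nat_into Idx i)" for i
  define Z where "Z i = snd (from_nat_into Idx i)" for i
  have fZ: "wf_fm L (f i)" "Z i \<subseteq> fv (f i)" "fst ` Z i \<subseteq> {\<sigma>}" for i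
  proof -
    obtain \<phi> Z' where e: "from_nat_into Idx i = (\<phi>, Z')" by (rule prod.exhaust)
    then have "(\<phi>, Z') \<in> Idx" using from_nat_into[OF \<open>Idx \<noteq> {}\<close>, of i] by simp
    then have "wf_fm L \<phi>" "Z' \<subseteq> fv \<phi>" "fst ` Z' \<subseteq> {\<sigma>}" by (simp_all add: Idx_def)
    then show "wf_fm L (f i)" "Z i \<subseteq> fv (f i)" "fst ` Z i \<subseteq> {\<sigma>}"
      by (simp_all add: f_def Z_def e)
  qed
  have fZ_ex: "\<exists>i. f i = \<phi> \<and> Z i = Z'" if "wf_fm L \<phi>" "Z' \<subseteq> fv \<phi>" "fst ` Z' \<subseteq> {\<sigma>}" for \<phi> Z'
  proof -
    have "(\<phi>, Z') \<in> Idx" using that by (simp add: Idx_def)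
    from from_nat_into_surj[OF \<open>countable Idx\<close> this]
    obtain n where "from_nat_into Idx n = (\<phi>, Z')" by (rule exE)
    then show ?thesis by (intro exI[of _ n]) (simp add: f_def Z_def)
  qed
  define S where "S i c v = sat U (override_on v (\<lambda>_. c) (Z i)) (f i)" for i c and v :: "'s var \<Rightarrow> 'a"
  define Pa where "Pa i = {v :: 's var \<Rightarrow> 'a. \<forall>z\<in>fv (f i) - Z i. (fst z, v z) \<in> B}" for i
  have \<Theta>U: "\<Theta> \<subseteq> carr U \<sigma>" using \<Theta>(1) by (auto simp: dset_def)
  then have \<sigma>: "\<sigma> \<in> sorts L" using \<Theta>(2) is_struct by (auto simp: is_struct_def)
  have BU: "a \<in> carr U \<tau>" if "(\<tau>, a) \<in> B" for \<tau> a using that B(2) by (auto simp: elements_def)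
  \<comment> \<open>NIP with exchanged roles: the parameter tuples over \<open>B\<close> are the
    points to be shattered, and the elements of \<open>\<Theta>\<close> do the shattering.\<close>
  have vc: "\<exists>d. \<forall>Y\<subseteq>Pa i. finite Y \<and> card Y = Suc d \<longrightarrow> (\<exists>b. \<forall>c\<in>\<Theta>. \<exists>y\<in>Y. S i c y \<noteq> b y)" for i
  proof -
    let ?I = "fv (f i) - Z i"
    obtain d where d: "\<And>Y. finite Y \<Longrightarrow> Y \<subseteq> Vals ?I \<Longrightarrow>
      (\<And>b. \<exists>w\<in>Vals (fv (f i) - ?I). \<forall>y\<in>Y. sat U (override_on w y ?I) (f i) = b y) \<Longrightarrow> card Y \<le> d"
      using nip_bound[OF fZ(1), of ?I i] by (metis Diff_subset)
    have "\<exists>b. \<forall>c\<in>\<Theta>. \<exists>y\<in>Y. S i c y \<noteq> b y" if Y: "Y \<subseteq> Pa i" "finite Y" "card Y = Suc d" for Y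
    proof (rule ccontr)
      assume neg: "\<not> ?thesis"
      have "card Y \<le> d"
      proof (rule d[OF Y(2)])
        show "Y \<subseteq> Vals ?I" using Y(1) BU by (auto simp: Pa_def Vals_def)
        fix b
        have "\<not> (\<forall>c\<in>\<Theta>. \<exists>y\<in>Y. S i c y \<noteq> b y)" using neg by (rule contrapos_nn) (rule exI)
        then obtain c where c: "c \<in> \<Theta>" "\<forall>y\<in>Y. S i c y = b y" by auto
        have "sat U (override_on (\<lambda>_. c) y ?I) (f i) = S i c y" for y
          unfolding S_def by (rule sat_cong) (auto simp: override_on_def)
        moreover have "(\<lambda>_. c) \<in> Vals (fv (f i) - ?I)"
          using c(1) \<Theta>U fZ(3)[of i] by (auto simp: Vals_def)
        ultimately show "\<exists>w\<in>Vals (fv (f i) - ?I). \<forall>y\<in>Y. sat U (override_on w y ?I) (f i) = b y"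
          using c(2) by (intro bexI[of _ "\<lambda>_. c"]) auto
      qed
      then show False using Y(3) by simp
    qed
    then show ?thesis by blast
  qed
  obtain D where D: "D \<noteq> bot" "D \<le> principal \<Theta>"
     "\<forall>i. \<exists>K. \<forall>Y\<subseteq>Pa i \<times> UNIV. finite Y \<longrightarrow> (\<forall>(y, t)\<in>Y. \<forall>\<^sub>F c in D. S i c y = t) \<longrightarrow>
        (\<exists>l. length l \<le> K \<and> (\<forall>(j, y, t)\<in>set l. j \<le> i \<and> y \<in> Pa j \<and> (\<forall>\<^sub>F c in D. S j c y = t)) \<and>
             (\<forall>c\<in>\<Theta>. obeys S l c \<longrightarrow> agree (S i) Y c))"
     "\<forall>i. decides (S i) (Pa i) D"
    using compressible_sequence[OF \<Theta>(2), of Pa S, OF vc] by (elim exE conjE)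
  define E where "E j y t = {c\<in>carr U \<sigma>. S j c y = t}" for j y t
  define EE where "EE = {E j y t | j y t. y \<in> Pa j \<and> (\<forall>\<^sub>F c in D. S j c y = t)}"
  \<comment> \<open>A finite part of the type is an eventual property of the proper filter
    \<open>D\<close>, hence inhabited; saturation realises the whole type together with membership
    in \<open>\<Theta>\<close>.\<close>
  have "\<exists>c\<in>carr U \<sigma>. \<forall>A\<in>insert \<Theta> EE. c \<in> A"
  proof (rule saturated_dset[OF sat B(2,3) \<sigma>])
    have dE: "dset B \<sigma> (E j y t)" if "y \<in> Pa j" for j y t
    proof -
      let ?T = "{0 :: nat} \<times> Z j \<union> {1} \<times> (fv (f j) - Z j)"
      have df: "df ?T (\<lambda>V. sat U (\<lambda>z. V (if z \<in> Z j then 0 else 1) z) (f j) = t)"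
        by (intro df_const_iff df_atom[OF fZ(1)]) (use fZ(2) in auto)
      have eq: "(\<lambda>z. ((\<lambda>_. y)(0 :: nat := \<lambda>_. a)) (if z \<in> Z j then 0 else 1) z) = override_on y (\<lambda>_. a) (Z j)" for a
        by (rule ext) (simp add: override_on_def)
      show ?thesis
      proof (rule dsetI[OF df, of _ "\<lambda>_. y"])
        show "fst z = \<sigma>" if "(0, z) \<in> ?T" for z using that fZ(3)[of j] by auto
        show "(fst z, y z) \<in> B" if "(t, z) \<in> ?T" "t \<noteq> 0" for t z
          using that \<open>y \<in> Pa j\<close> by (auto simp: Pa_def)
        show "a \<in> E j y t \<longleftrightarrow> a \<in> carr U \<sigma> \<and>
            sat U (\<lambda>z. ((\<lambda>_. y)(0 :: nat := \<lambda>_. a)) (if z \<in> Z j then 0 else 1) z) (f j) = t" for a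
          unfolding eq by (simp add: E_def S_def)
      qed
    qed
    show "dset B \<sigma> A" if "A \<in> insert \<Theta> EE" for A
      using that dE \<Theta>(1) by (auto simp: EE_def)
    fix G assume G: "finite G" "G \<subseteq> insert \<Theta> EE"
    have ev\<Theta>: "\<forall>\<^sub>F c in D. c \<in> \<Theta>"
      using D(2) by (rule filter_leD) (simp add: eventually_principal)
    have "\<forall>\<^sub>F c in D. c \<in> A" if AG: "A \<in> G" for A
    proof (cases "A = \<Theta>")
      case True
      then show ?thesis using ev\<Theta> by simp
    next
      case False
      then have "A \<in> EE" using AG G(2) by blast
      then obtain j y t where A: "A = E j y t" "y \<in> Pa j" "\<forall>\<^sub>F c in D. S j c y = t"
        unfolding EE_def by (elim CollectE exE conjE)
      from A(3) ev\<Theta> have "\<forall>\<^sub>F c in D. S j c y = t \<and> c \<in> \<Theta>" by (rule eventually_conj)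
      then show ?thesis by (rule eventually_mono) (use \<Theta>U in \<open>auto simp: A(1) E_def\<close>)
    qed
    then have "\<forall>\<^sub>F c in D. \<forall>A\<in>G. c \<in> A" using G(1) by (intro eventually_ball_finite) auto
    with ev\<Theta> have "\<forall>\<^sub>F c in D. c \<in> \<Theta> \<and> (\<forall>A\<in>G. c \<in> A)" by (rule eventually_conj)
    from eventually_happens'[OF D(1) this] show "\<exists>c\<in>carr U \<sigma>. \<forall>A\<in>G. c \<in> A" using \<Theta>U by blast
  qed
  then obtain c where c0: "\<forall>A\<in>insert \<Theta> EE. c \<in> A" by (rule bexE)
  have c: "c \<in> \<Theta>" "\<And>j y t. y \<in> Pa j \<Longrightarrow> \<forall>\<^sub>F c in D. S j c y = t \<Longrightarrow> S j c y = t"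
  proof -
    show "c \<in> \<Theta>" using c0 by simp
    fix j y t assume "y \<in> Pa j" "\<forall>\<^sub>F c in D. S j c y = t"
    then have "E j y t \<in> EE" unfolding EE_def by (intro CollectI exI[of _ j] exI[of _ y] exI[of _ t] conjI refl)
    then have "c \<in> E j y t" using c0 by simp
    then show "S j c y = t" by (simp add: E_def)
  qed
  have "A \<inter> N \<noteq> {}" if A: "dset (insert (\<sigma>, c) B) s A" and AX: "A \<inter> X \<noteq> {}" for A
  proof
    assume AN: "A \<inter> N = {}"
    obtain a where a: "a \<in> A" "a \<in> X" using AX by blast
    obtain T Q V where T: "finite T" "df T Q" "\<forall>z. (0, z) \<in> T \<longrightarrow> fst z = s"
      "\<forall>t z. (t, z) \<in> T \<longrightarrow> t \<noteq> 0 \<longrightarrow> (fst z, V t z) \<in> insert (\<sigma>, c) B"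
      "A = {a\<in>carr U s. Q (V(0 := \<lambda>_. a))}"
      by (rule dsetE[OF A])
    obtain \<phi> where \<phi>: "wf_fm L \<phi>" "fv \<phi> \<subseteq> enc ` T" "Q = (\<lambda>V. sat U (untag V) \<phi>)"
      using T(2) by (rule dfE)
    have dec: "(fst (dec x), snd (dec x)) \<in> T" "fst (snd (dec x)) = fst x" if "x \<in> fv \<phi>" for x
      using \<phi>(2) that by (auto simp: fst_enc)
    have tag0: "fst x = s" if "x \<in> fv \<phi>" "fst (dec x) = 0" for x
      using dec[OF that(1)] that(2) T(3) by simp
    have tag: "(fst x, untag V x) = (\<sigma>, c) \<or> (fst x, untag V x) \<in> B" if "x \<in> fv \<phi>" "fst (dec x) \<noteq> 0" for x
      using dec[OF that(1)] that(2) T(4)[rule_format, of "fst (dec x)" "snd (dec x)"]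
      by (simp add: untag_def)
    \<comment> \<open>Only variables whose value is not already in \<open>B\<close> are treated as
      occurrences of \<open>c\<close>; this also covers the case that \<open>c\<close> belongs to
      \<open>B\<close>.\<close>
    define Zc where "Zc = {x\<in>fv \<phi>. fst (dec x) \<noteq> 0 \<and> (fst x, untag V x) \<notin> B}"
    have Zc: "fst x = \<sigma>" "untag V x = c" if "x \<in> Zc" for x
      using that tag[of x] by (auto simp: Zc_def)
    have "Zc \<subseteq> fv \<phi>" "fst ` Zc \<subseteq> {\<sigma>}" using Zc(1) by (auto simp: Zc_def)
    then obtain i where i: "f i = \<phi>" "Z i = Zc" using fZ_ex[OF \<phi>(1)] by blast
    define va where "va a x = (if fst (dec x) = 0 then a else untag V x)" for a x
    have SQ: "S i c (va a') \<longleftrightarrow> Q (V(0 := \<lambda>_. a'))" for a'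
      unfolding S_def i \<phi>(3)
      by (rule sat_cong) (use Zc(2) in \<open>auto simp: override_on_def va_def untag_def Zc_def\<close>)
    have vaP: "va a' \<in> Pa i" if "a' \<in> N" for a'
    proof -
      have "(fst z, va a' z) \<in> B" if z: "z \<in> fv \<phi> - Zc" for z
      proof (cases "fst (dec z) = 0")
        case True
        then show ?thesis using tag0[of z] z B(1) \<open>a' \<in> N\<close> by (auto simp: va_def)
      next
        case False
        then show ?thesis using z by (auto simp: va_def Zc_def)
      qed
      then show ?thesis unfolding Pa_def i by blast
    qed
    have notS: "\<not> S i c (va a')" if "a' \<in> N" for a'
      using AN that N X_carr unfolding SQ T(5) by blast
    have evS: "\<forall>\<^sub>F c in D. S i c (va a') = False" if "a' \<in> N" for a'
    proof -
      have "(\<forall>\<^sub>F c in D. S i c (va a')) \<or> (\<forall>\<^sub>F c in D. \<not> S i c (va a'))"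
        using D(4) vaP[OF that] unfolding decides_def by blast
      moreover have "\<not> (\<forall>\<^sub>F c in D. S i c (va a'))"
      proof
        assume "\<forall>\<^sub>F c in D. S i c (va a')"
        then have "S i c (va a')" using c(2)[OF vaP[OF that], of True] by simp
        with notS[OF that] show False ..
      qed
      ultimately show ?thesis by simp
    qed
    obtain K where K: "\<forall>Y\<subseteq>Pa i \<times> UNIV. finite Y \<longrightarrow> (\<forall>(y, t)\<in>Y. \<forall>\<^sub>F c in D. S i c y = t) \<longrightarrow>
        (\<exists>l. length l \<le> K \<and> (\<forall>(j, y, t)\<in>set l. j \<le> i \<and> y \<in> Pa j \<and> (\<forall>\<^sub>F c in D. S j c y = t)) \<and>
             (\<forall>c\<in>\<Theta>. obeys S l c \<longrightarrow> agree (S i) Y c))"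
      using D(3) by (rule allE, elim exE)
    \<comment> \<open>Lists of boundedly many conditions that hold of \<open>c\<close>.
      \<open>R a' l\<close> says that the list \<open>l\<close> alone, together with
      \<open>\<Theta>\<close>, excludes \<open>a'\<close> from the set under consideration;
      compressibility provides one list for each finite part of \<open>N\<close>.\<close>
    define LL where "LL = {l. length l \<le> K \<and> (\<forall>(j, y, t)\<in>set l. j \<le> i \<and> y \<in> Pa j) \<and> obeys S l c}"
    define R where "R a' l \<longleftrightarrow> (\<forall>c'\<in>\<Theta>. obeys S l c' \<longrightarrow> \<not> S i c' (va a'))" for a' l
    have fin: "\<exists>l\<in>LL. \<forall>a'\<in>N0. R a' l" if N0: "finite N0" "N0 \<subseteq> N" for N0
    proof -
      define Y where "Y = (\<lambda>a'. (va a', False)) ` N0"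
      have 1: "Y \<subseteq> Pa i \<times> UNIV" using vaP N0 by (auto simp: Y_def)
      have 2: "finite Y" using N0 by (simp add: Y_def)
      have 3: "\<forall>(y, t)\<in>Y. \<forall>\<^sub>F c in D. S i c y = t" using evS N0(2) by (auto simp: Y_def)
      from K[THEN spec, THEN mp, THEN mp, THEN mp, OF 1 2 3] obtain l where l: "length l \<le> K"
        "\<forall>(j, y, t)\<in>set l. j \<le> i \<and> y \<in> Pa j \<and> (\<forall>\<^sub>F c in D. S j c y = t)"
        "\<forall>c\<in>\<Theta>. obeys S l c \<longrightarrow> agree (S i) Y c"
        by (elim exE conjE)
      have "S j c y = t" if "(j, y, t) \<in> set l" for j y t
      proof (rule c(2))
        show "y \<in> Pa j" "\<forall>\<^sub>F c in D. S j c y = t" using bspec[OF l(2) that] by simp_all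
      qed
      then have "obeys S l c" unfolding obeys_def by blast
      moreover have "\<forall>(j, y, t)\<in>set l. j \<le> i \<and> y \<in> Pa j"
      proof (intro ballI, unfold split_paired_all prod.case)
        fix j y t assume "(j, y, t) \<in> set l"
        from bspec[OF l(2) this] show "j \<le> i \<and> y \<in> Pa j" by simp
      qed
      ultimately have "l \<in> LL" using l(1) by (simp add: LL_def)
      moreover have "\<forall>a'\<in>N0. R a' l" using l(3) by (auto simp: R_def agree_def Y_def)
      ultimately show ?thesis by blast
    qed
    obtain T' Q' V' where T': "finite T'" "df T' Q'" "\<forall>z. (0, z) \<in> T' \<longrightarrow> fst z = \<sigma>"
      "\<forall>t z. (t, z) \<in> T' \<longrightarrow> t \<noteq> 0 \<longrightarrow> (fst z, V' t z) \<in> B"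
      "\<Theta> = {a\<in>carr U \<sigma>. Q' (V'(0 := \<lambda>_. a))}"
      by (rule dsetE[OF \<Theta>(1)])
    \<comment> \<open>Without the parameters, only finitely many shapes remain for lists in
      \<open>LL\<close>. On lists of a fixed shape \<open>h\<close> the relation \<open>R\<close> is
      given by the single formula behind \<open>Qh h\<close>.\<close>
    define shape :: "(nat \<times> ('s var \<Rightarrow> 'a) \<times> bool) list \<Rightarrow> (nat \<times> bool) list"
      where "shape = map (\<lambda>(j, y, t). (j, t))"
    \<comment> \<open>Layout for \<open>Qh\<close>: copy 0 holds \<open>a'\<close>, copy 1 the
      quantified element of \<open>\<Theta>\<close>, copy 2 the \<open>B\<close>-parameters of
      \<open>A\<close>, the copies \<open>2 * q + 4\<close> the parameters of the conditions, and
      the odd copies from 3 on those of \<open>\<Theta>\<close>.\<close>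
    define W where "W l n = (if n = 0 then undefined else if n = 2 then untag V
      else if even n then fst (snd (l ! (n div 2 - 2))) else V' (n div 2))" for l :: "(nat \<times> ('s var \<Rightarrow> 'a) \<times> bool) list" and n
    have W: "W l 2 = untag V" "W l (2 * q + 4) = fst (snd (l ! q))" "W l (2 * t + 1) = V' t" for l q t
    proof -
      have "2 * q + 4 \<noteq> 0" "2 * q + 4 \<noteq> 2" "even (2 * q + 4)" "(2 * q + 4) div 2 - 2 = q" by auto
      then show "W l (2 * q + 4) = fst (snd (l ! q))" unfolding W_def by (simp only: if_True if_False simp_thms)
      have "2 * t + 1 \<noteq> 0" "2 * t + 1 \<noteq> 2" "odd (2 * t + 1)" "(2 * t + 1) div 2 = t" by presburger+
      then show "W l (2 * t + 1) = V' t" unfolding W_def by (simp only: if_True if_False simp_thms)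
    qed (simp add: W_def)
    define Qh where "Qh h V \<longleftrightarrow> \<not> (\<exists>w\<in>Vals {(\<sigma>, 0)}.
      (Q' (\<lambda>t z. (V(1 := w)) (if t = 0 then 1 else 2 * t + 1) (if t = 0 then (\<sigma>, 0) else z)) \<and>
       (\<forall>q\<in>{..<length h}. sat U (\<lambda>z. (V(1 := w)) (if z \<in> Z (fst (h ! q)) then 1 else 2 * q + 4)
           (if z \<in> Z (fst (h ! q)) then (\<sigma>, 0) else z)) (f (fst (h ! q))) = snd (h ! q))) \<and>
      sat U (\<lambda>z. (V(1 := w)) (if z \<in> Zc then 1 else if fst (dec z) = 0 then 0 else 2)
        (if z \<in> Zc then (\<sigma>, 0) else z)) \<phi>)" for h :: "(nat \<times> bool) list" and V
    define Th where "Th h = {0} \<times> {x. fst x = s} \<union> {2} \<times> {x\<in>fv \<phi> - Zc. fst (dec x) \<noteq> 0} \<union>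
      (\<lambda>(t, z). (2 * t + 1, z)) ` {i\<in>T'. fst i \<noteq> 0} \<union>
      (\<Union>q\<in>{..<length h}. {2 * q + 4} \<times> (fv (f (fst (h ! q))) - Z (fst (h ! q))))" for h :: "(nat \<times> bool) list"
    have dfQ: "df (Th h) (Qh h)" for h
    proof -
      let ?T = "Th h \<union> {(1, (\<sigma>, 0))}"
      have "df ?T (\<lambda>V. (Q' (\<lambda>t z. V (if t = 0 then 1 else 2 * t + 1) (if t = 0 then (\<sigma>, 0) else z)) \<and>
       (\<forall>q\<in>{..<length h}. sat U (\<lambda>z. V (if z \<in> Z (fst (h ! q)) then 1 else 2 * q + 4)
           (if z \<in> Z (fst (h ! q)) then (\<sigma>, 0) else z)) (f (fst (h ! q))) = snd (h ! q))) \<and>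
        sat U (\<lambda>z. V (if z \<in> Zc then 1 else if fst (dec z) = 0 then 0 else 2)
          (if z \<in> Zc then (\<sigma>, 0) else z)) \<phi>)"
      proof (intro df_conj)
        show "df ?T (\<lambda>V. Q' (\<lambda>t z. V (if t = 0 then 1 else 2 * t + 1) (if t = 0 then (\<sigma>, 0) else z)))"
        proof (rule df_subst[OF T'(2)])
          fix t z assume tz: "(t, z) \<in> T'"
          then show "(if t = 0 then 1 else 2 * t + 1, if t = 0 then (\<sigma>, 0) else z) \<in> ?T"
            by (force simp: Th_def)
          show "fst (if t = 0 then (\<sigma>, 0) else z) = fst z"
            using tz T'(3)[rule_format, of z] by auto
        qed
        show "df ?T (\<lambda>V. \<forall>q\<in>{..<length h}. sat U (\<lambda>z. V (if z \<in> Z (fst (h ! q)) then 1 else 2 * q + 4)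
           (if z \<in> Z (fst (h ! q)) then (\<sigma>, 0) else z)) (f (fst (h ! q))) = snd (h ! q))"
        proof (intro df_Ball df_const_iff df_atom[OF fZ(1)])
          fix q z assume qz: "q \<in> {..<length h}" "z \<in> fv (f (fst (h ! q)))"
          then show "(if z \<in> Z (fst (h ! q)) then 1 else 2 * q + 4,
              if z \<in> Z (fst (h ! q)) then (\<sigma>, 0) else z) \<in> ?T"
            by (auto simp: Th_def)
          show "fst (if z \<in> Z (fst (h ! q)) then (\<sigma>, 0) else z) = fst z"
            using fZ(3)[of "fst (h ! q)"] by auto
        qed simp
        show "df ?T (\<lambda>V. sat U (\<lambda>z. V (if z \<in> Zc then 1 else if fst (dec z) = 0 then 0 else 2)
          (if z \<in> Zc then (\<sigma>, 0) else z)) \<phi>)"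
        proof (rule df_atom[OF \<phi>(1)])
          fix z assume z: "z \<in> fv \<phi>"
          then show "(if z \<in> Zc then 1 else if fst (dec z) = 0 then 0 else 2, if z \<in> Zc then (\<sigma>, 0) else z) \<in> ?T"
            using tag0[of z] by (auto simp: Th_def)
          show "fst (if z \<in> Zc then (\<sigma>, 0) else z) = fst z" using Zc(1)[of z] by auto
        qed
      qed
      then have "df (?T - {1} \<times> UNIV) (Qh h)"
        unfolding Qh_def[abs_def]
      proof (intro df_not, rule df_ex[rotated])
        show "z \<in> {(\<sigma>, 0)}" if "(1, z) \<in> ?T" for z
        proof -
          have "(1, z) \<notin> Th h"
          proof -
            have "2 * t + 1 \<noteq> 1" if "t \<noteq> 0" for t :: nat using that by simp
            moreover have "2 * q + 4 \<noteq> 1" for q :: nat by presburger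
            ultimately show ?thesis unfolding Th_def by fastforce
          qed
          then show ?thesis using that by auto
        qed
      qed simp
      then show ?thesis by (rule df_mono) auto
    qed
    have WB: "(fst z, W l t z) \<in> B" if l: "l \<in> LL" and tz: "(t, z) \<in> Th (shape l)" "t \<noteq> 0" for l t z
    proof -
      consider "t = 2" "z \<in> fv \<phi> - Zc" "fst (dec z) \<noteq> 0"
        | t' where "t = 2 * t' + 1" "(t', z) \<in> T'" "t' \<noteq> 0"
        | q where "t = 2 * q + 4" "q < length l" "z \<in> fv (f (fst (l ! q))) - Z (fst (l ! q))"
        using tz by (auto simp: Th_def shape_def split_beta)
      then show ?thesis
      proof cases
        case 1
        then show ?thesis using W(1) by (auto simp: Zc_def)
      next
        case 2
        then show ?thesis using W(3) T'(4)[rule_format, of t' z] by simp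
      next
        case 3
        obtain j y t0 where jy: "l ! q = (j, y, t0)" by (rule prod_cases3)
        then have "(j, y, t0) \<in> set l" using nth_mem[OF 3(2)] by simp
        then have "y \<in> Pa j" using l by (auto simp: LL_def)
        then show ?thesis using 3 W(2) by (simp add: jy Pa_def)
      qed
    qed
    have QhR: "Qh (shape l) ((W l)(0 := \<lambda>_. a')) \<longleftrightarrow> R a' l" for l a'
    proof -
      have 1: "Q' (\<lambda>t z. ((W l)(0 := \<lambda>_. a', 1 := w)) (if t = 0 then 1 else 2 * t + 1) (if t = 0 then (\<sigma>, 0) else z)) \<longleftrightarrow>
          Q' (V'(0 := \<lambda>_. w (\<sigma>, 0)))" for w
      proof (rule df_support[OF T'(2)])
        fix t z
        show "((W l)(0 := \<lambda>_. a', 1 := w)) (if t = 0 then 1 else 2 * t + 1) (if t = 0 then (\<sigma>, 0) else z) =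
          (V'(0 := \<lambda>_. w (\<sigma>, 0))) t z"
          using W(3)[of l t] by (cases "t = 0") auto
      qed
      have 2: "(\<forall>q\<in>{..<length (shape l)}. sat U (\<lambda>z. ((W l)(0 := \<lambda>_. a', 1 := w)) (if z \<in> Z (fst (shape l ! q)) then 1 else 2 * q + 4)
           (if z \<in> Z (fst (shape l ! q)) then (\<sigma>, 0) else z)) (f (fst (shape l ! q))) = snd (shape l ! q)) \<longleftrightarrow>
        obeys S l (w (\<sigma>, 0))" for w
      proof -
        have "(\<lambda>z. ((W l)(0 := \<lambda>_. a', 1 := w)) (if z \<in> Z j then 1 else 2 * q + 4) (if z \<in> Z j then (\<sigma>, 0) else z)) =
            override_on (fst (snd (l ! q))) (\<lambda>_. w (\<sigma>, 0)) (Z j)" for q j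
          using W(2)[of l q] by (auto simp: override_on_def)
        then show ?thesis
          unfolding obeys_def S_def by (auto simp: shape_def all_set_conv_all_nth split_beta)
      qed
      have 3: "sat U (\<lambda>z. ((W l)(0 := \<lambda>_. a', 1 := w)) (if z \<in> Zc then 1 else if fst (dec z) = 0 then 0 else 2)
        (if z \<in> Zc then (\<sigma>, 0) else z)) \<phi> \<longleftrightarrow> S i (w (\<sigma>, 0)) (va a')" for w
        unfolding S_def i by (rule sat_cong) (use W(1)[of l] in \<open>auto simp: override_on_def va_def Zc_def\<close>)
      have "Qh (shape l) ((W l)(0 := \<lambda>_. a')) \<longleftrightarrow> \<not> (\<exists>w\<in>Vals {(\<sigma>, 0)}.
          (Q' (V'(0 := \<lambda>_. w (\<sigma>, 0))) \<and> obeys S l (w (\<sigma>, 0))) \<and> S i (w (\<sigma>, 0)) (va a'))"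
        unfolding Qh_def 1 2 3 ..
      also have "\<dots> \<longleftrightarrow> R a' l"
      proof
        assume h: "\<not> (\<exists>w\<in>Vals {(\<sigma>, 0)}. (Q' (V'(0 := \<lambda>_. w (\<sigma>, 0))) \<and> obeys S l (w (\<sigma>, 0))) \<and> S i (w (\<sigma>, 0)) (va a'))"
        show "R a' l"
          unfolding R_def
        proof (intro ballI impI)
          fix c' assume c': "c' \<in> \<Theta>" "obeys S l c'"
          then have "(\<lambda>_. c') \<in> Vals {(\<sigma>, 0)}" "Q' (V'(0 := \<lambda>_. c'))" using T'(5) by (auto simp: Vals_def)
          then show "\<not> S i c' (va a')" using h c'(2) by auto
        qed
      next
        assume "R a' l"
        moreover have "w (\<sigma>, 0) \<in> \<Theta>" if "w \<in> Vals {(\<sigma>, 0)}" "Q' (V'(0 := \<lambda>_. w (\<sigma>, 0)))" for w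
          using that T'(5) by (simp add: Vals_def)
        ultimately show "\<not> (\<exists>w\<in>Vals {(\<sigma>, 0)}. (Q' (V'(0 := \<lambda>_. w (\<sigma>, 0))) \<and> obeys S l (w (\<sigma>, 0))) \<and> S i (w (\<sigma>, 0)) (va a'))"
          unfolding R_def by blast
      qed
      finally show ?thesis .
    qed
    \<comment> \<open>Without a finite cover there would be an order between elements of
      \<open>N\<close> and lists. On an infinite subsequence of constant shape it is an order for
      one formula with one side in \<open>X\<close>, which \<open>no_order_df\<close>
      excludes.\<close>
    have "\<exists>E0\<subseteq>LL. finite E0 \<and> (\<forall>a'\<in>N. \<exists>l\<in>E0. R a' l)"
    proof (rule cover_or_order[OF fin])
      fix aa :: "nat \<Rightarrow> 'a" and ll
      assume aa: "\<And>i. aa i \<in> N" and ll: "\<And>i. ll i \<in> LL" and ord: "\<And>i j. R (aa i) (ll j) \<longleftrightarrow> i < j"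
      have "finite {h :: (nat \<times> bool) list. set h \<subseteq> {..i} \<times> UNIV \<and> length h \<le> K}"
        by (rule finite_lists_length_le) simp
      moreover have "range (\<lambda>k. shape (ll k)) \<subseteq> {h. set h \<subseteq> {..i} \<times> UNIV \<and> length h \<le> K}"
        using ll by (fastforce simp: LL_def shape_def)
      ultimately have "finite (range (\<lambda>k. shape (ll k)))" by (rule finite_subset[rotated])
      then obtain k0 where k0: "infinite {k. shape (ll k) = shape (ll k0)}"
        using pigeonhole_infinite[of UNIV "\<lambda>k. shape (ll k)"] by auto
      define g where "g = enumerate {k. shape (ll k) = shape (ll k0)}"
      have g: "strict_mono g" "\<And>k. shape (ll (g k)) = shape (ll k0)"
        using k0 enumerate_in_set[OF k0] by (auto simp: g_def strict_mono_enumerate)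
      show False
      proof (rule no_order_df[OF dfQ[of "shape (ll k0)"], of 0 "\<lambda>k _. aa (g k)" "\<lambda>k. W (ll (g k))"])
        show "fst z = s" if "(0, z) \<in> Th (shape (ll k0))" for z
        proof -
          have "2 * t + 1 \<noteq> 0" "2 * t + 4 \<noteq> 0" for t :: nat by presburger+
          then show ?thesis using that unfolding Th_def by fastforce
        qed
        show "aa (g k) \<in> X" for k using aa N by auto
        show "W (ll (g j)) t z \<in> carr U (fst z)" if "(t, z) \<in> Th (shape (ll k0))" "t \<noteq> 0" for j t z
          using WB[OF ll, of t z "g j"] that g(2) BU by simp
        show "Qh (shape (ll k0)) ((W (ll (g j)))(0 := (\<lambda>_. aa (g k)))) \<longleftrightarrow> k < j" for k j
          using QhR[of "ll (g j)" "aa (g k)"] ord[of "g k" "g j"] g(2)[of j] strict_mono_less[OF g(1), of k j]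
          by simp
      qed
    qed
    then obtain E0 where E0: "E0 \<subseteq> LL" "finite E0" "\<forall>a'\<in>N. \<exists>l\<in>E0. R a' l" by blast
    have "dset B s {a'\<in>carr U s. \<not> R a' l}" if "l \<in> E0" for l
    proof (rule dsetI[OF df_not[OF dfQ[of "shape l"]], of _ "W l"])
      show "fst z = s" if "(0, z) \<in> Th (shape l)" for z
      proof -
        have "2 * t + 1 \<noteq> 0" "2 * t + 4 \<noteq> 0" for t :: nat by presburger+
        then show ?thesis using that unfolding Th_def by fastforce
      qed
      show "(fst z, W l t z) \<in> B" if "(t, z) \<in> Th (shape l)" "t \<noteq> 0" for t z
        using WB that \<open>l \<in> E0\<close> E0(1) by blast
    qed (simp add: QhR)
    \<comment> \<open>The elements excluded by no list of \<open>E0\<close> form a set definable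
      over \<open>B\<close>. It contains \<open>a\<close>, because \<open>c\<close> obeys every list
      of \<open>E0\<close> and has \<open>a\<close> in its set; so it intersects \<open>X\<close>,
      and hence \<open>N\<close>, contradicting the cover.\<close>
    then have "dset B s (carr U s \<inter> (\<Inter>l\<in>E0. {a'\<in>carr U s. \<not> R a' l}))"
      by (rule dset_INT[OF E0(2)])
    moreover have "\<not> R a l" if "l \<in> E0" for l
    proof
      assume "R a l"
      moreover have "obeys S l c" using that E0(1) by (auto simp: LL_def)
      moreover have "S i c (va a)" using a(1) SQ by (simp add: T(5))
      ultimately show False using c(1) by (auto simp: R_def)
    qed
    then have "(carr U s \<inter> (\<Inter>l\<in>E0. {a'\<in>carr U s. \<not> R a' l})) \<inter> X \<noteq> {}" using a(2) X_carr by blast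
    ultimately have "(carr U s \<inter> (\<Inter>l\<in>E0. {a'\<in>carr U s. \<not> R a' l})) \<inter> N \<noteq> {}"
      using m unfolding meets_def by blast
    then show False using E0(3) by blast
  qed
  then have "meets (insert (\<sigma>, c) B) N" unfolding meets_def by blast
  with c(1) show ?thesis by (rule that)
qed

end

section \<open>Closing off a set of parameters\<close>

lemma countable_ordLeq_infinite:
  assumes "countable A" "\<not> finite K"
  shows "|A| \<le>o |K|"
proof -
  have "|A| \<le>o |UNIV :: nat set|"
    using inj_on_to_nat_on[OF assms(1)] by (intro card_of_ordLeqI) auto
  then show ?thesis using assms(2) ordLeq_transitive by (auto simp: infinite_iff_card_of_nat)
qed

lemma card_of_lists_ordLeq:
  assumes K: "\<not> finite K" and S: "|S| \<le>o |K|"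
  shows "|lists S| \<le>o |K|"
proof -
  have len: "|{l\<in>lists S. length l = n}| \<le>o |K|" for n
  proof (induction n)
    case 0
    have "finite {l\<in>lists S. length l = 0}" by (rule finite_subset[of _ "{[]}"]) auto
    then show ?case using K by (intro countable_ordLeq_infinite countable_finite)
  next
    case (Suc n)
    have "{l\<in>lists S. length l = Suc n} \<subseteq> (\<lambda>(a, l). a # l) ` (SIGMA a:S. {l\<in>lists S. length l = n})"
    proof
      fix l assume "l \<in> {l\<in>lists S. length l = Suc n}"
      then show "l \<in> (\<lambda>(a, l). a # l) ` (SIGMA a:S. {l\<in>lists S. length l = n})"
        by (cases l) auto
    qed
    from card_of_mono1[OF this]
    have "|{l\<in>lists S. length l = Suc n}| \<le>o |SIGMA a:S. {l\<in>lists S. length l = n}|"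
      using card_of_image ordLeq_transitive by blast
    also have "|SIGMA a:S. {l\<in>lists S. length l = n}| \<le>o |K|"
      by (rule card_of_Sigma_ordLeq_infinite[OF K S]) (simp add: Suc)
    finally show ?case .
  qed
  have "lists S = (\<Union>n. {l\<in>lists S. length l = n})" by auto
  moreover have "|\<Union>n. {l\<in>lists S. length l = n}| \<le>o |K|"
    using K len by (intro card_of_UNION_ordLeq_infinite) (auto simp: infinite_iff_card_of_nat)
  ultimately show ?thesis by simp
qed

context stable_set
begin

text \<open>A definable set is coded by a formula, its sort and a finite list of parameters.
  Non-emptiness confines the sort to the countable set \<open>sorts L\<close>.\<close>

lemma card_of_dsets:
  assumes cl: "countable_lang L" and K: "\<not> finite K" "|B| \<le>o |K|"
  shows "|{(\<sigma>, A). dset B \<sigma> A \<and> A \<noteq> {}}| \<le>o |K|"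
proof -
  define xs where "xs \<phi> = (SOME xs. set xs = {x\<in>fv \<phi>. fst (dec x) \<noteq> 0})" for \<phi> :: "('s, 'f, 'r) fm"
  have xs: "set (xs \<phi>) = {x\<in>fv \<phi>. fst (dec x) \<noteq> 0}" for \<phi>
  proof -
    have "\<exists>xs. set xs = {x\<in>fv \<phi>. fst (dec x) \<noteq> 0}" using finite_fv[of \<phi>] by (intro finite_list) simp
    then show ?thesis unfolding xs_def by (rule someI_ex)
  qed
  define code where "code = (\<lambda>(\<phi>, \<sigma>, ps). (\<sigma>, {a\<in>carr U \<sigma>. sat U (\<lambda>x. if fst (dec x) = 0 then a
      else the (map_of (zip (xs \<phi>) ps) x)) \<phi>}))"
  define H where "H = (SIGMA \<phi>:{\<phi>. wf_fm L \<phi>}. SIGMA \<sigma>:sorts L. lists (snd ` B))"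
  have "{(\<sigma>, A). dset B \<sigma> A \<and> A \<noteq> {}} \<subseteq> code ` H"
  proof (clarsimp simp del: image_iff)
    fix \<sigma> A assume A: "dset B \<sigma> A" "A \<noteq> {}"
    obtain T Q V where T: "finite T" "df T Q" "\<forall>z. (0, z) \<in> T \<longrightarrow> fst z = \<sigma>"
      "\<forall>t z. (t, z) \<in> T \<longrightarrow> t \<noteq> 0 \<longrightarrow> (fst z, V t z) \<in> B"
      "A = {a\<in>carr U \<sigma>. Q (V(0 := \<lambda>_. a))}"
      by (rule dsetE[OF A(1)])
    obtain \<phi> where \<phi>: "wf_fm L \<phi>" "fv \<phi> \<subseteq> enc ` T" "Q = (\<lambda>V. sat U (untag V) \<phi>)"
      using T(2) by (rule dfE)
    have "sat U (untag (V(0 := \<lambda>_. a))) \<phi> = sat U (\<lambda>x. if fst (dec x) = 0 then a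
      else the (map_of (zip (xs \<phi>) (map (untag V) (xs \<phi>))) x)) \<phi>" for a
      by (rule sat_cong) (auto simp: map_of_zip_map xs untag_def)
    then have "code (\<phi>, \<sigma>, map (untag V) (xs \<phi>)) = (\<sigma>, A)"
      by (simp add: code_def T(5) \<phi>(3))
    moreover have "untag V x \<in> snd ` B" if x: "x \<in> set (xs \<phi>)" for x
    proof -
      obtain t z where "x = enc (t, z)" "(t, z) \<in> T" using x \<phi>(2) xs by auto
      then have "(fst z, untag V x) \<in> B" using x xs T(4)[rule_format, of t z] by simp
      then show ?thesis by force
    qed
    moreover have "\<sigma> \<in> sorts L" using A(2) T(5) is_struct by (auto simp: is_struct_def)
    ultimately show "(\<sigma>, A) \<in> code ` H"
      using \<phi>(1) by (intro image_eqI[where x = "(\<phi>, \<sigma>, map (untag V) (xs \<phi>))"]) (auto simp: H_def)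
  qed
  from card_of_mono1[OF this] have "|{(\<sigma>, A). dset B \<sigma> A \<and> A \<noteq> {}}| \<le>o |H|"
    using card_of_image ordLeq_transitive by blast
  also have "|H| \<le>o |K|"
    unfolding H_def
  proof (intro card_of_Sigma_ordLeq_infinite K(1) ballI)
    show "|{\<phi>. wf_fm L \<phi>}| \<le>o |K|" by (rule countable_ordLeq_infinite[OF countable_wf_fm[OF cl] K(1)])
    show "|sorts L| \<le>o |K|" using cl K(1) by (intro countable_ordLeq_infinite) (simp add: countable_lang_def)
    show "|lists (snd ` B)| \<le>o |K|"
      using card_of_lists_ordLeq[OF K(1)] ordLeq_transitive[OF card_of_image K(2)] by blast
  qed
  finally show ?thesis .
qed

lemma meets_Union_chain:
  assumes "subset.chain AA C" "C \<noteq> {}" "\<And>B. B \<in> C \<Longrightarrow> meets B N"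
  shows "meets (\<Union>C) N"
  unfolding meets_def
proof (intro allI impI)
  fix A assume A: "dset (\<Union>C) s A" "A \<inter> X \<noteq> {}"
  obtain B0 where B0: "finite B0" "B0 \<subseteq> \<Union>C" "dset B0 s A" using A(1) by (rule dset_finite_param)
  obtain B where "B \<in> C" "B0 \<subseteq> B" using finite_subset_Union_chain[OF B0(1,2) assms(2,1)] .
  then show "A \<inter> N \<noteq> {}" using assms(3) dset_mono[OF B0(3)] A(2) unfolding meets_def by blast
qed

text \<open>Zorn's lemma for partial choice functions on the non-empty \<open>B\<close>-definable
  sets whose values keep \<open>N\<close> met. There are at most as many such sets as elements of
  \<open>K\<close>, so the enlarged parameter set stays small, and \<open>extension\<close> can
  prolong any function that is not yet total.\<close>

lemma closure_step:
  assumes cl: "countable_lang L" and K: "\<not> finite K" "|K| <o |elements U|"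
    and m: "meets B N" and B: "{s} \<times> N \<subseteq> B" "B \<subseteq> elements U" "|B| \<le>o |K|" and N: "N \<subseteq> X"
  shows "\<exists>B'. B \<subseteq> B' \<and> B' \<subseteq> elements U \<and> |B'| \<le>o |K| \<and> meets B' N \<and>
    (\<forall>\<sigma> A. dset B \<sigma> A \<longrightarrow> A \<noteq> {} \<longrightarrow> (\<exists>a\<in>A. (\<sigma>, a) \<in> B'))"
proof -
  define J where "J = {(\<sigma>, A). dset B \<sigma> A \<and> A \<noteq> {}}"
  \<comment> \<open>A choice function is represented by its graph \<open>G\<close>, whose first
    components are pairs of a sort and a set; \<open>w\<close> keeps the sort and the chosen
    element.\<close>
  define w where "w G = (\<lambda>(j, a). (fst j, a)) ` G" for G :: "(('s \<times> 'a set) \<times> 'a) set"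
  define GG where "GG = {G. fst ` G \<subseteq> J \<and> inj_on fst G \<and> (\<forall>(j, a)\<in>G. a \<in> snd j) \<and> meets (B \<union> w G) N}"
  have GGI: "G \<in> GG \<longleftrightarrow> fst ` G \<subseteq> J \<and> inj_on fst G \<and> (\<forall>e\<in>G. snd e \<in> snd (fst e)) \<and> meets (B \<union> w G) N" for G
    by (auto simp: GG_def)
  have "\<exists>G\<in>GG. \<forall>G'\<in>GG. G \<subseteq> G' \<longrightarrow> G' = G"
  proof (rule subset_Zorn')
    fix C assume C: "subset.chain GG C"
    then have sub: "C \<subseteq> GG" and lin: "\<And>G G'. G \<in> C \<Longrightarrow> G' \<in> C \<Longrightarrow> G \<subseteq> G' \<or> G' \<subseteq> G"
      by (auto simp: subset_chain_def)
    have "inj_on fst (\<Union>C)"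
    proof (rule inj_onI)
      fix e e' assume "e \<in> \<Union>C" "e' \<in> \<Union>C" and eq: "fst e = fst e'"
      then obtain G G' where "G \<in> C" "e \<in> G" "G' \<in> C" "e' \<in> G'" by blast
      with lin have "\<exists>G\<in>C. e \<in> G \<and> e' \<in> G" by blast
      then obtain G where "G \<in> GG" "e \<in> G" "e' \<in> G" using sub by blast
      then show "e = e'" using eq GGI[of G] by (auto dest: inj_onD)
    qed
    moreover have "meets (B \<union> w (\<Union>C)) N"
    proof (cases "C = {}")
      case True
      then show ?thesis using m by (simp add: w_def)
    next
      case False
      have "subset.chain UNIV ((\<lambda>G. B \<union> w G) ` C)"
      proof -
        have "B \<union> w G \<subseteq> B \<union> w G' \<or> B \<union> w G' \<subseteq> B \<union> w G" if "G \<in> C" "G' \<in> C" for G G'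
          using lin[OF that] by (auto simp: w_def)
        then show ?thesis unfolding subset_chain_def by blast
      qed
      then have "meets (\<Union>((\<lambda>G. B \<union> w G) ` C)) N"
        by (rule meets_Union_chain) (use False sub GGI in auto)
      moreover have "\<Union>((\<lambda>G. B \<union> w G) ` C) = B \<union> w (\<Union>C)" using False by (auto simp: w_def)
      ultimately show ?thesis by simp
    qed
    moreover have "fst ` \<Union>C \<subseteq> J"
    proof
      fix p assume "p \<in> fst ` \<Union>C"
      then obtain e G where "p = fst e" "e \<in> G" "G \<in> C" by blast
      moreover from this have "fst ` G \<subseteq> J" using sub GGI by blast
      ultimately show "p \<in> J" by blast
    qed
    moreover have "\<forall>e\<in>\<Union>C. snd e \<in> snd (fst e)" using sub GGI by blast
    ultimately show "\<Union>C \<in> GG" unfolding GGI by blast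
  qed
  then obtain G where G: "G \<in> GG" and max: "\<And>G'. G' \<in> GG \<Longrightarrow> G \<subseteq> G' \<Longrightarrow> G' = G" by blast
  have GJ: "fst ` G \<subseteq> J" "inj_on fst G" "\<And>e. e \<in> G \<Longrightarrow> snd e \<in> snd (fst e)" "meets (B \<union> w G) N"
    using G unfolding GGI by blast+
  have 1: "|J| \<le>o |K|" unfolding J_def by (rule card_of_dsets[OF cl K(1) B(3)])
  have 2: "|G| \<le>o |J|" using GJ(1,2) by (intro card_of_ordLeqI[of fst]) auto
  have 3: "|w G| \<le>o |G|" unfolding w_def by (rule card_of_image)
  have wG: "|w G| \<le>o |K|" by (rule ordLeq_transitive[OF 3 ordLeq_transitive[OF 2 1]])
  have card: "|B \<union> w G| \<le>o |K|"
  proof -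
    have "|\<Union>b\<in>(UNIV :: bool set). if b then B else w G| \<le>o |K|"
      using B(3) wG K(1)
      by (intro card_of_UNION_ordLeq_infinite) (auto intro: countable_ordLeq_infinite countable_finite)
    moreover have "(\<Union>b\<in>(UNIV :: bool set). if b then B else w G) = B \<union> w G" by (auto split: if_splits)
    ultimately show ?thesis by simp
  qed
  have dU: "A \<subseteq> carr U \<sigma>" if "dset B \<sigma> A" for \<sigma> A using that by (auto simp: dset_def)
  have wU: "w G \<subseteq> elements U"
  proof
    fix p assume "p \<in> w G"
    then obtain e where e: "e \<in> G" "p = (fst (fst e), snd e)" by (auto simp: w_def)
    then have "dset B (fst (fst e)) (snd (fst e))" using GJ(1) by (auto simp: J_def)
    from dU[OF this] show "p \<in> elements U" using GJ(3)[OF e(1)] e(2) by (auto simp: elements_def)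
  qed
  have "\<exists>a\<in>A. (\<sigma>, a) \<in> B \<union> w G" if A: "dset B \<sigma> A" "A \<noteq> {}" for \<sigma> A
  proof (cases "(\<sigma>, A) \<in> fst ` G")
    case True
    then obtain a where "((\<sigma>, A), a) \<in> G" by auto
    moreover from this have "a \<in> A" using GJ(3) by fastforce
    ultimately show ?thesis by (force simp: w_def)
  next
    case False
    have small: "small U (B \<union> w G)" using ordLeq_ordLess_trans[OF card K(2)] by (simp add: small_def)
    obtain c where c: "c \<in> A" "meets (insert (\<sigma>, c) (B \<union> w G)) N"
    proof (rule extension[OF cl GJ(4) _ _ small N])
      show "{s} \<times> N \<subseteq> B \<union> w G" using B(1) by blast
      show "B \<union> w G \<subseteq> elements U" using B(2) wU by blast
      show "dset (B \<union> w G) \<sigma> A" by (rule dset_mono[OF A(1)]) simp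
    qed (use A(2) in auto)
    let ?G = "insert ((\<sigma>, A), c) G"
    have "insert (\<sigma>, c) (B \<union> w G) = B \<union> w ?G" by (auto simp: w_def)
    then have "meets (B \<union> w ?G) N" using c(2) by simp
    moreover have "inj_on fst ?G" using GJ(2) False by (auto simp: inj_on_def image_iff)
    moreover have "fst ` ?G \<subseteq> J" using GJ(1) A by (auto simp: J_def)
    moreover have "\<forall>e\<in>?G. snd e \<in> snd (fst e)" using GJ(3) c(1) by simp
    ultimately have "?G \<in> GG" unfolding GGI by blast
    then have "?G = G" by (rule max) blast
    then show ?thesis using False by (metis fst_conv image_eqI insertI1)
  qed
  then show ?thesis using card B(2) wU GJ(4) by (intro exI[of _ "B \<union> w G"]) auto
qed

text \<open>The new elements give rise to new definable sets, so the step is iterated. The natural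
  numbers suffice: a set definable over the union has finitely many parameters and is served at the
  step after these have all appeared.\<close>

lemma closure:
  assumes cl: "countable_lang L"
    and m: "meets B N" and B: "{s} \<times> N \<subseteq> B" "B \<subseteq> elements U" "small U B" and N: "N \<subseteq> X"
  obtains B' where "B \<subseteq> B'" "B' \<subseteq> elements U" "small U B'" "meets B' N"
    "\<forall>\<sigma> A. dset B' \<sigma> A \<longrightarrow> A \<noteq> {} \<longrightarrow> (\<exists>a\<in>A. (\<sigma>, a) \<in> B')"
proof -
  \<comment> \<open>The summand of natural numbers makes the bound infinite even for finite
    \<open>B\<close>; as the same \<open>K\<close> bounds every stage, it also bounds the countable
    union.\<close>
  define K where "K = B <+> (UNIV :: nat set)"
  have infU: "\<not> finite (elements U)" using unc countable_finite by blast
  have K: "\<not> finite K" by (simp add: K_def)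
  have "small U (UNIV :: nat set)" by (rule small_countable[OF _ unc]) simp
  then have Ksmall: "|K| <o |elements U|"
    unfolding K_def using B(3) infU by (intro card_of_Plus_ordLess_infinite) (simp_all add: small_def)
  define P where "P B' \<longleftrightarrow> B \<subseteq> B' \<and> B' \<subseteq> elements U \<and> |B'| \<le>o |K| \<and> meets B' N" for B'
  define Q where "Q B1 B2 \<longleftrightarrow> B1 \<subseteq> B2 \<and> (\<forall>\<sigma> A. dset B1 \<sigma> A \<longrightarrow> A \<noteq> {} \<longrightarrow> (\<exists>a\<in>A. (\<sigma>, a) \<in> B2))" for B1 B2
  have "\<exists>f. \<forall>n :: nat. P (f n) \<and> Q (f n) (f (Suc n))"
  proof (rule dependent_nat_choice)
    have "P B" using m B(2) by (simp add: P_def K_def card_of_Plus1)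
    then show "\<exists>x. P x" by (rule exI)
  next
    fix B1 and n :: nat assume P: "P B1"
    then have "\<exists>B'. B1 \<subseteq> B' \<and> B' \<subseteq> elements U \<and> |B'| \<le>o |K| \<and> meets B' N \<and>
      (\<forall>\<sigma> A. dset B1 \<sigma> A \<longrightarrow> A \<noteq> {} \<longrightarrow> (\<exists>a\<in>A. (\<sigma>, a) \<in> B'))"
      using B(1) by (intro closure_step[OF cl K Ksmall _ _ _ _ N]) (auto simp: P_def)
    then show "\<exists>y. P y \<and> Q B1 y" using P by (auto simp: P_def Q_def)
  qed
  then obtain f where f: "\<And>n :: nat. P (f n)" "\<And>n. Q (f n) (f (Suc n))" by blast
  have mono: "f i \<subseteq> f j" if "i \<le> j" for i j
    using lift_Suc_mono_le[of f i j] f(2) that by (simp add: Q_def)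
  have chain: "subset.chain UNIV (range f)"
    unfolding subset_chain_def using mono by (auto) (metis nat_le_linear subsetD)
  let ?B = "\<Union>(range f)"
  show ?thesis
  proof (rule that)
    show "B \<subseteq> ?B" using f(1)[of 0] by (auto simp: P_def)
    show "?B \<subseteq> elements U" using f(1) by (auto simp: P_def)
    have "|\<Union>n\<in>UNIV. f n| \<le>o |K|"
      using f(1) K by (intro card_of_UNION_ordLeq_infinite) (auto simp: P_def infinite_iff_card_of_nat)
    then show "small U ?B" using ordLeq_ordLess_trans[OF _ Ksmall] by (simp add: small_def)
    show "meets ?B N"
      by (rule meets_Union_chain[OF chain]) (use f(1) in \<open>auto simp: P_def\<close>)
    show "\<forall>\<sigma> A. dset ?B \<sigma> A \<longrightarrow> A \<noteq> {} \<longrightarrow> (\<exists>a\<in>A. (\<sigma>, a) \<in> ?B)"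
    proof (intro allI impI)
      fix \<sigma> A assume A: "dset ?B \<sigma> A" "A \<noteq> {}"
      obtain B0 where B0: "finite B0" "B0 \<subseteq> ?B" "dset B0 \<sigma> A" using A(1) by (rule dset_finite_param)
      obtain B1 where "B1 \<in> range f" "B0 \<subseteq> B1"
        using finite_subset_Union_chain[OF B0(1,2) _ chain] by blast
      then obtain n where "dset (f n) \<sigma> A" using dset_mono[OF B0(3)] by blast
      then have "\<exists>a\<in>A. (\<sigma>, a) \<in> f (Suc n)" using f(2)[of n] A(2) unfolding Q_def by blast
      then show "\<exists>a\<in>A. (\<sigma>, a) \<in> ?B" by blast
    qed
  qed
qed

end

section \<open>Constants and elementary substructures\<close>

lemma finite_set2_tm: "finite (set2_tm t)"
  by (induction t) auto

lemma finite_set2_fm: "finite (set2_fm \<phi>)"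
  by (induction \<phi>) (auto simp: finite_set2_tm)

text \<open>Replacing the constants by variables: the variables go to copy 0 and the constant \<open>p\<close> becomes
  the variable number \<open>\<kappa> p\<close> of its sort in copy 1.\<close>

primrec elim_tm :: "('s \<times> 'a \<Rightarrow> nat) \<Rightarrow> ('s, 'f + 's \<times> 'a) tm \<Rightarrow> ('s, 'f) tm" where
  "elim_tm \<kappa> (Var x) = Var (enc (0, x))"
| "elim_tm \<kappa> (Fn f ts) = (case f of Inl f \<Rightarrow> Fn f (map (elim_tm \<kappa>) ts)
     | Inr p \<Rightarrow> Var (enc (1, (fst p, \<kappa> p))))"

primrec elim_fm :: "('s \<times> 'a \<Rightarrow> nat) \<Rightarrow> ('s, 'f + 's \<times> 'a, 'r) fm \<Rightarrow> ('s, 'f, 'r) fm" where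
  "elim_fm \<kappa> Bot = Bot"
| "elim_fm \<kappa> (Eq t u) = Eq (elim_tm \<kappa> t) (elim_tm \<kappa> u)"
| "elim_fm \<kappa> (Rel r ts) = Rel r (map (elim_tm \<kappa>) ts)"
| "elim_fm \<kappa> (Neg \<phi>) = Neg (elim_fm \<kappa> \<phi>)"
| "elim_fm \<kappa> (Conj \<phi> \<psi>) = Conj (elim_fm \<kappa> \<phi>) (elim_fm \<kappa> \<psi>)"
| "elim_fm \<kappa> (Ex x \<phi>) = Ex (enc (0, x)) (elim_fm \<kappa> \<phi>)"

lemma untag_case_upd:
  fixes v :: "'s var \<Rightarrow> 'a"
  shows "untag (\<lambda>t. if t = 0 then v(x := a) else Vp) = (untag (\<lambda>t. if t = 0 then v else Vp))(enc (0, x) := a)"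
proof
  fix y :: "'s var"
  obtain i where y: "y = enc i" using enc_dec[of y] by metis
  have "enc i = enc (0, x) \<longleftrightarrow> i = (0, x)" by (metis dec_enc)
  then show "untag (\<lambda>t. if t = 0 then v(x := a) else Vp) y =
      ((untag (\<lambda>t. if t = 0 then v else Vp))(enc (0, x) := a)) y"
    by (cases i) (auto simp: y)
qed

context fo_structure
begin

context
  fixes P :: "('s \<times> 'a) set" and \<kappa> :: "'s \<times> 'a \<Rightarrow> nat" and Vp :: "'s var \<Rightarrow> 'a" and C :: "('s \<times> 'a) set"
  assumes P: "P \<subseteq> elements U" and Vp: "\<And>p. p \<in> C \<Longrightarrow> Vp (fst p, \<kappa> p) = snd p"
begin

lemma elim_tm:
  "has_sort (const_lang L P) t \<sigma> \<Longrightarrow> Inr -` set2_tm t \<subseteq> C \<Longrightarrow>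
    has_sort L (elim_tm \<kappa> t) \<sigma> \<and>
    tm_vars (elim_tm \<kappa> t) \<subseteq> enc ` ({0} \<times> tm_vars t \<union> {1} \<times> (\<lambda>p. (fst p, \<kappa> p)) ` (C \<inter> P)) \<and>
    (\<forall>v. eval U (untag (\<lambda>t. if t = 0 then v else Vp)) (elim_tm \<kappa> t) = eval (const_struct U P) v t)"
proof (induction rule: has_sort.induct)
  case (1 x)
  then show ?case
    using has_sort.intros(1)[of "enc (0, x)" L] by (simp add: fst_enc const_lang_def)
next
  case (2 f ts)
  show ?case
  proof (cases f)
    case (Inl g)
    then have g: "g \<in> funs L" "fun_args (const_lang L P) f = fun_args L g" "fun_res (const_lang L P) f = fun_res L g"
      using 2(1) by (auto simp: const_lang_def)
    have IH: "has_sort L (elim_tm \<kappa> (ts ! i)) (fun_args L g ! i) \<and>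
        tm_vars (elim_tm \<kappa> (ts ! i)) \<subseteq> enc ` ({0} \<times> tm_vars (ts ! i) \<union> {1} \<times> (\<lambda>p. (fst p, \<kappa> p)) ` (C \<inter> P)) \<and>
        (\<forall>v. eval U (untag (\<lambda>t. if t = 0 then v else Vp)) (elim_tm \<kappa> (ts ! i)) = eval (const_struct U P) v (ts ! i))"
      if i: "i < length ts" for i
    proof -
      have "Inr -` set2_tm (ts ! i) \<subseteq> C" using 2(3) nth_mem[OF i] by auto
      then show ?thesis using 2(2) i unfolding g list_all2_conv_all_nth by simp
    qed
    have len: "length ts = length (fun_args L g)" using 2(2) unfolding g by (simp add: list_all2_conv_all_nth)
    have "has_sort L (Fn g (map (elim_tm \<kappa>) ts)) (fun_res L g)"
      by (rule has_sort.intros(2)[OF g(1)]) (use IH len in \<open>simp add: list_all2_conv_all_nth\<close>)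
    moreover have "tm_vars (Fn g (map (elim_tm \<kappa>) ts)) \<subseteq>
        enc ` ({0} \<times> tm_vars (Fn f ts) \<union> {1} \<times> (\<lambda>p. (fst p, \<kappa> p)) ` (C \<inter> P))"
    proof
      fix x assume "x \<in> tm_vars (Fn g (map (elim_tm \<kappa>) ts))"
      then obtain i where i: "i < length ts" "x \<in> tm_vars (elim_tm \<kappa> (ts ! i))"
        by (auto simp: in_set_conv_nth)
      then have "x \<in> enc ` ({0} \<times> tm_vars (ts ! i) \<union> {1} \<times> (\<lambda>p. (fst p, \<kappa> p)) ` (C \<inter> P))" using IH by blast
      then show "x \<in> enc ` ({0} \<times> tm_vars (Fn f ts) \<union> {1} \<times> (\<lambda>p. (fst p, \<kappa> p)) ` (C \<inter> P))"
        using nth_mem[OF i(1)] by auto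
    qed
    moreover have "map (eval U (untag (\<lambda>t. if t = 0 then v else Vp))) (map (elim_tm \<kappa>) ts) =
        map (eval (const_struct U P) v) ts" for v
      by (rule nth_equalityI) (use IH in auto)
    then have "\<forall>v. eval U (untag (\<lambda>t. if t = 0 then v else Vp)) (Fn g (map (elim_tm \<kappa>) ts)) =
        eval (const_struct U P) v (Fn f ts)"
      by (simp only: eval.simps) (simp add: Inl const_struct_def)
    ultimately show ?thesis unfolding g by (simp add: Inl)
  next
    case (Inr p)
    have p: "p \<in> P" "p \<in> C" "ts = []" "fun_res (const_lang L P) f = fst p"
      using 2 by (auto simp: Inr const_lang_def)
    then have "snd p \<in> carr U (fst p)" using P by (auto simp: elements_def)
    then have "fst p \<in> sorts L" using is_struct by (auto simp: is_struct_def)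
    then have "has_sort L (Var (enc (1, (fst p, \<kappa> p)))) (fst p)"
      using has_sort.intros(1)[of "enc (1, (fst p, \<kappa> p))" L] by (simp add: fst_enc)
    then show ?thesis
      unfolding p(4) using p Vp[OF p(2)] by (auto simp: Inr const_struct_def)
  qed
qed

lemma elim_fm:
  defines "E \<equiv> \<lambda>A. enc ` ({0} \<times> A \<union> {1} \<times> (\<lambda>p. (fst p, \<kappa> p)) ` (C \<inter> P))"
  shows "wf_fm (const_lang L P) \<phi> \<Longrightarrow> Inr -` set2_fm \<phi> \<subseteq> C \<Longrightarrow>
    wf_fm L (elim_fm \<kappa> \<phi>) \<and>
    fv (elim_fm \<kappa> \<phi>) \<subseteq> E (fv \<phi>) \<and>
    (\<forall>v. sat U (untag (\<lambda>t. if t = 0 then v else Vp)) (elim_fm \<kappa> \<phi>) \<longleftrightarrow> sat (const_struct U P) v \<phi>)"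
proof (induction \<phi>)
  case Bot
  then show ?case by simp
next
  case (Eq t u)
  then obtain \<sigma> where "has_sort (const_lang L P) t \<sigma>" "has_sort (const_lang L P) u \<sigma>" by auto
  moreover have "Inr -` set2_tm t \<subseteq> C" "Inr -` set2_tm u \<subseteq> C"
    using Eq.prems(2) by (auto simp: vimage_def subset_iff)
  ultimately have t: "has_sort L (elim_tm \<kappa> t) \<sigma>" "tm_vars (elim_tm \<kappa> t) \<subseteq> E (tm_vars t)"
      "\<forall>v. eval U (untag (\<lambda>t. if t = 0 then v else Vp)) (elim_tm \<kappa> t) = eval (const_struct U P) v t"
    and u: "has_sort L (elim_tm \<kappa> u) \<sigma>" "tm_vars (elim_tm \<kappa> u) \<subseteq> E (tm_vars u)"
      "\<forall>v. eval U (untag (\<lambda>t. if t = 0 then v else Vp)) (elim_tm \<kappa> u) = eval (const_struct U P) v u"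
    using elim_tm[of t \<sigma>] elim_tm[of u \<sigma>] by (simp_all add: E_def)
  have Em: "E A \<subseteq> E A'" if "A \<subseteq> A'" for A A' using that by (auto simp: E_def)
  have "fv (elim_fm \<kappa> (Eq t u)) \<subseteq> E (fv (Eq t u))"
    using order_trans[OF t(2) Em[of "tm_vars t" "fv (Eq t u)"]]
      order_trans[OF u(2) Em[of "tm_vars u" "fv (Eq t u)"]] by simp
  moreover have "wf_fm L (elim_fm \<kappa> (Eq t u))" using t(1) u(1) by auto
  ultimately show ?case using t(3) u(3) by simp
next
  case (Rel r ts)
  have r: "r \<in> rels L" "list_all2 (has_sort (const_lang L P)) ts (rel_args L r)"
    using Rel.prems(1) by (auto simp: const_lang_def)
  have IH: "has_sort L (elim_tm \<kappa> (ts ! i)) (rel_args L r ! i) \<and>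
      tm_vars (elim_tm \<kappa> (ts ! i)) \<subseteq> enc ` ({0} \<times> tm_vars (ts ! i) \<union> {1} \<times> (\<lambda>p. (fst p, \<kappa> p)) ` (C \<inter> P)) \<and>
      (\<forall>v. eval U (untag (\<lambda>t. if t = 0 then v else Vp)) (elim_tm \<kappa> (ts ! i)) = eval (const_struct U P) v (ts ! i))"
    if i: "i < length ts" for i
  proof (rule elim_tm)
    show "Inr -` set2_tm (ts ! i) \<subseteq> C" using Rel.prems(2) nth_mem[OF i] by auto
    show "has_sort (const_lang L P) (ts ! i) (rel_args L r ! i)" using r(2) i by (simp add: list_all2_conv_all_nth)
  qed
  have "list_all2 (has_sort L) (map (elim_tm \<kappa>) ts) (rel_args L r)"
    using IH r(2) by (simp add: list_all2_conv_all_nth)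
  moreover have "fv (elim_fm \<kappa> (Rel r ts)) \<subseteq> E (fv (Rel r ts))"
    unfolding E_def
  proof
    fix x assume "x \<in> fv (elim_fm \<kappa> (Rel r ts))"
    then obtain i where i: "i < length ts" "x \<in> tm_vars (elim_tm \<kappa> (ts ! i))"
      by (auto simp: in_set_conv_nth)
    then have "x \<in> enc ` ({0} \<times> tm_vars (ts ! i) \<union> {1} \<times> (\<lambda>p. (fst p, \<kappa> p)) ` (C \<inter> P))" using IH by blast
    then show "x \<in> enc ` ({0} \<times> fv (Rel r ts) \<union> {1} \<times> (\<lambda>p. (fst p, \<kappa> p)) ` (C \<inter> P))"
      using nth_mem[OF i(1)] by auto
  qed
  moreover have "map (eval U (untag (\<lambda>t. if t = 0 then v else Vp))) (map (elim_tm \<kappa>) ts) =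
      map (eval (const_struct U P) v) ts" for v
    by (rule nth_equalityI) (use IH in auto)
  then have "\<forall>v. sat U (untag (\<lambda>t. if t = 0 then v else Vp)) (elim_fm \<kappa> (Rel r ts)) \<longleftrightarrow>
      sat (const_struct U P) v (Rel r ts)"
    by (simp only: elim_fm.simps sat.simps) (simp add: const_struct_def)
  ultimately show ?case using r(1) by simp
next
  case (Neg \<phi>)
  then show ?case by simp
next
  case (Conj \<phi> \<psi>)
  have "wf_fm (const_lang L P) \<phi>" "wf_fm (const_lang L P) \<psi>" "Inr -` set2_fm \<phi> \<subseteq> C" "Inr -` set2_fm \<psi> \<subseteq> C"
    using Conj.prems by auto
  note 1 = Conj.IH(1)[OF this(1,3)] and 2 = Conj.IH(2)[OF this(2,4)]
  have Em: "E A \<subseteq> E A'" if "A \<subseteq> A'" for A A' using that by (auto simp: E_def)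
  have "fv (elim_fm \<kappa> (Conj \<phi> \<psi>)) \<subseteq> E (fv (Conj \<phi> \<psi>))"
    using order_trans[OF _ Em[of "fv \<phi>" "fv (Conj \<phi> \<psi>)"]] 1
      order_trans[OF _ Em[of "fv \<psi>" "fv (Conj \<phi> \<psi>)"]] 2 by simp
  then show ?case using 1 2 by simp
next
  case (Ex x \<phi>)
  have "wf_fm (const_lang L P) \<phi>" "Inr -` set2_fm \<phi> \<subseteq> C" "fst x \<in> sorts L"
    using Ex.prems by (auto simp: const_lang_def)
  note 1 = Ex.IH[OF this(1,2)] and 2 = this(3)
  have "fv (elim_fm \<kappa> (Ex x \<phi>)) \<subseteq> E (fv (Ex x \<phi>))"
  proof
    fix y assume "y \<in> fv (elim_fm \<kappa> (Ex x \<phi>))"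
    then have "y \<noteq> enc (0, x)" "y \<in> E (fv \<phi>)" using 1 by auto
    then show "y \<in> E (fv (Ex x \<phi>))" unfolding E_def by auto
  qed
  moreover have "carr (const_struct U P) = carr U" by (simp add: const_struct_def)
  ultimately show ?case
    using 1 2 by (simp add: untag_case_upd[symmetric] fst_enc del: fun_upd_apply)
qed

end

text \<open>Only finitely many constants occur in a formula, so \<open>to_nat_on\<close> gives each
  of them a variable number of its own, and \<open>from_nat_into\<close> recovers the constant's
  value from that number.\<close>

lemma df_of_const_formula:
  assumes P: "P \<subseteq> elements U" and \<phi>: "wf_fm (const_lang L P) \<phi>"
  obtains T Q Vp where "finite T" "df T Q" "T \<subseteq> {0} \<times> fv \<phi> \<union> {1} \<times> {z. (fst z, Vp z) \<in> P}"
    "\<forall>v. sat (const_struct U P) v \<phi> \<longleftrightarrow> Q (\<lambda>t. if t = 0 then v else Vp)"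
proof -
  define C where "C = Inr -` set2_fm \<phi>"
  have finC: "finite C" unfolding C_def by (intro finite_vimageI finite_set2_fm) simp
  define Vp where "Vp z = snd (from_nat_into C (snd z))" for z :: "'s var"
  have Vp: "Vp (fst p, to_nat_on C p) = snd p" if "p \<in> C" for p
    using that finC by (simp add: Vp_def countable_finite)
  let ?\<psi> = "elim_fm (to_nat_on C) \<phi>"
  have \<psi>: "wf_fm L ?\<psi>"
    "fv ?\<psi> \<subseteq> enc ` ({0} \<times> fv \<phi> \<union> {1} \<times> (\<lambda>p. (fst p, to_nat_on C p)) ` (C \<inter> P))"
    "\<forall>v. sat U (untag (\<lambda>t. if t = 0 then v else Vp)) ?\<psi> \<longleftrightarrow> sat (const_struct U P) v \<phi>"
    using elim_fm[where \<kappa> = "to_nat_on C" and Vp = Vp and C = C, OF P Vp \<phi>] unfolding C_def by blast+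
  show ?thesis
  proof (rule that)
    show "df ({0} \<times> fv \<phi> \<union> {1} \<times> (\<lambda>p. (fst p, to_nat_on C p)) ` (C \<inter> P)) (\<lambda>V. sat U (untag V) ?\<psi>)"
      by (rule dfI[OF \<psi>(1,2)]) simp
    show "\<forall>v. sat (const_struct U P) v \<phi> \<longleftrightarrow> sat U (untag (\<lambda>t. if t = 0 then v else Vp)) ?\<psi>"
      using \<psi>(3) by blast
    show "finite ({0} \<times> fv \<phi> \<union> {1} \<times> (\<lambda>p. (fst p, to_nat_on C p)) ` (C \<inter> P))"
      using finC finite_fv[of \<phi>] by simp
    show "{0} \<times> fv \<phi> \<union> {1} \<times> (\<lambda>p. (fst p, to_nat_on C p)) ` (C \<inter> P) \<subseteq>
        {0} \<times> fv \<phi> \<union> {1} \<times> {z. (fst z, Vp z) \<in> P}"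
      using Vp by auto
  qed
qed

text \<open>\<open>c\<close> selects the variables to be replaced by constants and \<open>y\<close>
  renames the others. Leaving the choice open allows parameters from \<open>F\<close> to be absorbed
  into the language while those from \<open>N\<close> remain variables.\<close>

lemma const_formula_of_df:
  assumes Q: "df T Q" and c: "\<And>t z. (t, z) \<in> T \<Longrightarrow> c t z \<Longrightarrow> (fst z, V t z) \<in> P"
    and y: "\<And>t z. (t, z) \<in> T \<Longrightarrow> \<not> c t z \<Longrightarrow> fst (y t z) = fst z"
  obtains \<psi> where "wf_fm (const_lang L P) \<psi>" "fv \<psi> \<subseteq> {y t z | t z. (t, z) \<in> T \<and> \<not> c t z}"
    "\<forall>v. sat (const_struct U P) v \<psi> \<longleftrightarrow> Q (\<lambda>t z. if c t z then V t z else v (y t z))"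
proof -
  let ?L = "const_lang L P" and ?U = "const_struct U P"
  obtain \<phi> where \<phi>: "wf_fm L \<phi>" "fv \<phi> \<subseteq> enc ` T" "Q = (\<lambda>V. sat U (untag V) \<phi>)"
    using Q by (rule dfE)
  define \<tau> :: "'s var \<Rightarrow> ('s, 'f + 's \<times> 'a) tm" where
    "\<tau> x = (let t = fst (dec x); z = snd (dec x) in
       if c t z then Fn (Inr (fst z, V t z)) [] else Var (y t z))" for x
  have T: "(fst (dec x), snd (dec x)) \<in> T" "fst (snd (dec x)) = fst x" if "x \<in> fv \<phi>" for x
    using \<phi>(2) that by (auto simp: fst_enc)
  have \<tau>: "has_sort ?L (\<tau> x) (fst x)" if x: "x \<in> fv \<phi>" for x
  proof (cases "c (fst (dec x)) (snd (dec x))")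
    case True
    then have "(fst x, V (fst (dec x)) (snd (dec x))) \<in> P" using c[OF T(1)[OF x]] T(2)[OF x] by simp
    then show ?thesis
      using has_sort.intros(2)[of "Inr (fst x, V (fst (dec x)) (snd (dec x)))" ?L "[]"] True T(2)[OF x]
      by (simp add: \<tau>_def const_lang_def)
  next
    case False
    then have "fst (y (fst (dec x)) (snd (dec x))) = fst x" using y[OF T(1)[OF x]] T(2)[OF x] by simp
    then show ?thesis
      using has_sort.intros(1)[of "y (fst (dec x)) (snd (dec x))" ?L] False wf_fm_vars[OF \<phi>(1)] x
      by (auto simp: \<tau>_def const_lang_def)
  qed
  have "\<exists>\<psi>. wf_fm ?L \<psi> \<and> fv \<psi> = (\<Union>x\<in>fv \<phi>. tm_vars (\<tau> x)) \<and>
      (\<forall>v. sat ?U v \<psi> \<longleftrightarrow> sat U (\<lambda>x. eval ?U v (\<tau> x)) \<phi>)"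
    by (rule embedding.translate[OF embedding_const \<phi>(1)]) (rule \<tau>)
  then obtain \<psi> where \<psi>: "wf_fm ?L \<psi>" "fv \<psi> = (\<Union>x\<in>fv \<phi>. tm_vars (\<tau> x))"
    "\<forall>v. sat ?U v \<psi> \<longleftrightarrow> sat U (\<lambda>x. eval ?U v (\<tau> x)) \<phi>"
    by (elim exE conjE)
  show ?thesis
  proof (rule that[OF \<psi>(1)])
    show "fv \<psi> \<subseteq> {y t z | t z. (t, z) \<in> T \<and> \<not> c t z}"
    proof
      fix x assume "x \<in> fv \<psi>"
      then obtain x' where x': "x' \<in> fv \<phi>" "x \<in> tm_vars (\<tau> x')" using \<psi>(2) by blast
      then have "\<not> c (fst (dec x')) (snd (dec x'))" "x = y (fst (dec x')) (snd (dec x'))"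
        by (auto simp: \<tau>_def Let_def split: if_splits)
      then show "x \<in> {y t z | t z. (t, z) \<in> T \<and> \<not> c t z}" using T(1)[OF x'(1)] by blast
    qed
    show "\<forall>v. sat ?U v \<psi> \<longleftrightarrow> Q (\<lambda>t z. if c t z then V t z else v (y t z))"
    proof
      fix v
      have "sat U (\<lambda>x. eval ?U v (\<tau> x)) \<phi> \<longleftrightarrow> sat U (untag (\<lambda>t z. if c t z then V t z else v (y t z))) \<phi>"
      proof (rule sat_cong)
        fix x assume x: "x \<in> fv \<phi>"
        then show "eval ?U v (\<tau> x) = untag (\<lambda>t z. if c t z then V t z else v (y t z)) x"
          using c[OF T(1)[OF x]] by (auto simp: \<tau>_def Let_def untag_def const_struct_def)
      qed
      then show "sat ?U v \<psi> \<longleftrightarrow> Q (\<lambda>t z. if c t z then V t z else v (y t z))"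
        using \<psi>(3) \<phi>(3) by simp
    qed
  qed
qed

lemma dset_const_formula:
  assumes P: "P \<subseteq> elements U" and \<phi>: "wf_fm (const_lang L P) \<phi>" and B: "P \<subseteq> B"
    "\<And>z. z \<in> fv \<phi> \<Longrightarrow> z \<noteq> x \<Longrightarrow> (fst z, v z) \<in> B"
  shows "dset B (fst x) {a\<in>carr U (fst x). sat (const_struct U P) (v(x := a)) \<phi>}"
proof -
  obtain T Q Vp where T: "finite T" "df T Q" "T \<subseteq> {0} \<times> fv \<phi> \<union> {1} \<times> {z. (fst z, Vp z) \<in> P}"
    "\<forall>v. sat (const_struct U P) v \<phi> \<longleftrightarrow> Q (\<lambda>t. if t = 0 then v else Vp)"
    by (rule df_of_const_formula[OF P \<phi>])
  let ?V = "\<lambda>t :: nat. if t = 0 then v else Vp"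
  have "(\<lambda>t. if t = 0 then v(x := a) else Vp) = ?V(0 := (?V 0)(x := a))" for a by auto
  moreover have "dset B (fst x) {a\<in>carr U (fst x). Q (?V(0 := (?V 0)(x := a)))}"
  proof (rule dset_coord[OF T(2)])
    fix t z assume "(t, z) \<in> T" "(t, z) \<noteq> (0, x)"
    then show "(fst z, (if t = 0 then v else Vp) z) \<in> B" using T(3) B(1) B(2)[of z] by auto
  qed
  ultimately show ?thesis unfolding T(4)[rule_format] by (simp only:)
qed

lemma dset_singleton:
  assumes "a \<in> carr U \<sigma>" "(\<sigma>, a) \<in> B"
  shows "dset B \<sigma> {a}"
proof -
  let ?\<phi> = "Eq (Var (\<sigma>, 0)) (Var (\<sigma>, 1)) :: ('s, 'f + 's \<times> 'a, 'r) fm"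
  have "\<sigma> \<in> sorts L" using assms(1) is_struct by (auto simp: is_struct_def)
  then have "has_sort (const_lang L {}) (Var (\<sigma>, k)) \<sigma>" for k
    using has_sort.intros(1)[of "(\<sigma>, k)" "const_lang L {}"] by (simp add: const_lang_def)
  then have "wf_fm (const_lang L {}) ?\<phi>" by auto
  then have "dset B (fst (\<sigma>, 0 :: nat)) {b\<in>carr U (fst (\<sigma>, 0 :: nat)). sat (const_struct U {}) ((\<lambda>_. a)((\<sigma>, 0) := b)) ?\<phi>}"
    by (rule dset_const_formula[rotated]) (use assms(2) in auto)
  moreover have "{b\<in>carr U (fst (\<sigma>, 0 :: nat)). sat (const_struct U {}) ((\<lambda>_. a)((\<sigma>, 0) := b)) ?\<phi>} = {a}"
    using assms(1) by auto
  ultimately show ?thesis by simp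
qed

end

section \<open>Tuples and atomic formulas of the induced language\<close>

lemma pow_map_obtain:
  assumes "as \<in> pow C xs" "distinct xs"
  obtains v where "as = map v xs" "\<forall>x\<in>set xs. v x \<in> C (fst x)"
proof -
  have len: "length as = length xs" using assms(1) by (auto simp: pow_def tuples_def dest: list_all2_lengthD)
  let ?v = "\<lambda>x. the (map_of (zip xs as) x)"
  have as: "as = map ?v xs"
    by (rule nth_equalityI) (use len assms(2) in \<open>simp_all add: map_of_zip_nth\<close>)
  then have "map ?v xs \<in> pow C xs" using assms(1) by simp
  then have "\<forall>x\<in>set xs. ?v x \<in> C (fst x)" by (simp only: in_pow_map)
  with as show ?thesis by (rule that)
qed

lemma holds_Ex: "holds M ts (Ex z \<phi>) as \<longleftrightarrow> (\<exists>a\<in>carr M (fst z). holds M (z # ts) \<phi> (a # as))"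
proof -
  have "(\<lambda>x. the (map_of (zip ts as) x))(z := a) = (\<lambda>x. the (map_of (zip (z # ts) (a # as)) x))" for a
    by auto
  then show ?thesis unfolding holds_def sat.simps by (simp only:)
qed

definition uvars :: "nat \<Rightarrow> unit var list" where
  "uvars n = map (Pair ()) [0..<n]"

lemma length_uvars [simp]: "length (uvars n) = n"
  by (simp add: uvars_def)

lemma distinct_uvars: "distinct (uvars n)"
  by (simp add: uvars_def distinct_map inj_on_def)

lemma pow_const: "as \<in> pow (\<lambda>_. A) xs \<longleftrightarrow> length as = length xs \<and> set as \<subseteq> A"
  by (auto simp: pow_def tuples_def list_all2_conv_all_nth in_set_conv_nth subset_iff)

lemma pow_unit: "as \<in> pow C xs \<longleftrightarrow> length as = length xs \<and> set as \<subseteq> C ()" for xs :: "unit var list"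
  using pow_const[of as "C ()" xs] by simp

lemma elem_subD:
  assumes "elem_sub L M N" "var_tuple L xs" "\<phi> \<in> formulas L xs" "as \<in> pow (carr M) xs"
  shows "holds M xs \<phi> as \<longleftrightarrow> holds N xs \<phi> as"
  using assms by (simp add: elem_sub_def)

lemma holds_Rel_uvars:
  assumes "length as = n"
  shows "holds M (uvars n) (Rel r (map Var (uvars n))) as \<longleftrightarrow> as \<in> rel_int M r"
proof -
  have "map (eval M (\<lambda>x. the (map_of (zip (uvars n) as) x))) (map Var (uvars n)) = as"
    by (rule nth_equalityI) (use assms distinct_uvars in \<open>simp_all add: map_of_zip_nth\<close>)
  then show ?thesis unfolding holds_def sat.simps by (simp only:)
qed

lemma Rel_uvars_formula:
  assumes "(xs, \<psi>) \<in> rels (ind_lang L s)"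
  shows "Rel (xs, \<psi>) (map Var (uvars (length xs))) \<in> formulas (ind_lang L s) (uvars (length xs))"
proof -
  have "has_sort (ind_lang L s) (Var x) ()" for x :: "unit var"
    using has_sort.intros(1)[of x "ind_lang L s"] by (simp add: ind_lang_def)
  then show ?thesis
    using assms by (auto simp: formulas_def ind_lang_def list_all2_conv_all_nth)
qed

lemma var_tuple_uvars: "distinct zs \<Longrightarrow> var_tuple (ind_lang L s) zs"
  by (simp add: var_tuple_def ind_lang_def)

lemma uvars_append: "uvars (m + n) = uvars m @ map (Pair ()) [m..<m + n]"
  by (simp add: uvars_def upt_add_eq_append[of 0 m n])

lemma rel_int_induced:
  "(xs, \<psi>) \<in> rels (ind_lang L s) \<Longrightarrow>
    rel_int (induced L U s A) (xs, \<psi>) = {as \<in> pow (\<lambda>_. A) xs. holds U xs \<psi> as}"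
  by (simp add: induced_def)

context fo_structure
begin

lemma wf_const_lang: "P \<subseteq> elements U \<Longrightarrow> wf_lang (const_lang L P)"
  using wf_lang is_struct by (fastforce simp: wf_lang_def const_lang_def elements_def is_struct_def)

lemma is_struct_const:
  assumes "P \<subseteq> elements U"
  shows "is_struct (const_lang L P) (const_struct U P)"
proof -
  have "snd p \<in> carr U (fst p)" if "p \<in> P" for p using assms that by (auto simp: elements_def)
  moreover have "as \<in> tuples (carr U) [] \<longleftrightarrow> as = []" for as by (simp add: tuples_def)
  ultimately have fn: "if f \<in> funs (const_lang L P) \<and> as \<in> tuples (carr U) (fun_args (const_lang L P) f)
      then fun_int (const_struct U P) f as \<in> carr U (fun_res (const_lang L P) f)
      else fun_int (const_struct U P) f as = undefined" for f as
    using is_struct[unfolded is_struct_def, THEN conjunct2, THEN conjunct1, rule_format, of "projl f" as]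
    by (cases f) (auto simp: const_lang_def const_struct_def split: if_splits)
  show ?thesis
    unfolding is_struct_def
  proof (intro conjI allI)
    show "\<sigma> \<notin> sorts (const_lang L P) \<longrightarrow> carr (const_struct U P) \<sigma> = {}" for \<sigma>
      using is_struct by (simp add: is_struct_def const_lang_def const_struct_def)
    show "if r \<in> rels (const_lang L P)
        then rel_int (const_struct U P) r \<subseteq> tuples (carr (const_struct U P)) (rel_args (const_lang L P) r)
        else rel_int (const_struct U P) r = {}" for r
      using is_struct by (simp add: is_struct_def const_lang_def const_struct_def)
  next
    fix f as
    have "carr (const_struct U P) = carr U" by (simp add: const_struct_def)
    then show "if f \<in> funs (const_lang L P) \<and> as \<in> tuples (carr (const_struct U P)) (fun_args (const_lang L P) f)
        then fun_int (const_struct U P) f as \<in> carr (const_struct U P) (fun_res (const_lang L P) f)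
        else fun_int (const_struct U P) f as = undefined"
      using fn[of f as] by (simp only:)
  qed
qed

text \<open>The induced language has a relation symbol for every formula, so an order inside
  \<open>X\<close> becomes an order for an atomic formula of the induced structure.\<close>

lemma stable_of_induced:
  assumes st: "stable_in (ind_lang (const_lang L P) s) (induced (const_lang L P) (const_struct U P) s X)"
    and s: "s \<in> sorts L" and Q: "df T Q" and T: "\<And>t z. (t, z) \<in> T \<Longrightarrow> fst z = s"
    and A: "\<And>i z. (t0, z) \<in> T \<Longrightarrow> A i z \<in> X"
    and B: "\<And>j t z. (t, z) \<in> T \<Longrightarrow> t \<noteq> t0 \<Longrightarrow> B j t z \<in> X"
    and ord: "\<And>i j :: nat. Q ((B j)(t0 := A i)) \<longleftrightarrow> i < j"
  shows False
proof -
  let ?LF = "const_lang L P" and ?UF = "const_struct U P"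
  obtain T' where T': "finite T'" "T' \<subseteq> T" "df T' Q" using Q by (rule df_finite_support)
  obtain \<psi> where \<psi>: "wf_fm ?LF \<psi>" "fv \<psi> \<subseteq> {enc (t, z) | t z. (t, z) \<in> T' \<and> \<not> False}"
    "\<forall>v. sat ?UF v \<psi> \<longleftrightarrow> Q (\<lambda>t z. if False then undefined t z else v (enc (t, z)))"
    by (rule const_formula_of_df[OF T'(3), of "\<lambda>_ _. False" undefined P "\<lambda>t z. enc (t, z)"])
      (simp_all add: fst_enc)
  obtain xs where xs: "set xs = enc ` {i\<in>T'. fst i = t0}" "distinct xs"
    using finite_distinct_list[of "enc ` {i\<in>T'. fst i = t0}"] T'(1) by auto
  obtain ys where ys: "set ys = enc ` {i\<in>T'. fst i \<noteq> t0}" "distinct ys"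
    using finite_distinct_list[of "enc ` {i\<in>T'. fst i \<noteq> t0}"] T'(1) by auto
  have dec_inj: "enc i = enc j \<longleftrightarrow> i = j" for i j :: "nat \<times> 's var" by (metis dec_enc)
  have dist: "distinct (xs @ ys)" using xs ys by (auto simp: dec_inj)
  have fv: "fv \<psi> \<subseteq> set (xs @ ys)" using \<psi>(2) xs(1) ys(1) by force
  have sorts: "fst ` set (xs @ ys) \<subseteq> {s}"
  proof
    fix \<sigma> assume "\<sigma> \<in> fst ` set (xs @ ys)"
    then obtain i where i: "i \<in> T'" "\<sigma> = fst (snd i)" using xs(1) ys(1) by (auto simp: fst_enc)
    then have "(fst i, snd i) \<in> T" using T'(2) by auto
    then show "\<sigma> \<in> {s}" using T i(2) by blast
  qed
  have r: "(xs @ ys, \<psi>) \<in> rels (ind_lang ?LF s)"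
    using dist sorts s \<psi>(1) fv by (auto simp: ind_lang_def var_tuple_def formulas_def const_lang_def)
  let ?n = "length xs" and ?m = "length ys"
  let ?zs = "map (Pair ()) [?n..<?n + ?m] :: unit var list"
  let ?\<Phi> = "Rel (xs @ ys, \<psi>) (map Var (uvars (?n + ?m)))"
  let ?I = "induced ?LF ?UF s X"
  define a where "a i = map (untag (\<lambda>_. A i)) xs" for i
  define b where "b j = map (untag (B j)) ys" for j
  have aX: "set (a i) \<subseteq> X" for i
  proof -
    have "untag (\<lambda>_. A i) x \<in> X" if x: "x \<in> set xs" for x
    proof -
      obtain t z where "x = enc (t, z)" "(t, z) \<in> T'" "t = t0" using x xs(1) by auto
      then show ?thesis using A[where z = z] T'(2) by auto
    qed
    then show ?thesis by (auto simp: a_def)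
  qed
  have bX: "set (b j) \<subseteq> X" for j
  proof -
    have "untag (B j) x \<in> X" if x: "x \<in> set ys" for x
    proof -
      obtain t z where "x = enc (t, z)" "(t, z) \<in> T'" "t \<noteq> t0" using x ys(1) by auto
      then show ?thesis using B[where t = t and z = z] T'(2) by auto
    qed
    then show ?thesis by (auto simp: b_def)
  qed
  have "order_property ?I (uvars ?n) ?zs ?\<Phi>"
    unfolding order_property_def
  proof (rule exI[of _ a], rule exI[of _ b], intro conjI allI)
    show "a i \<in> pow (carr ?I) (uvars ?n)" for i
      using aX[of i] by (simp add: pow_unit induced_def) (simp add: a_def)
    show "b j \<in> pow (carr ?I) ?zs" for j
    proof -
      have "list_all2 (\<lambda>a s. a \<in> X) (b j) (map fst ?zs)"
        using bX[of j] by (auto simp: b_def list_all2_conv_all_nth)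
      then show ?thesis by (simp add: pow_def tuples_def induced_def)
    qed
    fix i j
    define w where "w = untag ((B j)(t0 := A i))"
    have "map w xs = a i" "map w ys = b j"
      using xs(1) ys(1) by (auto simp: w_def a_def b_def untag_def)
    then have ab: "a i @ b j = map w (xs @ ys)" by simp
    have len: "length (a i @ b j) = ?n + ?m" by (simp add: a_def b_def)
    have "map w (xs @ ys) \<in> pow (\<lambda>_. X) (xs @ ys)"
      using aX[of i] bX[of j] unfolding ab[symmetric]
      by (simp add: pow_def tuples_def list_all2_conv_all_nth) (use len in \<open>auto simp: nth_append a_def b_def\<close>)
    then have "a i @ b j \<in> rel_int ?I (xs @ ys, \<psi>) \<longleftrightarrow> sat ?UF w \<psi>"
      unfolding rel_int_induced[OF r] ab using holds_map[OF fv, of ?UF w] by simp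
    also have "\<dots> \<longleftrightarrow> Q ((B j)(t0 := A i))"
      using \<psi>(3) by (simp add: w_def fun_upd_def cong: if_cong)
    finally show "holds ?I (uvars ?n @ ?zs) ?\<Phi> (a i @ b j) \<longleftrightarrow> i < j"
      using holds_Rel_uvars[OF len, of ?I "(xs @ ys, \<psi>)"] ord[of j i] unfolding uvars_append[symmetric]
      by simp
  qed
  moreover have "?\<Phi> \<in> formulas (ind_lang ?LF s) (uvars ?n @ ?zs)"
    using Rel_uvars_formula[OF r] by (simp add: uvars_append)
  moreover have "var_tuple (ind_lang ?LF s) (uvars ?n @ ?zs)"
    unfolding uvars_append[symmetric] by (rule var_tuple_uvars[OF distinct_uvars])
  ultimately show False using st unfolding stable_in_def by blast
qed

text \<open>The sentence that something equals the constant passes down to \<open>M\<close>; its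
  witness, tested in the large structure, can only be the named element.\<close>

lemma const_in_elem_sub:
  assumes M: "elem_sub (const_lang L P) M (const_struct U P)" and P: "P \<subseteq> elements U"
  shows "P \<subseteq> elements M"
proof
  fix p assume p: "p \<in> P"
  let ?LF = "const_lang L P" and ?UF = "const_struct U P"
  let ?y = "(fst p, 0) :: 's var" and ?\<phi> = "Eq (Var (fst p, 0)) (Fn (Inr p) []) :: ('s, 'f + 's \<times> 'a, 'r) fm"
  have pU: "snd p \<in> carr U (fst p)" using p P by (auto simp: elements_def)
  then have sort: "fst p \<in> sorts ?LF" using is_struct by (auto simp: is_struct_def const_lang_def)
  have "has_sort ?LF (Var ?y) (fst p)" using has_sort.intros(1)[of ?y ?LF] sort by simp
  moreover have "has_sort ?LF (Fn (Inr p) []) (fst p)"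
    using has_sort.intros(2)[of "Inr p" ?LF "[]"] p by (simp add: const_lang_def)
  ultimately have \<phi>: "?\<phi> \<in> formulas ?LF [?y]" by (auto simp: formulas_def)
  then have \<phi>': "Ex ?y ?\<phi> \<in> formulas ?LF []" using sort by (auto simp: formulas_def)
  have iff: "holds ?UF [?y] ?\<phi> [a] \<longleftrightarrow> a = snd p" for a
    using p by (simp add: holds_def const_struct_def)
  have "holds ?UF [] (Ex ?y ?\<phi>) []"
    unfolding holds_Ex iff using pU by (simp add: const_struct_def)
  moreover have "var_tuple ?LF []" "[] \<in> pow (carr M) []" by (simp_all add: var_tuple_def pow_def tuples_def)
  ultimately have "holds M [] (Ex ?y ?\<phi>) []" using M \<phi>' unfolding elem_sub_def by blast
  then obtain a where a: "a \<in> carr M (fst p)" "holds M [?y] ?\<phi> [a]" unfolding holds_Ex by auto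
  moreover have "var_tuple ?LF [?y]" "[a] \<in> pow (carr M) [?y]"
    using sort a(1) by (simp_all add: var_tuple_def pow_def tuples_def)
  ultimately have "holds ?UF [?y] ?\<phi> [a]" using M \<phi> unfolding elem_sub_def by blast
  then show "p \<in> elements M" using iff a(1) by (cases p) (simp add: elements_def)
qed

text \<open>The easy direction of the Tarski-Vaught criterion; the parameters from \<open>M\<close>
  are turned back into free variables so that elementarity applies.\<close>

lemma elem_sub_dset:
  assumes M: "elem_sub (const_lang L P) M (const_struct U P)"
    and A: "dset (elements M) \<sigma> A" "A \<noteq> {}"
  shows "\<exists>a\<in>A. a \<in> carr M \<sigma>"
proof -
  let ?LF = "const_lang L P" and ?UF = "const_struct U P"
  have MU: "carr M \<tau> \<subseteq> carr U \<tau>" for \<tau> using M by (simp add: elem_sub_def const_struct_def)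
  have sortU: "\<tau> \<in> sorts L" if "a \<in> carr U \<tau>" for \<tau> a using that is_struct by (auto simp: is_struct_def)
  obtain T Q V where T: "finite T" "df T Q" "\<forall>z. (0, z) \<in> T \<longrightarrow> fst z = \<sigma>"
    "\<forall>t z. (t, z) \<in> T \<longrightarrow> t \<noteq> 0 \<longrightarrow> (fst z, V t z) \<in> elements M"
    "A = {a\<in>carr U \<sigma>. Q (V(0 := \<lambda>_. a))}"
    by (rule dsetE[OF A(1)])
  define y where "y t z = (if t = 0 then enc (0, (\<sigma>, 0)) else enc (t, z))" for t z
  obtain \<psi> where \<psi>: "wf_fm ?LF \<psi>" "fv \<psi> \<subseteq> {y t z | t z. (t, z) \<in> T \<and> \<not> False}"
    "\<forall>v. sat ?UF v \<psi> \<longleftrightarrow> Q (\<lambda>t z. if False then undefined t z else v (y t z))"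
    by (rule const_formula_of_df[OF T(2), of "\<lambda>_ _. False" undefined P y])
      (use T(3) in \<open>auto simp: fst_enc y_def\<close>)
  let ?y0 = "enc (0, (\<sigma>, 0)) :: 's var"
  obtain ys where ys: "set ys = enc ` {i\<in>T. fst i \<noteq> 0}" "distinct ys"
    using finite_distinct_list[of "enc ` {i\<in>T. fst i \<noteq> 0}"] T(1) by auto
  have dec_inj: "enc i = enc j \<longleftrightarrow> i = j" for i j :: "nat \<times> 's var" by (metis dec_enc)
  have y0: "?y0 \<notin> set ys" using ys(1) by (auto simp: dec_inj)
  have fv: "fv \<psi> \<subseteq> set (?y0 # ys)" using \<psi>(2) ys(1) by (force simp: y_def)
  have \<sigma>: "\<sigma> \<in> sorts L" using A(2) T(5) sortU by blast
  have ysM: "untag V x \<in> carr M (fst x)" if x: "x \<in> set ys" for x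
  proof -
    obtain t z where "x = enc (t, z)" "(t, z) \<in> T" "t \<noteq> 0" using x ys(1) by auto
    then show ?thesis using T(4)[rule_format, of t z] by (simp add: elements_def fst_enc)
  qed
  have sorts: "fst x \<in> sorts L" if "x \<in> set ys" for x using ysM[OF that] MU sortU by blast
  have vt: "var_tuple ?LF ys" "var_tuple ?LF (?y0 # ys)"
    using ys(2) y0 sorts \<sigma> by (auto simp: var_tuple_def const_lang_def fst_enc)
  have fm: "\<psi> \<in> formulas ?LF (?y0 # ys)" "Ex ?y0 \<psi> \<in> formulas ?LF ys"
    using \<psi>(1) fv \<sigma> by (auto simp: formulas_def const_lang_def fst_enc)
  have pow: "map (untag V) ys \<in> pow (carr M) ys" using ysM by (simp add: in_pow_map)
  have iff: "holds ?UF (?y0 # ys) \<psi> (a # map (untag V) ys) \<longleftrightarrow> Q (V(0 := \<lambda>_. a))" for a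
  proof -
    let ?w = "untag (V(0 := \<lambda>_. a))"
    have "a # map (untag V) ys = map ?w (?y0 # ys)"
      using ys(1) by (auto simp: untag_def)
    then have "holds ?UF (?y0 # ys) \<psi> (a # map (untag V) ys) \<longleftrightarrow> sat ?UF ?w \<psi>"
      using holds_map[OF fv, of ?UF ?w] by (simp only:)
    also have "\<dots> \<longleftrightarrow> Q (\<lambda>t z. ?w (y t z))" using \<psi>(3) by simp
    also have "(\<lambda>t z. ?w (y t z)) = V(0 := \<lambda>_. a)" by (auto simp: y_def fun_eq_iff)
    finally show ?thesis .
  qed
  have "holds ?UF ys (Ex ?y0 \<psi>) (map (untag V) ys)"
    unfolding holds_Ex iff using A(2) T(5) by (auto simp: fst_enc const_struct_def)
  then have "holds M ys (Ex ?y0 \<psi>) (map (untag V) ys)" using M vt(1) fm(2) pow unfolding elem_sub_def by blast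
  then obtain a where a: "a \<in> carr M \<sigma>" "holds M (?y0 # ys) \<psi> (a # map (untag V) ys)"
    unfolding holds_Ex by (auto simp: fst_enc)
  moreover have "a # map (untag V) ys \<in> pow (carr M) (?y0 # ys)"
    using pow a(1) by (simp add: pow_def tuples_def fst_enc)
  ultimately have "Q (V(0 := \<lambda>_. a))" using M vt(2) fm(1) unfolding elem_sub_def iff[symmetric] by blast
  then show ?thesis using a(1) MU T(5) by blast
qed

text \<open>The other direction of the Tarski-Vaught criterion. Closure under the functions,
  constants included, comes from the same hypothesis: the singleton of a function value is definable
  over the arguments and \<open>P\<close>.\<close>

lemma closed_model:
  assumes P: "P \<subseteq> B" and B: "B \<subseteq> elements U"
    and cl: "\<forall>\<sigma> A. dset B \<sigma> A \<longrightarrow> A \<noteq> {} \<longrightarrow> (\<exists>a\<in>A. (\<sigma>, a) \<in> B)"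
  obtains M where "elem_sub (const_lang L P) M (const_struct U P)" "elements M = B"
proof -
  let ?LF = "const_lang L P" and ?UF = "const_struct U P"
  have PU: "P \<subseteq> elements U" using P B by blast
  note wf = wf_const_lang[OF PU] and isUF = is_struct_const[OF PU]
  define C where "C \<sigma> = {a. (\<sigma>, a) \<in> B}" for \<sigma>
  define M where "M = \<lparr> carr = C, fun_int = (\<lambda>f as. if f \<in> funs ?LF \<and> as \<in> tuples C (fun_args ?LF f)
      then fun_int ?UF f as else undefined), rel_int = (\<lambda>r. rel_int ?UF r \<inter> tuples C (rel_args ?LF r)) \<rparr>"
  have carrUF: "carr ?UF = carr U" by (simp add: const_struct_def)
  have CU: "C \<sigma> \<subseteq> carr U \<sigma>" for \<sigma> using B by (auto simp: C_def elements_def)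
  have sortC: "\<sigma> \<in> sorts ?LF" if "a \<in> C \<sigma>" for \<sigma> a
    using that CU is_struct by (auto simp: is_struct_def const_lang_def)
  have tupCU: "as \<in> tuples (carr U) ss" if "as \<in> tuples C ss" for as ss
    using that CU by (auto simp: tuples_def list_all2_conv_all_nth subset_iff)
  have fun_closed: "fun_int ?UF f as \<in> C (fun_res ?LF f)"
    if f: "f \<in> funs ?LF" and as: "as \<in> tuples C (fun_args ?LF f)" for f as
  proof -
    let ?x = "(fun_res ?LF f, 0) :: 's var"
    define zs :: "'s var list" where "zs = map (\<lambda>i. (fun_args ?LF f ! i, Suc i)) [0..<length (fun_args ?LF f)]"
    define v where "v x = as ! (snd x - 1)" for x :: "'s var"
    let ?\<phi> = "Eq (Var ?x) (Fn f (map Var zs)) :: ('s, 'f + 's \<times> 'a, 'r) fm"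
    have len: "length as = length (fun_args ?LF f)" using as by (auto simp: tuples_def dest: list_all2_lengthD)
    have res: "fun_res ?LF f \<in> sorts ?LF" and args: "set (fun_args ?LF f) \<subseteq> sorts ?LF"
      using wf f by (auto simp: wf_lang_def)
    have "list_all2 (has_sort ?LF) (map Var zs) (fun_args ?LF f)"
      unfolding list_all2_conv_all_nth
    proof (intro conjI allI impI)
      fix i assume "i < length (map Var zs)"
      then have i: "i < length (fun_args ?LF f)" by (simp add: zs_def)
      then have "fun_args ?LF f ! i \<in> sorts ?LF" using args nth_mem by blast
      then show "has_sort ?LF (map Var zs ! i) (fun_args ?LF f ! i)"
        using has_sort.intros(1)[of "zs ! i" ?LF] i by (simp add: zs_def)
    qed (simp add: zs_def)
    then have "has_sort ?LF (Fn f (map Var zs)) (fun_res ?LF f)" using has_sort.intros(2) f by metis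
    moreover have "has_sort ?LF (Var ?x) (fun_res ?LF f)" using has_sort.intros(1)[of ?x ?LF] res by simp
    ultimately have \<phi>: "wf_fm ?LF ?\<phi>" by auto
    have B': "(fst z, v z) \<in> B" if z: "z \<in> fv ?\<phi>" "z \<noteq> ?x" for z
    proof -
      have "z \<in> set zs" using z by auto
      then obtain i where i: "i < length (fun_args ?LF f)" "z = (fun_args ?LF f ! i, Suc i)"
        by (auto simp: zs_def)
      then show ?thesis using as len by (auto simp: v_def tuples_def list_all2_conv_all_nth C_def)
    qed
    have "map (v(?x := a)) zs = as" for a
      by (rule nth_equalityI) (auto simp: zs_def len v_def)
    then have "sat ?UF (v(?x := a)) ?\<phi> \<longleftrightarrow> a = fun_int ?UF f as" for a
      by (simp add: o_def del: fun_upd_apply) (simp add: fun_upd_same)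
    moreover have "fun_int ?UF f as \<in> carr U (fun_res ?LF f)"
      using isUF f tupCU[OF as] unfolding is_struct_def carrUF by (auto dest!: spec[of _ f])
    ultimately have eq: "{a\<in>carr U (fst ?x). sat ?UF (v(?x := a)) ?\<phi>} = {fun_int ?UF f as}" by auto
    have "dset B (fst ?x) {a\<in>carr U (fst ?x). sat ?UF (v(?x := a)) ?\<phi>}"
      by (rule dset_const_formula[OF PU \<phi> P B'])
    then have "dset B (fun_res ?LF f) {fun_int ?UF f as}" unfolding eq by simp
    then show ?thesis using cl by (force simp: C_def)
  qed
  have tm: "eval M v t = eval ?UF v t \<and> eval ?UF v t \<in> C \<sigma>"
    if "has_sort ?LF t \<sigma>" "\<And>x. x \<in> tm_vars t \<Longrightarrow> v x \<in> C (fst x)" for t \<sigma> v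
    using that
  proof (induction rule: has_sort.induct)
    case (1 x)
    then show ?case by simp
  next
    case (2 f ts)
    have IH: "eval M v (ts ! i) = eval ?UF v (ts ! i) \<and> eval ?UF v (ts ! i) \<in> C (fun_args ?LF f ! i)"
      if i: "i < length ts" for i
    proof -
      have "v x \<in> C (fst x)" if "x \<in> tm_vars (ts ! i)" for x using 2(3)[of x] nth_mem[OF i] that by auto
      then show ?thesis using list_all2_nthD[OF 2(2) i] by blast
    qed
    have eq: "map (eval M v) ts = map (eval ?UF v) ts" by (rule nth_equalityI) (use IH in auto)
    have tup: "map (eval ?UF v) ts \<in> tuples C (fun_args ?LF f)"
      using IH 2(2) by (simp add: tuples_def list_all2_conv_all_nth)
    then have "fun_int M f (map (eval ?UF v) ts) = fun_int ?UF f (map (eval ?UF v) ts)"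
      using 2(1) by (simp add: M_def)
    then show ?case using fun_closed[OF 2(1) tup] unfolding eval.simps eq by simp
  qed
  have fm: "sat M v \<phi> \<longleftrightarrow> sat ?UF v \<phi>"
    if "wf_fm ?LF \<phi>" "\<And>x. x \<in> fv \<phi> \<Longrightarrow> v x \<in> C (fst x)" for \<phi> v
    using that
  proof (induction \<phi> arbitrary: v)
    case (Eq t u)
    then obtain \<sigma> where "has_sort ?LF t \<sigma>" "has_sort ?LF u \<sigma>" by auto
    then have "eval M v t = eval ?UF v t" "eval M v u = eval ?UF v u"
      using tm[of t \<sigma> v] tm[of u \<sigma> v] Eq.prems(2) by auto
    then show ?case by simp
  next
    case (Rel r ts)
    have IH: "eval M v (ts ! i) = eval ?UF v (ts ! i) \<and> eval ?UF v (ts ! i) \<in> C (rel_args ?LF r ! i)"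
      if i: "i < length ts" for i
    proof (rule tm)
      show "v x \<in> C (fst x)" if "x \<in> tm_vars (ts ! i)" for x using Rel.prems(2)[of x] nth_mem[OF i] that by auto
      show "has_sort ?LF (ts ! i) (rel_args ?LF r ! i)" using Rel.prems(1) i by (simp add: list_all2_conv_all_nth)
    qed
    have eq: "map (eval M v) ts = map (eval ?UF v) ts" by (rule nth_equalityI) (use IH in auto)
    have "map (eval ?UF v) ts \<in> tuples C (rel_args ?LF r)"
      using IH Rel.prems(1) by (simp add: tuples_def list_all2_conv_all_nth)
    then show ?case unfolding sat.simps eq by (simp add: M_def)
  next
    case (Neg \<phi>)
    have "sat M v \<phi> \<longleftrightarrow> sat ?UF v \<phi>" by (rule Neg.IH) (use Neg.prems in auto)
    then show ?case by simp
  next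
    case (Conj \<phi> \<psi>)
    have "sat M v \<phi> \<longleftrightarrow> sat ?UF v \<phi>" by (rule Conj.IH(1)) (use Conj.prems in auto)
    moreover have "sat M v \<psi> \<longleftrightarrow> sat ?UF v \<psi>" by (rule Conj.IH(2)) (use Conj.prems in auto)
    ultimately show ?case by simp
  next
    case (Ex x \<phi>)
    have \<phi>: "wf_fm ?LF \<phi>" using Ex.prems(1) by simp
    let ?A = "{a\<in>carr U (fst x). sat ?UF (v(x := a)) \<phi>}"
    have IH: "sat M (v(x := a)) \<phi> \<longleftrightarrow> sat ?UF (v(x := a)) \<phi>" if a: "a \<in> C (fst x)" for a
    proof (rule Ex.IH[OF \<phi>])
      show "(v(x := a)) z \<in> C (fst z)" if "z \<in> fv \<phi>" for z using Ex.prems(2)[of z] a that by (cases "z = x") auto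
    qed
    have "dset B (fst x) ?A"
    proof (rule dset_const_formula[OF PU \<phi> P])
      show "(fst z, v z) \<in> B" if "z \<in> fv \<phi>" "z \<noteq> x" for z using Ex.prems(2)[of z] that by (simp add: C_def)
    qed
    then have "?A \<noteq> {} \<Longrightarrow> \<exists>a\<in>?A. a \<in> C (fst x)" using cl unfolding C_def by blast
    then have "(\<exists>a\<in>carr U (fst x). sat ?UF (v(x := a)) \<phi>) \<longleftrightarrow> (\<exists>a\<in>C (fst x). sat ?UF (v(x := a)) \<phi>)"
      using CU by blast
    moreover have "carr M = C" by (simp add: M_def)
    ultimately show ?case using IH by (simp add: carrUF)
  qed simp
  have isM: "is_struct ?LF M"
    unfolding is_struct_def
  proof (intro conjI allI impI)
    show "carr M \<sigma> = {}" if "\<sigma> \<notin> sorts ?LF" for \<sigma> using that sortC by (auto simp: M_def)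
    show "if f \<in> funs ?LF \<and> as \<in> tuples (carr M) (fun_args ?LF f)
        then fun_int M f as \<in> carr M (fun_res ?LF f) else fun_int M f as = undefined" for f as
      using fun_closed[of f as] by (simp add: M_def)
    show "if r \<in> rels ?LF then rel_int M r \<subseteq> tuples (carr M) (rel_args ?LF r) else rel_int M r = {}" for r
      using isUF by (auto simp: M_def is_struct_def)
  qed
  have "holds M xs \<phi> as \<longleftrightarrow> holds ?UF xs \<phi> as"
    if xs: "var_tuple ?LF xs" and \<phi>: "\<phi> \<in> formulas ?LF xs" and as: "as \<in> pow (carr M) xs" for xs \<phi> as
  proof -
    have \<phi>': "wf_fm ?LF \<phi>" "fv \<phi> \<subseteq> set xs" using \<phi> by (auto simp: formulas_def)
    have "distinct xs" using xs by (simp add: var_tuple_def)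
    then obtain v where v: "as = map v xs" "\<forall>x\<in>set xs. v x \<in> carr M (fst x)"
      using as by (elim pow_map_obtain)
    then have "sat M v \<phi> \<longleftrightarrow> sat ?UF v \<phi>" using \<phi>' by (intro fm) (auto simp: M_def)
    then show ?thesis unfolding v(1) holds_map[OF \<phi>'(2)] .
  qed
  then have "elem_sub ?LF M ?UF"
    using isM isUF CU by (simp add: elem_sub_def M_def carrUF)
  moreover have "elements M = B" by (auto simp: elements_def M_def C_def)
  ultimately show ?thesis by (rule that)
qed

end

context stable_set
begin

text \<open>That a set over \<open>F\<close> and \<open>N\<close> intersects \<open>X\<close>
  becomes an existential statement about one relation symbol: the \<open>F\<close>-parameters are
  absorbed into its formula, the \<open>N\<close>-parameters are its arguments, and elementarity
  moves the witness into \<open>N\<close>. Equality of the structures rests on atomic formulas and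
  on interpretations being normalised.\<close>

lemma induced_elem_sub:
  assumes N: "elem_sub (ind_lang (const_lang L F) s) NN (induced (const_lang L F) (const_struct U F) s X)"
  shows "carr NN () \<subseteq> X" "meets (F \<union> {s} \<times> carr NN ()) (carr NN ())"
    "NN = induced (const_lang L F) (const_struct U F) s (carr NN ())"
proof -
  let ?LF = "const_lang L F" and ?UF = "const_struct U F"
  let ?I = "induced ?LF ?UF s X" and ?LX = "ind_lang ?LF s"
  define N where "N = carr NN ()"
  have NX: "N \<subseteq> X" using assms by (auto simp: elem_sub_def induced_def N_def)
  then show "carr NN () \<subseteq> X" by (simp add: N_def)
  have transfer: "as \<in> rel_int NN (xs, \<psi>) \<longleftrightarrow> as \<in> pow (\<lambda>_. X) xs \<and> holds ?UF xs \<psi> as"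
    if r: "(xs, \<psi>) \<in> rels ?LX" and as: "length as = length xs" "set as \<subseteq> N" for as xs \<psi>
  proof -
    let ?\<Phi> = "Rel (xs, \<psi>) (map Var (uvars (length xs))) :: (unit, unit, _) fm"
    have "as \<in> pow (carr NN) (uvars (length xs))" using as by (simp add: pow_unit N_def)
    then have "holds NN (uvars (length xs)) ?\<Phi> as \<longleftrightarrow> holds ?I (uvars (length xs)) ?\<Phi> as"
      by (rule elem_subD[OF N var_tuple_uvars[OF distinct_uvars] Rel_uvars_formula[OF r]])
    then show ?thesis
      unfolding holds_Rel_uvars[OF as(1)] rel_int_induced[OF r] by simp
  qed
  show "meets (F \<union> {s} \<times> carr NN ()) (carr NN ())"
    unfolding meets_def N_def[symmetric]
  proof (intro allI impI)
    fix A assume A: "dset (F \<union> {s} \<times> N) s A" and "A \<inter> X \<noteq> {}"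
    then obtain a where a: "a \<in> A" "a \<in> X" by blast
    obtain T Q V where T: "finite T" "df T Q" "\<forall>z. (0, z) \<in> T \<longrightarrow> fst z = s"
      "\<forall>t z. (t, z) \<in> T \<longrightarrow> t \<noteq> 0 \<longrightarrow> (fst z, V t z) \<in> F \<union> {s} \<times> N"
      "A = {a\<in>carr U s. Q (V(0 := \<lambda>_. a))}"
      by (rule dsetE[OF A])
    define c where "c t z \<longleftrightarrow> t \<noteq> 0 \<and> (fst z, V t z) \<in> F" for t and z :: "'s var"
    define y where "y t z = (if t = 0 then enc (0, (s, 0)) else enc (t, z))" for t z
    obtain \<psi> where \<psi>: "wf_fm ?LF \<psi>" "fv \<psi> \<subseteq> {y t z | t z. (t, z) \<in> T \<and> \<not> c t z}"
      "\<forall>v. sat ?UF v \<psi> \<longleftrightarrow> Q (\<lambda>t z. if c t z then V t z else v (y t z))"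
      by (rule const_formula_of_df[OF T(2), of c V F y])
        (use T(3) in \<open>auto simp: fst_enc y_def c_def\<close>)
    let ?y0 = "enc (0, (s, 0)) :: 's var"
    define J where "J = {(t, z)\<in>T. t \<noteq> 0 \<and> \<not> c t z}"
    have J: "V t z \<in> N" "fst z = s" "t \<noteq> 0" if "(t, z) \<in> J" for t z
      using that T(4)[rule_format, of t z] by (auto simp: J_def c_def)
    have "finite J" using T(1) by (rule rev_finite_subset) (auto simp: J_def)
    then obtain ys where ys: "set ys = enc ` J" "distinct ys"
      using finite_distinct_list[of "enc ` J"] by auto
    have dec_inj: "enc i = enc j \<longleftrightarrow> i = j" for i j :: "nat \<times> 's var" by (metis dec_enc)
    have y0: "?y0 \<notin> set ys" using ys(1) J(3)[where t = 0 and z = "(s, 0)"] by (auto simp: dec_inj)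
    have fv: "fv \<psi> \<subseteq> set (?y0 # ys)"
    proof
      fix x assume "x \<in> fv \<psi>"
      then obtain t z where "x = y t z" "(t, z) \<in> T" "\<not> c t z" using \<psi>(2) by blast
      then show "x \<in> set (?y0 # ys)" using ys(1) by (cases "t = 0") (auto simp: y_def J_def)
    qed
    have ysJ: "fst x = s \<and> untag V x \<in> N \<and> untag (V(0 := W)) x = untag V x" if x: "x \<in> set ys" for x W
    proof -
      obtain t z where "x = enc (t, z)" "(t, z) \<in> J" using x ys(1) by auto
      then show ?thesis using J[where t = t and z = z] by (simp add: fst_enc)
    qed
    then have sorts: "fst ` set (?y0 # ys) \<subseteq> {s}" by (auto simp: fst_enc)
    have s: "s \<in> sorts L" using a(2) s_sort by blast
    have r: "(?y0 # ys, \<psi>) \<in> rels ?LX"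
      using ys(2) y0 sorts s \<psi>(1) fv by (auto simp: ind_lang_def var_tuple_def formulas_def const_lang_def)
    let ?n = "length ys"
    let ?ps = "map (untag V) ys"
    have psN: "set ?ps \<subseteq> N" using ysJ by auto
    have iff: "holds ?UF (?y0 # ys) \<psi> (a # ?ps) \<longleftrightarrow> Q (V(0 := \<lambda>_. a))" for a
    proof -
      let ?w = "untag (V(0 := \<lambda>_. a))"
      have "a # ?ps = map ?w (?y0 # ys)"
        using ysJ by simp
      then have "holds ?UF (?y0 # ys) \<psi> (a # ?ps) \<longleftrightarrow> sat ?UF ?w \<psi>"
        using holds_map[OF fv, of ?UF ?w] by (simp only:)
      also have "\<dots> \<longleftrightarrow> Q (\<lambda>t z. if c t z then V t z else ?w (y t z))" using \<psi>(3) by simp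
      also have "(\<lambda>t z. if c t z then V t z else ?w (y t z)) = V(0 := \<lambda>_. a)"
        by (auto simp: y_def fun_eq_iff c_def)
      finally show ?thesis .
    qed
    have pw: "a # ?ps \<in> pow (\<lambda>_. X) (?y0 # ys) \<longleftrightarrow> a \<in> X" for a
      using psN NX unfolding pow_const by auto
    let ?\<Phi> = "Rel (?y0 # ys, \<psi>) (map Var (uvars (Suc ?n))) :: (unit, unit, _) fm"
    let ?zs = "map (Pair ()) [1..<Suc ?n] :: unit var list"
    have uv: "uvars (Suc ?n) = ((), 0) # ?zs"
      unfolding uvars_def by (simp add: upt_conv_Cons del: upt_Suc)
    have \<Phi>: "?\<Phi> \<in> formulas ?LX (uvars (Suc ?n))" using Rel_uvars_formula[OF r] by simp
    then have Ex\<Phi>: "Ex ((), 0) ?\<Phi> \<in> formulas ?LX ?zs"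
      unfolding uv by (auto simp: formulas_def ind_lang_def)
    have "distinct ?zs" using distinct_uvars[of "Suc ?n"] unfolding uv by simp
    then have vt: "var_tuple ?LX ?zs" by (rule var_tuple_uvars)
    have pwN: "?ps \<in> pow (carr NN) ?zs"
      using psN unfolding pow_unit by (simp add: N_def del: upt_Suc)
    have "holds ?I ?zs (Ex ((), 0) ?\<Phi>) ?ps"
      unfolding holds_Ex
    proof (rule bexI[of _ a])
      have "a # ?ps \<in> rel_int ?I (?y0 # ys, \<psi>)"
        unfolding rel_int_induced[OF r] using iff pw a by (simp add: T(5))
      then show "holds ?I (((), 0) # ?zs) ?\<Phi> (a # ?ps)"
        using holds_Rel_uvars[of "a # ?ps" "Suc ?n" ?I] unfolding uv by simp
    qed (use a(2) in \<open>simp add: induced_def\<close>)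
    then have "holds NN ?zs (Ex ((), 0) ?\<Phi>) ?ps"
      using assms Ex\<Phi> vt pwN unfolding elem_sub_def by blast
    then obtain a' where a': "a' \<in> N" "holds NN (((), 0) # ?zs) ?\<Phi> (a' # ?ps)"
      unfolding holds_Ex N_def by auto
    then have "a' # ?ps \<in> rel_int NN (?y0 # ys, \<psi>)"
      using holds_Rel_uvars[of "a' # ?ps" "Suc ?n" NN] unfolding uv by simp
    then have "holds ?UF (?y0 # ys) \<psi> (a' # ?ps)"
      using transfer[OF r, of "a' # ?ps"] a'(1) psN by simp
    then have "a' \<in> A" using iff a'(1) NX X_carr by (auto simp: T(5))
    then show "A \<inter> N \<noteq> {}" using a'(1) by blast
  qed
  show "NN = induced ?LF ?UF s (carr NN ())"
  proof (rule fo_struct.equality)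
    have isN: "is_struct ?LX NN" using assms by (simp add: elem_sub_def)
    show "carr NN = carr (induced ?LF ?UF s (carr NN ()))" by (auto simp: induced_def)
    have "fun_int NN f as = undefined" for f as
      using isN by (simp add: is_struct_def ind_lang_def)
    then show "fun_int NN = fun_int (induced ?LF ?UF s (carr NN ()))" by (simp add: induced_def fun_eq_iff)
    show "rel_int NN = rel_int (induced ?LF ?UF s (carr NN ()))"
    proof
      fix r :: "'s var list \<times> ('s, 'f + 's \<times> 'a, 'r) fm"
      obtain xs \<psi> where r: "r = (xs, \<psi>)" by (rule prod.exhaust)
      show "rel_int NN r = rel_int (induced ?LF ?UF s (carr NN ())) r"
      proof (cases "r \<in> rels ?LX")
        case True
        have sub: "length as = length xs \<and> set as \<subseteq> N" if "as \<in> rel_int NN r" for as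
        proof -
          have "as \<in> tuples (carr NN) (rel_args ?LX r)"
            using isN[unfolded is_struct_def, THEN conjunct2, THEN conjunct2, rule_format, of r] True that by auto
          then have "as \<in> pow (carr NN) (map (Pair ()) [0..<length xs])"
            by (simp add: r ind_lang_def pow_def map_replicate_const o_def)
          then show ?thesis unfolding pow_unit by (simp add: N_def)
        qed
        have pX: "as \<in> pow (\<lambda>_. X) xs" if "as \<in> pow (\<lambda>_. N) xs" for as
          using that NX unfolding pow_const by auto
        have "as \<in> rel_int NN r \<longleftrightarrow> as \<in> pow (\<lambda>_. N) xs \<and> holds ?UF xs \<psi> as" for as
          using sub[of as] pow_const[of as N xs] pX[of as] transfer[of xs \<psi> as] True unfolding r by blast
        then show ?thesis
          using rel_int_induced[of xs \<psi> ?LF s ?UF "carr NN ()"] True unfolding r N_def by blast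
      next
        case False
        then show ?thesis using isN by (simp add: is_struct_def induced_def r)
      qed
    qed
  qed simp
qed

end

section \<open>Assembling the models\<close>

lemma elem_sub_models: "elem_sub L M V \<Longrightarrow> models L M (Th L V)"
  using elem_subD[of L M V "[]" _ "[]"]
  by (auto simp: models_def Th_def elem_sub_def var_tuple_def pow_def tuples_def)

lemma elem_sub_common:
  assumes M: "elem_sub L M V" and N: "elem_sub L N V" and sub: "elements M \<subseteq> elements N"
  shows "elem_sub L M N"
proof -
  have carr: "carr M \<sigma> \<subseteq> carr N \<sigma>" for \<sigma> using sub by (auto simp: elements_def)
  then have "as \<in> pow (carr N) xs" if "as \<in> pow (carr M) xs" for as xs
    using that by (auto simp: pow_def tuples_def list_all2_conv_all_nth subset_iff)
  then have "holds M xs \<phi> as \<longleftrightarrow> holds N xs \<phi> as"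
    if "var_tuple L xs" "\<phi> \<in> formulas L xs" "as \<in> pow (carr M) xs" for xs \<phi> as
    using elem_subD[OF M that] elem_subD[OF N that(1,2)] that(3) by blast
  then show ?thesis using M N carr by (simp add: elem_sub_def)
qed

lemma small_Un: "infinite (elements U) \<Longrightarrow> small U A \<Longrightarrow> small U B \<Longrightarrow> small U (A \<union> B)"
  unfolding small_def by (rule card_of_Un_ordLess_infinite)

lemma small_image: "small U A \<Longrightarrow> small U (f ` A)"
  unfolding small_def by (rule ordLeq_ordLess_trans[OF card_of_image])

lemma realisations_elem_sub:
  assumes M: "elem_sub L M V" and s: "fst x \<in> sorts L" and \<chi>: "\<chi> \<in> formulas L [x]"
  shows "realisations M x \<chi> = realisations V x \<chi> \<inter> carr M (fst x)"
proof -
  have "holds M [x] \<chi> [a] \<longleftrightarrow> holds V [x] \<chi> [a]" if "a \<in> carr M (fst x)" for a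
    using elem_subD[OF M _ \<chi>, of "[a]"] s that by (simp add: var_tuple_def pow_def tuples_def)
  moreover have "carr M (fst x) \<subseteq> carr V (fst x)" using M by (simp add: elem_sub_def)
  ultimately show ?thesis by (auto simp: realisations_def)
qed

context stable_set
begin

lemma dset_X: "dset F s X"
  using X(3,4) by (intro dsetI[OF X(2), of s VX]) (simp_all add: X(5))

text \<open>An element of \<open>X\<close> belonging to \<open>B\<close> has a
  \<open>B\<close>-definable singleton, which must intersect \<open>N\<close>. So enlarging
  \<open>B\<close> while it meets \<open>N\<close> never adds elements to \<open>X\<close>.\<close>

lemma meets_eq:
  assumes "meets B N" "{s} \<times> N \<subseteq> B" "N \<subseteq> X"
  shows "{a \<in> X. (s, a) \<in> B} = N"
proof
  show "{a \<in> X. (s, a) \<in> B} \<subseteq> N"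
  proof
    fix a assume a: "a \<in> {a \<in> X. (s, a) \<in> B}"
    then have "dset B s {a}" using X_carr by (intro dset_singleton) auto
    then show "a \<in> N" using assms(1) a unfolding meets_def by blast
  qed
qed (use assms in auto)

lemma meets_elem_sub:
  assumes M: "elem_sub (const_lang L F) M (const_struct U F)"
  shows "meets (elements M) (X \<inter> carr M s)"
  unfolding meets_def
proof (intro allI impI)
  fix A assume "dset (elements M) s A" "A \<inter> X \<noteq> {}"
  moreover have "dset (elements M) s X"
    using dset_X const_in_elem_sub[OF M F] by (rule dset_mono)
  ultimately have "\<exists>a\<in>A \<inter> X. a \<in> carr M s"
    by (intro elem_sub_dset[OF M] dset_Int)
  then show "A \<inter> (X \<inter> carr M s) \<noteq> {}" by blast
qed

text \<open>Common end of both halves of the theorem: the first takes for \<open>B\<close> the set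
  \<open>F\<close> with the universe of \<open>N\<close>, the second the universe of the given model
  with that of the larger structure.\<close>

lemma model_of_meets:
  assumes cl: "countable_lang L" and \<chi>: "s \<in> sorts L" "\<chi> \<in> formulas (const_lang L F) [(s, n)]"
    "realisations (const_struct U F) (s, n) \<chi> = X"
    and m: "meets B N" and B: "F \<subseteq> B" "{s} \<times> N \<subseteq> B" "B \<subseteq> elements U" "small U B" and N: "N \<subseteq> X"
  obtains M where "small_model_in U (const_lang L F) (const_struct U F) (Th (const_lang L F) (const_struct U F)) M"
    "B \<subseteq> elements M" "realisations M (s, n) \<chi> = N"
proof -
  obtain B' where B': "B \<subseteq> B'" "B' \<subseteq> elements U" "small U B'" "meets B' N"
    "\<forall>\<sigma> A. dset B' \<sigma> A \<longrightarrow> A \<noteq> {} \<longrightarrow> (\<exists>a\<in>A. (\<sigma>, a) \<in> B')"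
    by (rule closure[OF cl m B(2-4) N])
  have FB': "F \<subseteq> B'" using B(1) B'(1) by blast
  obtain M where M: "elem_sub (const_lang L F) M (const_struct U F)" "elements M = B'"
    by (rule closed_model[OF FB' B'(2,5)])
  have "realisations M (s, n) \<chi> = X \<inter> carr M s"
    using realisations_elem_sub[OF M(1), of "(s, n)" \<chi>] \<chi> by (simp add: const_lang_def)
  also have "\<dots> = {a \<in> X. (s, a) \<in> B'}" unfolding M(2)[symmetric] by (auto simp: elements_def)
  also have "\<dots> = N" using B'(1) B(2) by (intro meets_eq[OF B'(4) _ N]) blast
  finally show ?thesis
    using M B' elem_sub_models[OF M(1)] by (intro that[of M]) (simp_all add: small_model_in_def)
qed

end

theorem corollary6p33:
  fixes L' :: "('s, 'f, 'r) lang" and T' :: "('s, 'f, 'r) fm set"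
    and U :: "('s, 'f, 'r, 'a) fo_struct" and F :: "('s \<times> 'a) set"
    and L :: "('s, 'f + 's \<times> 'a, 'r) lang" and T :: "('s, 'f + 's \<times> 'a, 'r) fm set"
    and U\<^sub>F :: "('s, 'f + 's \<times> 'a, 'r, 'a) fo_struct"
    and s :: 's and n :: nat and \<chi> :: "('s, 'f + 's \<times> 'a, 'r) fm"
    and X :: "('s, 'f + 's \<times> 'a, 'r, 'a) fo_struct \<Rightarrow> 'a set"
    and ind :: "'a set \<Rightarrow> (unit, unit, 's var list \<times> ('s, 'f + 's \<times> 'a, 'r) fm, 'a) fo_struct"
    and L\<^sub>X :: "(unit, unit, 's var list \<times> ('s, 'f + 's \<times> 'a, 'r) fm) lang"
    and T\<^sub>X :: "(unit, unit, 's var list \<times> ('s, 'f + 's \<times> 'a, 'r) fm) fm set"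
  assumes "wf_lang L'" and "countable_lang L'"
    and "complete_theory L' T'" and "monster L' T' U" and "NIP_in L' U"
    and "F \<subseteq> elements U" and "small U F"
    and "L = const_lang L' F" and "U\<^sub>F = const_struct U F" and "T = Th L U\<^sub>F"
    and "s \<in> sorts L" and "\<chi> \<in> formulas L [(s, n)]"
    and "X = (\<lambda>M. realisations M (s, n) \<chi>)"
    and "ind = induced L U\<^sub>F s"
    and "L\<^sub>X = ind_lang L s" and "T\<^sub>X = Th L\<^sub>X (ind (X U\<^sub>F))"
    and "stable_in L\<^sub>X (ind (X U\<^sub>F))"
  shows "(\<forall>N. small_model_in U L\<^sub>X (ind (X U\<^sub>F)) T\<^sub>X N \<longrightarrow>
            (\<exists>M. small_model_in U L U\<^sub>F T M \<and> N = ind (X M))) \<and>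
         (\<forall>N\<^sub>1 N\<^sub>2 M\<^sub>1.
            small_model_in U L\<^sub>X (ind (X U\<^sub>F)) T\<^sub>X N\<^sub>1 \<and>
            small_model_in U L\<^sub>X (ind (X U\<^sub>F)) T\<^sub>X N\<^sub>2 \<and> elem_sub L\<^sub>X N\<^sub>1 N\<^sub>2 \<and>
            small_model_in U L U\<^sub>F T M\<^sub>1 \<and> ind (X M\<^sub>1) = N\<^sub>1 \<longrightarrow>
            (\<exists>M\<^sub>2. small_model_in U L U\<^sub>F T M\<^sub>2 \<and> elem_sub L M\<^sub>1 M\<^sub>2 \<and> ind (X M\<^sub>2) = N\<^sub>2))"
proof -
  note [simp] = assms(8-10,13-16)
  let ?X = "realisations U\<^sub>F (s, n) \<chi>"
  interpret fo_structure L' U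
    using assms(1,4) by unfold_locales (simp_all add: monster_def models_def)
  have s: "s \<in> sorts L'" using assms(11) by (simp add: const_lang_def)
  have \<chi>: "wf_fm (const_lang L' F) \<chi>" "fv \<chi> \<subseteq> {(s, n)}" using assms(12) by (auto simp: formulas_def)
  obtain TX QX Vp where TX: "finite TX" "df TX QX" "TX \<subseteq> {0} \<times> fv \<chi> \<union> {1} \<times> {z. (fst z, Vp z) \<in> F}"
    "\<forall>v. sat (const_struct U F) v \<chi> \<longleftrightarrow> QX (\<lambda>t. if t = 0 then v else Vp)"
    by (rule df_of_const_formula[OF assms(6) \<chi>(1)])
  \<comment> \<open>The constants of \<open>\<chi>\<close> have been eliminated in favour of values
    \<open>Vp\<close> in copy 1; giving every non-zero copy the same values is harmless, as
    \<open>TX\<close> mentions only copies 0 and 1.\<close>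
  interpret stable_set L' U F s ?X TX QX "\<lambda>_. Vp"
  proof unfold_locales
    show "saturated L' U" "uncountable (elements U)" using assms(4) by (simp_all add: monster_def)
    have "holds U\<^sub>F [(s, n)] \<chi> [a] \<longleftrightarrow> sat U\<^sub>F (\<lambda>_. a) \<chi>" for a
      using holds_map[of \<chi> "[(s, n)]" U\<^sub>F "\<lambda>_. a"] \<chi>(2) by simp
    moreover have "(\<lambda>_. Vp)(0 := \<lambda>_. a) = (\<lambda>t :: nat. if t = 0 then \<lambda>_. a else Vp)" for a by auto
    ultimately show "?X = {a \<in> carr U s. QX ((\<lambda>_. Vp)(0 := \<lambda>_. a))}"
      using TX(4) by (simp add: realisations_def const_struct_def)
    show "fst z = s" if "(0, z) \<in> TX" for z using that TX(3) \<chi>(2) by auto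
    show "(fst z, Vp z) \<in> F" if "(t, z) \<in> TX" "t \<noteq> 0" for t z using that TX(3) by auto
    show False if "df T Q" "\<And>t z. (t, z) \<in> T \<Longrightarrow> fst z = s" "\<And>i z. (t0, z) \<in> T \<Longrightarrow> A i z \<in> ?X"
        "\<And>j t z. (t, z) \<in> T \<Longrightarrow> t \<noteq> t0 \<Longrightarrow> B j t z \<in> ?X" "\<And>i j :: nat. Q ((B j)(t0 := A i)) \<longleftrightarrow> i < j"
      for T Q t0 A B
      by (rule stable_of_induced[OF _ s that]) (use assms(17) in simp)
  qed (fact assms(5,6) TX(1,2))+
  have inf: "infinite (elements U)" using unc countable_finite by blast
  have sub: "carr N () \<subseteq> ?X" "meets (F \<union> {s} \<times> carr N ()) (carr N ())" "N = ind (carr N ())"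
      "small U ({s} \<times> carr N ())" if "small_model_in U L\<^sub>X (ind (X U\<^sub>F)) T\<^sub>X N" for N
  proof -
    have N: "elem_sub (ind_lang (const_lang L' F) s) N (induced (const_lang L' F) (const_struct U F) s ?X)"
      and small: "small U (elements N)"
      using that by (simp_all add: small_model_in_def)
    show "carr N () \<subseteq> ?X" "meets (F \<union> {s} \<times> carr N ()) (carr N ())" "N = ind (carr N ())"
      using induced_elem_sub[OF N] by simp_all
    have "{s} \<times> carr N () = (\<lambda>p. (s, snd p)) ` elements N" by (force simp: elements_def)
    then show "small U ({s} \<times> carr N ())" using small_image[OF small] by simp
  qed
  have sX: "{s} \<times> N \<subseteq> elements U" if "N \<subseteq> ?X" for N
    using that X_carr by (auto simp: elements_def)
  show ?thesis
  proof (intro conjI allI impI)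
    fix N assume N: "small_model_in U L\<^sub>X (ind (X U\<^sub>F)) T\<^sub>X N"
    let ?B = "F \<union> {s} \<times> carr N ()"
    have B: "?B \<subseteq> elements U" "small U ?B"
      using assms(6,7) sX sub[OF N] small_Un[OF inf] by auto
    obtain M where "small_model_in U (const_lang L' F) (const_struct U F) (Th (const_lang L' F) (const_struct U F)) M"
      "?B \<subseteq> elements M" "realisations M (s, n) \<chi> = carr N ()"
      by (rule model_of_meets[OF assms(2) s _ _ sub(2)[OF N] _ _ B sub(1)[OF N]]) (use assms(12) in auto)
    then show "\<exists>M. small_model_in U L U\<^sub>F T M \<and> N = ind (X M)"
      using sub(3)[OF N] by (intro exI[of _ M]) simp
  next
    fix N1 N2 M1
    assume *: "small_model_in U L\<^sub>X (ind (X U\<^sub>F)) T\<^sub>X N1 \<and> small_model_in U L\<^sub>X (ind (X U\<^sub>F)) T\<^sub>X N2 \<and>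
      elem_sub L\<^sub>X N1 N2 \<and> small_model_in U L U\<^sub>F T M1 \<and> ind (X M1) = N1"
    then have N2: "small_model_in U L\<^sub>X (ind (X U\<^sub>F)) T\<^sub>X N2" by blast
    have M1: "elem_sub (const_lang L' F) M1 (const_struct U F)" "small U (elements M1)"
      using * by (simp_all add: small_model_in_def)
    let ?N1 = "?X \<inter> carr M1 s" and ?N2 = "carr N2 ()"
    have XM1: "realisations M1 (s, n) \<chi> = ?N1"
      using realisations_elem_sub[OF M1(1), of "(s, n)" \<chi>] assms(11,12) by simp
    have "ind (X M1) = N1" using * by blast
    then have N1: "N1 = induced L U\<^sub>F s ?N1" by (simp add: XM1)
    have "elem_sub L\<^sub>X N1 N2" using * by blast
    then have "carr N1 () \<subseteq> carr N2 ()" unfolding elem_sub_def by blast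
    then have N12: "?N1 \<subseteq> ?N2" by (subst (asm) N1) (simp add: induced_def)
    have M1U: "elements M1 \<subseteq> elements U"
      using M1(1) by (auto simp: elem_sub_def elements_def const_struct_def)
    have FM1: "F \<subseteq> elements M1" by (rule const_in_elem_sub[OF M1(1) assms(6)])
    \<comment> \<open>Keeping the whole universe of \<open>M1\<close> among the parameters makes it
      a subset of the new model; as both are elementary in the expanded monster, the inclusion is
      elementary.\<close>
    let ?B = "elements M1 \<union> {s} \<times> ?N2"
    have m: "meets ?B ?N2"
      by (rule meets_union[OF meets_elem_sub[OF M1(1)] FM1 _ M1U sub(2)[OF N2] N12 sub(1)[OF N2]])
        (auto simp: elements_def)
    have B: "F \<subseteq> ?B" "?B \<subseteq> elements U" "small U ?B"
      using FM1 M1U sX[OF sub(1)[OF N2]] small_Un[OF inf M1(2) sub(4)[OF N2]] by auto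
    obtain M2 where M2: "small_model_in U (const_lang L' F) (const_struct U F) (Th (const_lang L' F) (const_struct U F)) M2"
      "?B \<subseteq> elements M2" "realisations M2 (s, n) \<chi> = ?N2"
      by (rule model_of_meets[OF assms(2) s _ _ m B(1) _ B(2,3) sub(1)[OF N2]]) (use assms(12) in auto)
    have "elem_sub (const_lang L' F) M1 M2"
      using M2 by (intro elem_sub_common[OF M1(1)]) (auto simp: small_model_in_def)
    then show "\<exists>M2. small_model_in U L U\<^sub>F T M2 \<and> elem_sub L M1 M2 \<and> ind (X M2) = N2"
      using M2 sub(3)[OF N2] by (intro exI[of _ M2]) simp
  qed
qed

end
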